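(* Let $G=\mathbb Z/4\mathbb Z\star\mathbb Z/4\mathbb Z$, with $a$ and $b$ generators of the two cyclic factors. The minimal set of generators $S=\{a,a^{-1},b,b^{-1}\}$ is not extremal. Indeed, $$Q(S)=\frac{5+\sqrt5}{4}\cdot\frac{\log\bigl(\tfrac12+\tfrac{\sqrt5}{2}\bigr)}{\log(1+\sqrt2)}=0.987686\cdots<1.$$
   Context: For $g\in G$, $|g|_S$ is the word length of $g$ with respect to $S$. For a probability measure $\mu$ on $S$, the random walk $(G,\mu)$ is $X_0=1$, $X_{n+1}=X_n\ast x_n$ with $(x_n)$ i.i.d. of law $\mu$. Drift: the a.s. constant limit $\gamma(S,\mu)=\lim_n|X_n|_S/n$. Entropy: $h(\mu)=\lim_nH(\mu^{*n})/n$, where $H(\lambda)=-\sum_x\lambda(x)\log\lambda(x)$ and $\mu^{*n}$ is the law of $X_n$. Volume: $v(S)=\lim_n\frac1n\log\#\{g\in G:|g|_S=n\}$. Define $$Q(S)=\sup_\mu\frac{h(\mu)}{\gamma(S,\mu)\,v(S)},$$ the supremum being over probability measures $\mu$ on $S$ that are symmetric ($\mu(s)=\mu(s^{-1})$ for all $s\in S$) and satisfy $\bigcup_{n\ge1}\mathrm{supp}\,\mu^{*n}=G$. The set $S$ is called extremal if $Q(S)=1$. *)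

theory Defs
  imports "HOL-Probability.Probability" "HOL-Algebra.Algebra"
begin

section \<open>Free products of two groups\<close>

text \<open>
  The free product is the monoid of words over the disjoint union of the two carriers, divided
  by the congruence that multiplies adjacent letters of the same factor and erases unit letters.
\<close>

abbreviation letters ::
    "('a, 'm) monoid_scheme \<Rightarrow> ('b, 'n) monoid_scheme \<Rightarrow> ('a + 'b) set"
  where "letters G H \<equiv> Sum_Type.Plus (carrier G) (carrier H)"

inductive free_prod_eq ::
    "('a, 'm) monoid_scheme \<Rightarrow> ('b, 'n) monoid_scheme \<Rightarrow> ('a + 'b) list \<Rightarrow> ('a + 'b) list \<Rightarrow> bool"
  for G H
where
  refl: "w \<in> lists (letters G H) \<Longrightarrow> free_prod_eq G H w w"
| sym: "free_prod_eq G H u v \<Longrightarrow> free_prod_eq G H v u"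
| trans: "free_prod_eq G H u v \<Longrightarrow> free_prod_eq G H v w \<Longrightarrow> free_prod_eq G H u w"
| append: "free_prod_eq G H u u' \<Longrightarrow> free_prod_eq G H v v' \<Longrightarrow> free_prod_eq G H (u @ v) (u' @ v')"
| one_left: "free_prod_eq G H [Inl \<one>\<^bsub>G\<^esub>] []"
| one_right: "free_prod_eq G H [Inr \<one>\<^bsub>H\<^esub>] []"
| mult_left: "x \<in> carrier G \<Longrightarrow> y \<in> carrier G \<Longrightarrow>
    free_prod_eq G H [Inl x, Inl y] [Inl (x \<otimes>\<^bsub>G\<^esub> y)]"
| mult_right: "x \<in> carrier H \<Longrightarrow> y \<in> carrier H \<Longrightarrow>
    free_prod_eq G H [Inr x, Inr y] [Inr (x \<otimes>\<^bsub>H\<^esub> y)]"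

definition free_prod_class ::
    "('a, 'm) monoid_scheme \<Rightarrow> ('b, 'n) monoid_scheme \<Rightarrow> ('a + 'b) list \<Rightarrow> ('a + 'b) list set"
  where "free_prod_class G H w = {v. free_prod_eq G H w v}"

definition free_product ::
    "('a, 'm) monoid_scheme \<Rightarrow> ('b, 'n) monoid_scheme \<Rightarrow> ('a + 'b) list set monoid"
  where "free_product G H =
    \<lparr>carrier = free_prod_class G H ` lists (letters G H),
     monoid.mult = (\<lambda>A B. \<Union>u\<in>A. \<Union>v\<in>B. free_prod_class G H (u @ v)),
     one = free_prod_class G H []\<rparr>"

definition free_prod_inl ::
    "('a, 'm) monoid_scheme \<Rightarrow> ('b, 'n) monoid_scheme \<Rightarrow> 'a \<Rightarrow> ('a + 'b) list set"
  where "free_prod_inl G H x = free_prod_class G H [Inl x]"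

definition free_prod_inr ::
    "('a, 'm) monoid_scheme \<Rightarrow> ('b, 'n) monoid_scheme \<Rightarrow> 'b \<Rightarrow> ('a + 'b) list set"
  where "free_prod_inr G H y = free_prod_class G H [Inr y]"

lemma free_prod_class_eq:
  assumes "free_prod_eq G H u v"
  shows "free_prod_class G H u = free_prod_class G H v"
  using assms unfolding free_prod_class_def
  by (blast intro: free_prod_eq.sym free_prod_eq.trans)

lemma free_product_mult_class:
  assumes "u \<in> lists (letters G H)" "v \<in> lists (letters G H)"
  shows "free_prod_class G H u \<otimes>\<^bsub>free_product G H\<^esub> free_prod_class G H v
    = free_prod_class G H (u @ v)"
proof -
  have "free_prod_class G H (u' @ v') = free_prod_class G H (u @ v)"
    if "u' \<in> free_prod_class G H u" "v' \<in> free_prod_class G H v" for u' v'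
    using that by (metis free_prod_class_def free_prod_class_eq free_prod_eq.append mem_Collect_eq)
  moreover have "u \<in> free_prod_class G H u" "v \<in> free_prod_class G H v"
    using assms by (auto simp: free_prod_class_def intro: free_prod_eq.refl)
  ultimately have "(\<Union>u'\<in>free_prod_class G H u. \<Union>v'\<in>free_prod_class G H v.
      free_prod_class G H (u' @ v')) = free_prod_class G H (u @ v)"
    by blast
  then show ?thesis
    by (simp add: free_product_def)
qed

lemma group_free_product:
  assumes "Group.group G" "Group.group H"
  shows "Group.group (free_product G H)"
proof -
  interpret G: Group.group G by fact
  interpret H: Group.group H by fact
  let ?W = "lists (letters G H)"
  let ?c = "free_prod_class G H"
  let ?P = "free_product G H"
  have carr: "carrier ?P = ?c ` ?W" and one: "\<one>\<^bsub>?P\<^esub> = ?c []"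
    by (simp_all add: free_product_def)
  have letter: "\<exists>m \<in> letters G H. free_prod_eq G H [m, l] []"
    if "l \<in> letters G H" for l
    using that
  proof (elim PlusE)
    fix x assume x: "x \<in> carrier G" "l = Inl x"
    have "free_prod_eq G H [Inl (inv\<^bsub>G\<^esub> x), Inl x] [Inl (inv\<^bsub>G\<^esub> x \<otimes>\<^bsub>G\<^esub> x)]"
      using x by (intro free_prod_eq.mult_left) auto
    then have "free_prod_eq G H [Inl (inv\<^bsub>G\<^esub> x), Inl x] []"
      using x by (metis G.l_inv free_prod_eq.one_left free_prod_eq.trans)
    then show ?thesis using x by (metis G.inv_closed InlI)
  next
    fix x assume x: "x \<in> carrier H" "l = Inr x"
    have "free_prod_eq G H [Inr (inv\<^bsub>H\<^esub> x), Inr x] [Inr (inv\<^bsub>H\<^esub> x \<otimes>\<^bsub>H\<^esub> x)]"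
      using x by (intro free_prod_eq.mult_right) auto
    then have "free_prod_eq G H [Inr (inv\<^bsub>H\<^esub> x), Inr x] []"
      using x by (metis H.l_inv free_prod_eq.one_right free_prod_eq.trans)
    then show ?thesis using x by (metis H.inv_closed InrI)
  qed
  have inverse: "\<exists>v \<in> ?W. free_prod_eq G H (v @ w) []" if "w \<in> ?W" for w
    using that
  proof (induction w)
    case Nil
    then show ?case by (auto intro!: bexI[of _ "[]"] free_prod_eq.refl)
  next
    case (Cons l w)
    obtain m where m: "m \<in> letters G H" "free_prod_eq G H [m, l] []"
      using letter Cons.hyps by blast
    obtain v where v: "v \<in> ?W" "free_prod_eq G H (v @ w) []"
      using Cons by blast
    have w: "free_prod_eq G H w w" and vv: "free_prod_eq G H v v"
      using Cons v by (auto intro: free_prod_eq.refl)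
    have "free_prod_eq G H (v @ ([m, l] @ w)) (v @ ([] @ w))"
      by (intro free_prod_eq.append vv w m)
    then have "free_prod_eq G H ((v @ [m]) @ (l # w)) (v @ w)"
      by simp
    then have "free_prod_eq G H ((v @ [m]) @ (l # w)) []"
      using v(2) by (rule free_prod_eq.trans)
    moreover have "v @ [m] \<in> ?W" using v m by auto
    ultimately show ?case by blast
  qed
  show ?thesis
  proof (rule groupI)
    fix A B assume "A \<in> carrier ?P" "B \<in> carrier ?P"
    then obtain u v where "A = ?c u" "B = ?c v" "u \<in> ?W" "v \<in> ?W" unfolding carr by blast
    moreover have "u @ v \<in> ?W" using calculation by auto
    ultimately show "A \<otimes>\<^bsub>?P\<^esub> B \<in> carrier ?P"
      by (simp only: free_product_mult_class carr) blast
  next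
    show "\<one>\<^bsub>?P\<^esub> \<in> carrier ?P" unfolding carr one by blast
  next
    fix A B C assume "A \<in> carrier ?P" "B \<in> carrier ?P" "C \<in> carrier ?P"
    then obtain u v w where *: "A = ?c u" "B = ?c v" "C = ?c w" "u \<in> ?W" "v \<in> ?W" "w \<in> ?W"
      unfolding carr by blast
    moreover have "u @ v \<in> ?W" "v @ w \<in> ?W" using * by auto
    ultimately show "A \<otimes>\<^bsub>?P\<^esub> B \<otimes>\<^bsub>?P\<^esub> C = A \<otimes>\<^bsub>?P\<^esub> (B \<otimes>\<^bsub>?P\<^esub> C)"
      by (simp only: free_product_mult_class append_assoc)
  next
    fix A assume "A \<in> carrier ?P"
    then obtain u where *: "A = ?c u" "u \<in> ?W" unfolding carr by blast
    then show "\<one>\<^bsub>?P\<^esub> \<otimes>\<^bsub>?P\<^esub> A = A"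
      by (simp only: one free_product_mult_class lists.Nil append_Nil)
    obtain v where v: "v \<in> ?W" "free_prod_eq G H (v @ u) []"
      using inverse * by blast
    then have "?c v \<otimes>\<^bsub>?P\<^esub> A = \<one>\<^bsub>?P\<^esub>"
      by (simp only: * one free_product_mult_class free_prod_class_eq[OF v(2)])
    then show "\<exists>B \<in> carrier ?P. B \<otimes>\<^bsub>?P\<^esub> A = \<one>\<^bsub>?P\<^esub>"
      using v carr by blast
  qed
qed


section \<open>Random walks on groups\<close>

text \<open>
  Words only use letters from \<open>S\<close>; this is the word length with respect to \<open>S\<close> for the symmetric
  generating sets considered here. The value is unspecified outside the generated submonoid.
\<close>

definition word_length :: "('g, 'm) monoid_scheme \<Rightarrow> 'g set \<Rightarrow> 'g \<Rightarrow> nat"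
  where "word_length G S g =
    (LEAST n. \<exists>ws. length ws = n \<and> set ws \<subseteq> S \<and> foldr (\<otimes>\<^bsub>G\<^esub>) ws \<one>\<^bsub>G\<^esub> = g)"

definition volume_growth :: "('g, 'm) monoid_scheme \<Rightarrow> 'g set \<Rightarrow> real"
  where "volume_growth G S =
    lim (\<lambda>n. ln (real (card {g \<in> carrier G. word_length G S g = n})) / real n)"

fun walk :: "('g, 'm) monoid_scheme \<Rightarrow> (nat \<Rightarrow> 'g) \<Rightarrow> nat \<Rightarrow> 'g"
  where
    "walk G x 0 = \<one>\<^bsub>G\<^esub>"
  | "walk G x (Suc n) = walk G x n \<otimes>\<^bsub>G\<^esub> x n"

definition increments :: "'g pmf \<Rightarrow> (nat \<Rightarrow> 'g) measure"
  where "increments \<mu> = (\<Pi>\<^sub>M i\<in>(UNIV :: nat set). measure_pmf \<mu>)"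

definition drift :: "('g, 'm) monoid_scheme \<Rightarrow> 'g set \<Rightarrow> 'g pmf \<Rightarrow> real"
  where "drift G S \<mu> =
    (THE c. AE x in increments \<mu>.
       (\<lambda>n. real (word_length G S (walk G x n)) / real n) \<longlonglongrightarrow> c)"

fun conv_power :: "('g, 'm) monoid_scheme \<Rightarrow> 'g pmf \<Rightarrow> nat \<Rightarrow> 'g pmf"
  where
    "conv_power G \<mu> 0 = return_pmf \<one>\<^bsub>G\<^esub>"
  | "conv_power G \<mu> (Suc n) =
       map_pmf (\<lambda>(g, s). g \<otimes>\<^bsub>G\<^esub> s) (pair_pmf (conv_power G \<mu> n) \<mu>)"

definition shannon_entropy :: "'g pmf \<Rightarrow> real"
  where "shannon_entropy \<nu> = - (\<Sum>\<^sub>\<infinity>x. pmf \<nu> x * ln (pmf \<nu> x))"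

definition walk_entropy :: "('g, 'm) monoid_scheme \<Rightarrow> 'g pmf \<Rightarrow> real"
  where "walk_entropy G \<mu> = lim (\<lambda>n. shannon_entropy (conv_power G \<mu> n) / real n)"

definition admissible :: "('g, 'm) monoid_scheme \<Rightarrow> 'g set \<Rightarrow> 'g pmf set"
  where "admissible G S =
    {\<mu>. set_pmf \<mu> \<subseteq> S \<and>
        (\<forall>s\<in>S. pmf \<mu> s = pmf \<mu> (inv\<^bsub>G\<^esub> s)) \<and>
        (\<Union>n\<in>{1..}. set_pmf (conv_power G \<mu> n)) = carrier G}"

text \<open>
  The supremum is taken in the extended reals, so no boundedness or nonemptiness is presupposed.
  A vanishing denominator would give the value 0 by the convention for division; for the walks
  considered here both the drift and the volume growth are positive.
\<close>

definition sup_ratio :: "('g, 'm) monoid_scheme \<Rightarrow> 'g set \<Rightarrow> ereal"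
  where "sup_ratio G S =
    (SUP \<mu>\<in>admissible G S. ereal (walk_entropy G \<mu> / (drift G S \<mu> * volume_growth G S)))"

definition extremal :: "('g, 'm) monoid_scheme \<Rightarrow> 'g set \<Rightarrow> bool"
  where "extremal G S \<longleftrightarrow> sup_ratio G S = 1"

end

(*
An element of the free product is a stack of letters, one per syllable, and right multiplication
by a generator acts on the top of the stack.  The probability that the walk ever hits a stack is a
product of weights of its letters, alpha for an element of order 4 and alpha * w for an involution,
where (alpha, w) depends on the factor.

Hitting probabilities bound the law of the walk pointwise, and their sum over the support of the
n-th step is O(n); hence the entropy of that law is - E ln (hit X_n) up to O(ln n).  Both the word
length and - ln hit are sums of weights over the letters.  Such a sum becomes a martingale with
constant drift and bounded increments after adding a bounded corrector, in which the contribution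
of a letter is discounted by the hitting probability of everything above it.  This gives the limits
of the entropy in mean and of the word length almost surely (exponential moments, Borel-Cantelli),
with explicit values.

The parameters w, z of the two factors satisfy c(w) * c(z) = 1 with c(x) = x(2+x) / (2-x^2).
Optimising under this constraint with a Lagrange multiplier reduces to one real variable, where the
relevant derivative has the sign of a convex function; the optimum is w = z = (sqrt 5 - 1) / 2,
attained by the uniform measure.
*)
theory Submission
  imports Defs "HOL-Real_Asymp.Real_Asymp"
begin

text \<open>Drift and entropy are two values of one functional \<open>speed\<close>, and no ergodic
  theorem or boundary enters: the value is forced by the solvability of a finite linear system for
  the corrector. Hitting probabilities never appear as events. The product \<open>hit\<close> is
  written down, shown to be harmonic away from the empty stack, and compared with the law of the
  walk by induction on time; the symmetry of the measure turns the last step of the walk into the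
  averaging operator. The comparison yields only the lower bound of the entropy. The upper bound
  needs the mass of \<open>hit\<close> on the stacks with k syllables to stay bounded in k. This is
  what c(w) * c(z) = 1 provides, since c is the total weight of the three letters of a factor. The
  quotient of the two rates is not optimised as such. Both contain the same positive prefactor, so
  the claim becomes that the entropy is at most \<open>kap\<close> times the drift. Adding a
  multiple of ln c(w) + ln c(z) = 0 then splits it into two copies of a one-variable
  inequality.\<close>

section \<open>The free product as a set of reduced stacks\<close>

text \<open>
  The head of a stack is the last syllable of the normal form; \<open>True\<close> marks the left factor,
  and the integer is a nonzero residue mod 4.
\<close>

type_synonym stack = "(bool \<times> int) list"

abbreviation "Z4 \<equiv> integer_mod_group 4"
abbreviation "G4 \<equiv> free_product Z4 Z4"

fun enc :: "int + int \<Rightarrow> bool \<times> int" where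
  "enc (Inl x) = (True, x)" | "enc (Inr x) = (False, x)"

definition dec :: "bool \<times> int \<Rightarrow> int + int" where
  "dec l = (if fst l then Inl (snd l) else Inr (snd l))"

definition avoids :: "bool \<Rightarrow> stack \<Rightarrow> bool" where
  "avoids f st \<longleftrightarrow> st = [] \<or> fst (hd st) \<noteq> f"

lemma avoids_simps [simp]: "avoids f []" "avoids f ((g, x) # st) \<longleftrightarrow> g \<noteq> f"
  by (auto simp: avoids_def)

fun reduced :: "stack \<Rightarrow> bool" where
  "reduced [] \<longleftrightarrow> True"
| "reduced ((f, x) # st) \<longleftrightarrow> x \<in> {1, 2, 3} \<and> avoids f st \<and> reduced st"

fun push :: "bool \<times> int \<Rightarrow> stack \<Rightarrow> stack" where
  "push (f, x) [] = (if x = 0 then [] else [(f, x)])"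
| "push (f, x) ((g, y) # st) =
    (if x = 0 then (g, y) # st
     else if f = g then (if (y + x) mod 4 = 0 then st else (f, (y + x) mod 4) # st)
     else (f, x) # (g, y) # st)"

abbreviation push_word :: "(int + int) list \<Rightarrow> stack \<Rightarrow> stack" where
  "push_word w st \<equiv> fold (\<lambda>l. push (enc l)) w st"

definition cls :: "stack \<Rightarrow> (int + int) list set" where
  "cls st = free_prod_class Z4 Z4 (map dec (rev st))"

lemma enc_dec [simp]: "enc (dec l) = l"
  by (cases l) (simp add: dec_def)

lemma dec_enc [simp]: "dec (enc l) = l"
  by (cases l) (simp_all add: dec_def)

lemma carrier_Z4: "carrier Z4 = {0, 1, 2, 3}"
  by (auto simp: carrier_integer_mod_group)

lemma letters_iff: "l \<in> letters Z4 Z4 \<longleftrightarrow> snd (enc l) \<in> {0, 1, 2, 3}"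
  by (cases l) (auto simp: carrier_integer_mod_group)

lemma push_zero [simp]: "push (f, 0) st = st"
  by (cases st) auto

lemma push_avoids: "avoids f st \<Longrightarrow> push (f, x) st = (if x = 0 then st else (f, x) # st)"
  by (cases st) auto

lemma reduced_push:
  assumes "reduced st" "x \<in> {0, 1, 2, 3}"
  shows "reduced (push (f, x) st)"
proof (cases "avoids f st")
  case True
  then show ?thesis using assms by (auto simp: push_avoids)
next
  case False
  then obtain y st' where "st = (f, y) # st'" by (cases st) auto
  then show ?thesis using assms by auto
qed

lemma push_push:
  assumes "reduced st" "x \<in> {0, 1, 2, 3}" "y \<in> {0, 1, 2, 3}"
  shows "push (f, y) (push (f, x) st) = push (f, (x + y) mod 4) st"
proof -
  have x: "x = 0 \<or> x = 1 \<or> x = 2 \<or> x = 3" and y: "y = 0 \<or> y = 1 \<or> y = 2 \<or> y = 3"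
    using assms by auto
  show ?thesis
  proof (cases "avoids f st")
    case True
    show ?thesis using x y by (elim disjE) (simp_all add: push_avoids True)
  next
    case False
    then obtain z st' where st: "st = (f, z) # st'" by (cases st) auto
    then have "z = 1 \<or> z = 2 \<or> z = 3" and a: "avoids f st'" using assms(1) by auto
    then show ?thesis using x y unfolding st by (elim disjE) (simp_all add: push_avoids a)
  qed
qed

text \<open>Van der Waerden's argument: letters act on reduced stacks, and this action respects
  every defining relation, hence the whole congruence. Applied to the empty stack it separates
  distinct normal forms.\<close>

lemma free_prod_eq_push_word:
  assumes "free_prod_eq Z4 Z4 u v"
  shows "u \<in> lists (letters Z4 Z4) \<and> v \<in> lists (letters Z4 Z4) \<and>
    (\<forall>st. reduced st \<longrightarrow> push_word u st = push_word v st \<and> reduced (push_word u st))"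
  using assms
proof induction
  case (refl w)
  have "reduced (push_word w st)" if "reduced st" for st
    using refl that
  proof (induction w arbitrary: st)
    case (Cons l w)
    then have "snd (enc l) \<in> {0, 1, 2, 3}" by (simp only: letters_iff[symmetric] Cons_in_lists_iff)
    then have "reduced (push (enc l) st)" using Cons.prems reduced_push by (metis prod.collapse)
    then show ?case using Cons by simp
  qed simp
  then show ?case using refl by blast
next
  case (mult_left x y)
  then have xy: "x \<in> {0, 1, 2, 3}" "y \<in> {0, 1, 2, 3}" by (simp_all only: carrier_Z4)
  then have m: "(x + y) mod 4 \<in> {0, 1, 2, 3}" by auto
  show ?case
    using push_push[OF _ xy, of _ True] reduced_push[OF _ m, of _ True] xy m
    by (auto simp: carrier_Z4 simp del: insert_iff)
next
  case (mult_right x y)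
  then have xy: "x \<in> {0, 1, 2, 3}" "y \<in> {0, 1, 2, 3}" by (simp_all only: carrier_Z4)
  then have m: "(x + y) mod 4 \<in> {0, 1, 2, 3}" by auto
  show ?case
    using push_push[OF _ xy, of _ False] reduced_push[OF _ m, of _ False] xy m
    by (auto simp: carrier_Z4 simp del: insert_iff)
qed (auto simp: carrier_integer_mod_group)

lemma map_dec_rev_in_lists: "reduced st \<Longrightarrow> map dec (rev st) \<in> lists (letters Z4 Z4)"
  by (induction st rule: reduced.induct) (auto simp: letters_iff dec_def carrier_integer_mod_group)

lemma push_word_map_dec_rev: "reduced st \<Longrightarrow> push_word (map dec (rev st)) [] = st"
  by (induction st rule: reduced.induct) (auto simp: push_avoids)

lemma cls_inject:
  assumes "reduced st" "reduced st'"
  shows "cls st = cls st' \<longleftrightarrow> st = st'"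
proof
  assume "cls st = cls st'"
  then have "free_prod_eq Z4 Z4 (map dec (rev st)) (map dec (rev st'))"
    using free_prod_eq.refl[OF map_dec_rev_in_lists[OF assms(2)]]
    unfolding cls_def free_prod_class_def by blast
  then have "push_word (map dec (rev st)) [] = push_word (map dec (rev st')) []"
    using free_prod_eq_push_word by fastforce
  then show "st = st'" using assms by (simp only: push_word_map_dec_rev)
qed simp

lemma free_prod_eq_dec_zero: "free_prod_eq Z4 Z4 [dec (f, 0)] []"
  using free_prod_eq.one_left[of Z4 Z4] free_prod_eq.one_right[of Z4 Z4] by (simp add: dec_def)

lemma free_prod_eq_dec_mult:
  assumes "x \<in> {0, 1, 2, 3}" "y \<in> {0, 1, 2, 3}"
  shows "free_prod_eq Z4 Z4 [dec (f, x), dec (f, y)] [dec (f, (x + y) mod 4)]"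
proof (cases f)
  case True
  then show ?thesis using assms free_prod_eq.mult_left[of x Z4 y Z4]
    by (simp add: dec_def carrier_Z4 del: insert_iff)
next
  case False
  then show ?thesis using assms free_prod_eq.mult_right[of x Z4 y Z4]
    by (simp add: dec_def carrier_Z4 del: insert_iff)
qed

text \<open>The converse direction: a push changes the word only by a multiplication at its end or
  by the erasure of a unit letter, so every class contains a normal form.\<close>

lemma free_prod_eq_push:
  assumes "reduced st" "x \<in> {0, 1, 2, 3}"
  shows "free_prod_eq Z4 Z4 (map dec (rev st) @ [dec (f, x)]) (map dec (rev (push (f, x) st)))"
proof (cases "avoids f st")
  case True
  have w: "free_prod_eq Z4 Z4 (map dec (rev st)) (map dec (rev st))"
    using assms by (intro free_prod_eq.refl map_dec_rev_in_lists)
  show ?thesis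
  proof (cases "x = 0")
    case True
    then show ?thesis
      using free_prod_eq.append[OF w free_prod_eq_dec_zero[of f]] by simp
  next
    case False
    have "dec (f, x) \<in> letters Z4 Z4" using assms by (auto simp: letters_iff)
    then have "free_prod_eq Z4 Z4 [dec (f, x)] [dec (f, x)]" by (intro free_prod_eq.refl) auto
    from free_prod_eq.append[OF w this] show ?thesis
      using False \<open>avoids f st\<close> by (simp add: push_avoids)
  qed
next
  case False
  then obtain y st' where st: "st = (f, y) # st'" by (cases st) auto
  then have y': "y \<in> {1, 2, 3}" and r: "reduced st'" using assms by auto
  then have y: "y \<in> {0, 1, 2, 3}" by blast
  have w: "free_prod_eq Z4 Z4 (map dec (rev st')) (map dec (rev st'))"
    using r by (intro free_prod_eq.refl map_dec_rev_in_lists)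
  have 1: "free_prod_eq Z4 Z4 (map dec (rev st) @ [dec (f, x)]) (map dec (rev st') @ [dec (f, (y + x) mod 4)])"
    using free_prod_eq.append[OF w free_prod_eq_dec_mult[OF y assms(2), of f]] st by simp
  show ?thesis
  proof (cases "(y + x) mod 4 = 0")
    case True
    have "free_prod_eq Z4 Z4 (map dec (rev st') @ [dec (f, (y + x) mod 4)]) (map dec (rev st'))"
      using free_prod_eq.append[OF w free_prod_eq_dec_zero[of f]] True by simp
    moreover have "x \<noteq> 0" using y' True by auto
    then have "push (f, x) st = st'" using True st by simp
    ultimately show ?thesis using 1 free_prod_eq.trans by metis
  next
    case False
    have "y mod 4 = y" using y' by auto
    then have "push (f, x) st = (f, (y + x) mod 4) # st'" using False st by simp
    then show ?thesis using 1 by simp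
  qed
qed

lemma cls_mult:
  assumes "reduced st" "x \<in> {0, 1, 2, 3}"
  shows "cls st \<otimes>\<^bsub>G4\<^esub> free_prod_class Z4 Z4 [dec (f, x)] = cls (push (f, x) st)"
proof -
  have "[dec (f, x)] \<in> lists (letters Z4 Z4)" using assms by (auto simp: letters_iff)
  then show ?thesis
    unfolding cls_def using free_product_mult_class[OF map_dec_rev_in_lists[OF assms(1)]]
      free_prod_class_eq[OF free_prod_eq_push[OF assms, of f]] by simp
qed

lemma cls_singleton: "cls [l] = free_prod_class Z4 Z4 [dec l]"
  by (simp add: cls_def)

lemma one_G4: "\<one>\<^bsub>G4\<^esub> = cls []"
  by (simp add: cls_def free_product_def)

lemma carrier_G4: "carrier G4 = cls ` {st. reduced st}"
proof (intro subset_antisym subsetI)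
  fix g assume "g \<in> carrier G4"
  then obtain w where w: "w \<in> lists (letters Z4 Z4)" "g = free_prod_class Z4 Z4 w"
    unfolding free_product_def by auto
  from w(1) have "\<exists>st. reduced st \<and> free_prod_class Z4 Z4 w = cls st"
  proof (induction w rule: rev_induct)
    case Nil
    show ?case by (intro exI[of _ "[]"]) (simp add: cls_def)
  next
    case (snoc l w)
    then obtain st where st: "reduced st" "free_prod_class Z4 Z4 w = cls st" by auto
    obtain f x where l: "l = dec (f, x)" by (metis dec_enc prod.exhaust)
    have x: "x \<in> {0, 1, 2, 3}" using snoc.prems l letters_iff[of l] by simp
    have "free_prod_class Z4 Z4 (w @ [l]) = cls (push (f, x) st)"
      using free_product_mult_class[of w Z4 Z4 "[l]"] snoc.prems st cls_mult[OF st(1) x, of f] l by simp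
    then show ?case using reduced_push[OF st(1) x] by blast
  qed
  then show "g \<in> cls ` {st. reduced st}" using w by blast
next
  fix g assume "g \<in> cls ` {st. reduced st}"
  then show "g \<in> carrier G4"
    using map_dec_rev_in_lists unfolding free_product_def cls_def by auto
qed

lemma group_G4: "Group.group G4"
  by (intro group_free_product) simp_all

section \<open>The four generators as letters\<close>

definition gens :: "(bool \<times> int) set" where
  "gens = {(True, 1), (True, 3), (False, 1), (False, 3)}"

lemma gens_iff: "(f, x) \<in> gens \<longleftrightarrow> x \<in> {1, 3}"
  by (cases f) (auto simp: gens_def)

abbreviation S4 :: "(int + int) list set set" where
  "S4 \<equiv> (\<lambda>l. cls [l]) ` gens"

lemma cls_mult_gen:
  "reduced st \<Longrightarrow> l \<in> gens \<Longrightarrow> cls st \<otimes>\<^bsub>G4\<^esub> cls [l] = cls (push l st)"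
  using cls_mult[of st "snd l" "fst l"] by (cases l) (auto simp: cls_singleton gens_iff)

lemma reduced_push_gen: "reduced st \<Longrightarrow> l \<in> gens \<Longrightarrow> reduced (push l st)"
  using reduced_push by (cases l) (auto simp: gens_iff)

lemma cls_in_carrier: "reduced st \<Longrightarrow> cls st \<in> carrier G4"
  unfolding carrier_G4 by blast

lemma inv_cls_gen:
  assumes "x \<in> {1, 3}"
  shows "inv\<^bsub>G4\<^esub> (cls [(f, x)]) = cls [(f, 4 - x)]"
proof -
  interpret Group.group G4 by (rule group_G4)
  have x: "x = 1 \<or> x = 3" using assms by simp
  then have r: "reduced [(f, x)]" "reduced [(f, 4 - x)]" by auto
  have "push (f, x) [(f, 4 - x)] = []" using x by auto
  then have "cls [(f, 4 - x)] \<otimes>\<^bsub>G4\<^esub> cls [(f, x)] = \<one>\<^bsub>G4\<^esub>"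
    using cls_mult_gen[OF r(2), of "(f, x)"] assms by (simp only: gens_iff one_G4)
  then show ?thesis using r by (intro inv_equality) (simp_all only: cls_in_carrier)
qed

lemma generator_Z4:
  assumes "s \<in> carrier Z4" "generate Z4 {s} = carrier Z4"
  shows "s \<in> {1, 3}"
proof (rule ccontr)
  assume "s \<notin> {1, 3}"
  then have s: "s \<in> {0, 2}" using assms(1) by (auto simp: carrier_integer_mod_group)
  have "subgroup {0, 2} Z4"
    by (intro group.subgroupI) (auto simp: carrier_integer_mod_group)
  then have "generate Z4 {s} \<subseteq> {0, 2}"
    using s by (intro group.generate_subgroup_incl) auto
  then have "{0, 1, 2, 3} \<subseteq> {0, 2 :: int}" unfolding assms(2) carrier_Z4 .
  then show False by simp
qed

text \<open>Inversion exchanges the residues 1 and 3, so the set does not depend on the chosen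
  generators of the cyclic factors.\<close>

lemma generating_set_eq:
  assumes "s \<in> {1, 3}" "t \<in> {1, 3}"
    and "a = free_prod_inl Z4 Z4 s" "b = free_prod_inr Z4 Z4 t"
  shows "{a, inv\<^bsub>G4\<^esub> a, b, inv\<^bsub>G4\<^esub> b} = S4"
proof -
  have "a = cls [(True, s)]" "b = cls [(False, t)]"
    using assms by (simp_all add: cls_singleton dec_def free_prod_inl_def free_prod_inr_def)
  then show ?thesis using assms(1,2) by (auto simp: inv_cls_gen gens_def)
qed

subsection \<open>Word length and volume growth\<close>

fun len :: "stack \<Rightarrow> nat" where
  "len [] = 0"
| "len (l # st) = (if snd l = 2 then 2 else 1) + len st"

lemma len_push_le: "reduced st \<Longrightarrow> l \<in> gens \<Longrightarrow> len (push l st) \<le> len st + 1"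
  by (cases st; cases l) (auto simp: gens_iff)

text \<open>\<open>word_length\<close> multiplies a word as a right-nested product, while a stack
  absorbs the letters from left to right; associativity (\<open>foldr_snoc\<close>) reconciles the
  two. The last conjunct is the lower bound for the word length.\<close>

lemma foldr_mult_gens:
  "set ls \<subseteq> gens \<Longrightarrow> foldr (\<otimes>\<^bsub>G4\<^esub>) (map (\<lambda>l. cls [l]) ls) \<one>\<^bsub>G4\<^esub> = cls (fold push ls [])
    \<and> reduced (fold push ls []) \<and> len (fold push ls []) \<le> length ls"
proof (induction ls rule: rev_induct)
  case (snoc l ls)
  interpret Group.group G4 by (rule group_G4)
  have c: "cls [l] \<in> carrier G4" if "l \<in> gens" for l
    using that by (cases l) (auto simp: gens_iff intro!: cls_in_carrier)
  have cf: "foldr (\<otimes>\<^bsub>G4\<^esub>) ws \<one>\<^bsub>G4\<^esub> \<in> carrier G4" if "set ws \<subseteq> carrier G4" for ws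
    using that by (induction ws) auto
  have foldr_snoc: "foldr (\<otimes>\<^bsub>G4\<^esub>) ws g = foldr (\<otimes>\<^bsub>G4\<^esub>) ws \<one>\<^bsub>G4\<^esub> \<otimes>\<^bsub>G4\<^esub> g"
    if "set ws \<subseteq> carrier G4" "g \<in> carrier G4" for ws g
    using that by (induction ws) (auto simp: m_assoc cf)
  have "foldr (\<otimes>\<^bsub>G4\<^esub>) (map (\<lambda>l. cls [l]) (ls @ [l])) \<one>\<^bsub>G4\<^esub>
    = foldr (\<otimes>\<^bsub>G4\<^esub>) (map (\<lambda>l. cls [l]) ls) (cls [l])"
    using snoc.prems c by simp
  also have "\<dots> = cls (fold push ls []) \<otimes>\<^bsub>G4\<^esub> cls [l]"
    using snoc c by (subst foldr_snoc) auto
  also have "\<dots> = cls (push l (fold push ls []))"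
    using snoc by (intro cls_mult_gen) auto
  finally show ?case
    using snoc reduced_push_gen[of "fold push ls []" l] len_push_le[of "fold push ls []" l] by auto
qed (simp add: one_G4)

lemma ex_gens_word: "reduced st \<Longrightarrow> \<exists>ls. set ls \<subseteq> gens \<and> length ls = len st \<and> fold push ls [] = st"
proof (induction st rule: reduced.induct)
  case (2 f x st)
  then obtain ls where ls: "set ls \<subseteq> gens" "length ls = len st" "fold push ls [] = st" by auto
  show ?case
  proof (cases "x = 2")
    case True
    then show ?thesis using 2 ls
      by (intro exI[of _ "ls @ [(f, 1), (f, 1)]"]) (auto simp: gens_iff push_avoids)
  next
    case False
    then show ?thesis using 2 ls
      by (intro exI[of _ "ls @ [(f, x)]"]) (auto simp: gens_iff push_avoids)
  qed
qed simp

lemma word_length_cls: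
  assumes "reduced st"
  shows "word_length G4 S4 (cls st) = len st"
  unfolding word_length_def
proof (rule Least_equality)
  obtain ls where "set ls \<subseteq> gens" "length ls = len st" "fold push ls [] = st"
    using ex_gens_word[OF assms] by blast
  then show "\<exists>ws. length ws = len st \<and> set ws \<subseteq> S4 \<and> foldr (\<otimes>\<^bsub>G4\<^esub>) ws \<one>\<^bsub>G4\<^esub> = cls st"
    using foldr_mult_gens[of ls] by (intro exI[of _ "map (\<lambda>l. cls [l]) ls"]) auto
next
  fix n assume "\<exists>ws. length ws = n \<and> set ws \<subseteq> S4 \<and> foldr (\<otimes>\<^bsub>G4\<^esub>) ws \<one>\<^bsub>G4\<^esub> = cls st"
  then obtain ws where ws: "length ws = n" "set ws \<subseteq> S4" "foldr (\<otimes>\<^bsub>G4\<^esub>) ws \<one>\<^bsub>G4\<^esub> = cls st" by blast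
  then have "ws \<in> lists S4" by auto
  then obtain ls where ls: "set ls \<subseteq> gens" "ws = map (\<lambda>l. cls [l]) ls"
    unfolding lists_image by (auto simp: lists_eq_set)
  then have "cls (fold push ls []) = cls st" "reduced (fold push ls [])"
    using foldr_mult_gens[of ls] ws by auto
  then have "fold push ls [] = st" using assms by (simp add: cls_inject)
  then show "len st \<le> n" using foldr_mult_gens[of ls] ls ws by auto
qed

text \<open>The sphere sizes 1, 2, 5, 12, ... once the factor of the top letter is prescribed: the
  top is one of two generators, or the involution, which costs two.\<close>

fun pell :: "nat \<Rightarrow> nat" where
  "pell 0 = 1" | "pell (Suc 0) = 2" | "pell (Suc (Suc n)) = 2 * pell (Suc n) + pell n"

definition sphere :: "bool \<Rightarrow> nat \<Rightarrow> stack set" where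
  "sphere f n = {st. reduced st \<and> len st = n \<and> avoids f st}"

lemma sphere_0: "sphere f 0 = {[]}"
proof -
  have "st = []" if "len st = 0" for st using that by (cases st) (auto split: if_splits)
  then show ?thesis by (auto simp: sphere_def)
qed

lemma sphere_1: "sphere f (Suc 0) = {[(\<not> f, 1)], [(\<not> f, 3)]}"
proof -
  have e: "st = []" if "len st = 0" for st using that by (cases st) (auto split: if_splits)
  have "st \<in> {[(\<not> f, 1)], [(\<not> f, 3)]}" if "st \<in> sphere f (Suc 0)" for st
    using that by (cases st) (auto simp: sphere_def split: if_splits dest: e)
  then show ?thesis by (auto simp: sphere_def)
qed

lemma sphere_Suc_Suc:
  "sphere f (Suc (Suc n)) = (Cons (\<not> f, 1) ` sphere (\<not> f) (Suc n) \<union> Cons (\<not> f, 3) ` sphere (\<not> f) (Suc n))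
     \<union> Cons (\<not> f, 2) ` sphere (\<not> f) n" (is "?L = ?R")
proof (intro subset_antisym subsetI)
  fix st assume st: "st \<in> ?L"
  then obtain g x st' where e: "st = (g, x) # st'" by (cases st) (auto simp: sphere_def)
  have g: "g = (\<not> f)" and x: "x = 1 \<or> x = 2 \<or> x = 3" and r: "reduced st'" "avoids (\<not> f) st'"
    using st unfolding sphere_def e by auto
  have "len st' = (if x = 2 then n else Suc n)" using st x unfolding sphere_def e by auto
  then have "st' \<in> sphere (\<not> f) (if x = 2 then n else Suc n)" using r by (simp add: sphere_def)
  then show "st \<in> ?R" using x unfolding e g by (elim disjE) simp_all
next
  fix st assume "st \<in> ?R"
  then show "st \<in> ?L" unfolding sphere_def by (elim UnE imageE) simp_all
qed

lemma card_sphere: "finite (sphere f n) \<and> card (sphere f n) = pell n"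
proof (induction n arbitrary: f rule: pell.induct)
  case (3 n)
  let ?A = "\<lambda>x k. Cons (\<not> f, x) ` sphere (\<not> f) k"
  have fin: "finite (?A x (Suc n))" "finite (?A x n)" for x using 3 by simp_all
  have c: "card (?A x (Suc n)) = pell (Suc n)" "card (?A x n) = pell n" for x
    using 3 by (simp_all add: card_image)
  have d: "?A 1 (Suc n) \<inter> ?A 3 (Suc n) = {}" "(?A 1 (Suc n) \<union> ?A 3 (Suc n)) \<inter> ?A 2 n = {}"
    by auto
  have "card (?A 1 (Suc n) \<union> ?A 3 (Suc n) \<union> ?A 2 n) = pell (Suc n) + pell (Suc n) + pell n"
    unfolding card_Un_disjoint[OF finite_UnI[OF fin(1) fin(1)] fin(2) d(2)] card_Un_disjoint[OF fin(1) fin(1) d(1)] c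
    by (rule HOL.refl)
  then show ?case using fin unfolding sphere_Suc_Suc by (simp only: finite_Un pell.simps) simp
next
  case 2
  show ?case unfolding sphere_1 pell.simps by simp
qed (simp add: sphere_0)

lemma card_sphere_G4:
  assumes "n > 0"
  shows "card {g \<in> carrier G4. word_length G4 S4 g = n} = 2 * pell n"
proof -
  let ?R = "{st. reduced st \<and> len st = n}"
  have mem: "g \<in> {g \<in> carrier G4. word_length G4 S4 g = n} \<longleftrightarrow> g \<in> cls ` ?R" for g
  proof
    assume "g \<in> {g \<in> carrier G4. word_length G4 S4 g = n}"
    then have c: "g \<in> carrier G4 \<and> word_length G4 S4 g = n" by (rule CollectD)
    then have l: "word_length G4 S4 g = n" by (rule conjunct2)
    obtain st where st: "g = cls st" "reduced st"
      using conjunct1[OF c] unfolding carrier_G4 by (elim imageE CollectE)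
    then have "st \<in> ?R" using l unfolding st(1) word_length_cls[OF st(2)] by (intro CollectI conjI)
    then show "g \<in> cls ` ?R" unfolding st(1) by (rule imageI)
  next
    assume "g \<in> cls ` ?R"
    then obtain st where st: "g = cls st" "reduced st" "len st = n" by (elim imageE CollectE conjE)
    show "g \<in> {g \<in> carrier G4. word_length G4 S4 g = n}"
      unfolding st(1) mem_Collect_eq word_length_cls[OF st(2)] using cls_in_carrier[OF st(2)] st(3) by (intro conjI)
  qed
  have "{g \<in> carrier G4. word_length G4 S4 g = n} = cls ` ?R"
    by (rule Set.set_eqI) (rule mem)
  also have "card \<dots> = card ?R"
    by (intro card_image inj_onI) (simp only: mem_Collect_eq cls_inject)
  also have "?R = sphere True n \<union> sphere False n"
    unfolding sphere_def avoids_def by blast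
  also have "card \<dots> = card (sphere True n) + card (sphere False n)"
  \<comment> \<open>Only the empty stack avoids both factors, and its length is 0; this is where n >
    0 enters.\<close>
  proof (rule card_Un_disjoint)
    have "\<not> (avoids True st \<and> avoids False st)" if "len st = n" for st
      using that assms by (cases st) auto
    then show "sphere True n \<inter> sphere False n = {}" unfolding sphere_def by blast
  qed (rule card_sphere[THEN conjunct1])+
  finally show ?thesis using card_sphere[of True n] card_sphere[of False n] by simp
qed

text \<open>The base is the positive root of the characteristic equation r * r = 2 * r + 1, so both
  bounds obey the recursion of \<open>pell\<close> and need checking only for n = 0 and n =
  1.\<close>

lemma pell_bounds: "(1 + sqrt 2) ^ n / 2 \<le> real (pell n) \<and> real (pell n) \<le> (1 + sqrt 2) ^ n"
proof -
  define r where "r = 1 + sqrt 2"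
  have s: "1 \<le> sqrt 2" by (rule real_le_rsqrt) simp
  have s': "sqrt 2 \<le> 2" by (rule real_le_lsqrt) simp_all
  have r: "2 \<le> r" "r \<le> 4" unfolding r_def using s s' by linarith+
  have "sqrt 2 * sqrt 2 = 2" by simp
  then have rr: "r * r = 2 * r + 1" unfolding r_def distrib_left distrib_right by linarith
  have "r ^ n / 2 \<le> real (pell n) \<and> real (pell n) \<le> r ^ n"
  proof (induction n rule: pell.induct)
    case 1
    show ?case by simp
  next
    case 2
    show ?case using r by (simp only: pell.simps power_Suc power_0) simp
  next
    case (3 n)
    have "r ^ Suc (Suc n) = r ^ n * (r * r)" by (simp only: power_Suc ac_simps)
    also have "\<dots> = 2 * r ^ Suc n + r ^ n" unfolding rr by (simp only: power_Suc distrib_left mult_1_right ac_simps)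
    finally have e: "r ^ Suc (Suc n) = 2 * r ^ Suc n + r ^ n" .
    have d: "real (pell (Suc (Suc n))) = 2 * real (pell (Suc n)) + real (pell n)" by simp
    define A B where "A = r ^ Suc n" and "B = r ^ n"
    have "2 * A + B \<ge> real (pell (Suc (Suc n)))" "(2 * A + B) / 2 \<le> real (pell (Suc (Suc n)))"
      using 3 d unfolding A_def[symmetric] B_def[symmetric] by (simp_all del: pell.simps)
    then show ?case unfolding e A_def[symmetric] B_def[symmetric] by (rule conjI[rotated])
  qed
  then show ?thesis by (simp only: r_def)
qed

lemma volume_growth_G4: "volume_growth G4 S4 = ln (1 + sqrt 2)"
proof -
  define r where "r = 1 + sqrt 2"
  define B where "B n = card {g \<in> carrier G4. word_length G4 S4 g = n}" for n
  have B: "B n = 2 * pell n" if "n > 0" for n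
    unfolding B_def using that by (rule card_sphere_G4)
  have r: "0 < r" unfolding r_def by (simp add: add_pos_pos)
  have b: "ln r \<le> ln (real (B n)) / real n \<and> ln (real (B n)) / real n \<le> ln r + ln 2 / real n"
    if "n > 0" for n
  proof -
    have p: "0 < r ^ n" using r by simp
    have 1: "r ^ n \<le> real (B n)" "real (B n) \<le> 2 * r ^ n"
      using pell_bounds[of n] unfolding r_def[symmetric] B[OF that] of_nat_mult of_nat_numeral by linarith+
    have "ln (r ^ n) \<le> ln (real (B n))"
      by (rule ln_mono[OF 1(1) p])
    moreover have "ln (real (B n)) \<le> ln (2 * r ^ n)"
      by (rule ln_mono[OF 1(2) less_le_trans[OF p 1(1)]])
    moreover have "ln (2 * r ^ n) = ln 2 + ln (r ^ n)"
      using p by (intro ln_mult_pos) simp_all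
    moreover have "ln (r ^ n) = real n * ln r" by (rule ln_realpow)
    ultimately show ?thesis using that by (simp add: field_simps)
  qed
  have "(\<lambda>n. ln r + ln 2 / real n) \<longlonglongrightarrow> ln r + 0"
    by (intro tendsto_add tendsto_const lim_const_over_n)
  then have u: "(\<lambda>n. ln r + ln 2 / real n) \<longlonglongrightarrow> ln r" by simp
  have "(\<lambda>n. ln (real (B n)) / real n) \<longlonglongrightarrow> ln r"
  proof (rule tendsto_sandwich[OF _ _ tendsto_const u])
    show "\<forall>\<^sub>F n in sequentially. ln r \<le> ln (real (B n)) / real n"
      using b by (intro eventually_sequentiallyI[of 1]) simp
    show "\<forall>\<^sub>F n in sequentially. ln (real (B n)) / real n \<le> ln r + ln 2 / real n"
      using b by (intro eventually_sequentiallyI[of 1]) simp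
  qed
  then show ?thesis unfolding volume_growth_def B_def[symmetric] r_def by (rule limI)
qed

section \<open>Numerical bounds\<close>

lemma sum_lessThan_9: "(\<Sum>k<9. f k) = f 0 + f 1 + f 2 + f 3 + f 4 + f 5 + f 6 + f 7 + f 8"
  for f :: "nat \<Rightarrow> real" by (simp add: eval_nat_numeral)

lemma sum_lessThan_13: "(\<Sum>k<13. f k) = f 0 + f 1 + f 2 + f 3 + f 4 + f 5 + f 6 + f 7 + f 8 + f 9 + f 10 + f 11 + f 12"
  for f :: "nat \<Rightarrow> real" by (simp add: eval_nat_numeral)

text \<open>
  In the series of \<^term>\<open>ln\<close> in powers of \<open>(x - 1) / (x + 1)\<close>, the argument is \<open>sqrt 5 - 2\<close> for the golden
  ratio and \<open>sqrt 2 - 1\<close> for \<open>1 + sqrt 2\<close>, so the partial sums are linear in the square root.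
\<close>

lemma ln_golden_bounds:
  "0.4812118250 < ln (1 / 2 + sqrt 5 / 2)" "ln (1 / 2 + sqrt 5 / 2) < 0.4812118251"
proof -
  define s :: real where "s = sqrt 5"
  define y where "y = (1 / 2 + sqrt 5 / 2 - 1) / (1 / 2 + sqrt 5 / 2 + 1)"
  have ss: "s * s = 5" by (simp add: s_def)
  \<comment> \<open>The powers below become a + b * s with integers up to about 4 * 10^11 and values
    down to about 10^(-12); the cancellation consumes more than twenty digits of s.\<close>
  have s: "2.23606797749978969640917366 < s" "s < 2.23606797749978969640917367" unfolding s_def
    by (rule real_less_rsqrt real_less_lsqrt; simp add: power2_eq_square)+
  have y: "y = s - 2" unfolding y_def s_def[symmetric] using ss s by (simp add: field_simps)
  have z: "y\<^sup>2 = 9 - 4 * s" unfolding y power2_eq_square using ss by (simp add: algebra_simps)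
  have step: "y ^ (m + 2) = (9 * a - 20 * b) + (9 * b - 4 * a) * s" if "y ^ m = a + b * s" for m a b
  proof -
    have "y ^ (m + 2) = y ^ m * y\<^sup>2" by (rule power_add)
    also have "\<dots> = 9 * a - 4 * b * (s * s) + (9 * b - 4 * a) * s"
      unfolding that z by (simp add: algebra_simps)
    finally show ?thesis unfolding ss by simp
  qed
  have p1: "y ^ 1 = (-2) + 1 * s" using y by simp
  have p3: "y ^ 3 = (-38) + (17) * s" using step[OF p1] by (simp add: power3_eq_cube)
  have p5: "y ^ 5 = (-682) + (305) * s" using step[OF p3] by simp
  have p7: "y ^ 7 = (-12238) + (5473) * s" using step[OF p5] by simp
  have p9: "y ^ 9 = (-219602) + (98209) * s" using step[OF p7] by simp
  have p11: "y ^ 11 = (-3940598) + (1762289) * s" using step[OF p9] by simp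
  have p13: "y ^ 13 = (-70711162) + (31622993) * s" using step[OF p11] by simp
  have p15: "y ^ 15 = (-1268860318) + (567451585) * s" using step[OF p13] by simp
  have p17: "y ^ 17 = (-22768774562) + (10182505537) * s" using step[OF p15] by simp
  have p19: "y ^ 19 = (-408569081798) + (182717648081) * s" using step[OF p17] by simp
  have d: "y ^ 19 / (1 - y\<^sup>2) / 19 < 1 / 10 ^ 11"
    unfolding p19 z using s by (simp add: divide_less_eq)
  have "ln (1 / 2 + sqrt 5 / 2) \<in> {(\<Sum>j<9. 2 * y ^ (2 * j + 1) / of_nat (2 * j + 1))..(\<Sum>j<9. 2 * y ^ (2 * j + 1) / of_nat (2 * j + 1))
      + 2 * (y ^ (2 * 9 + 1) / (1 - y\<^sup>2) / of_nat (2 * 9 + 1))}"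
    unfolding y_def by (rule ln_approx_bounds) (use s in \<open>simp add: s_def\<close>)
  moreover have "(\<Sum>j<9. 2 * y ^ (2 * j + 1) / of_nat (2 * j + 1)) = 2 * y ^ 1 / 1 + 2 * y ^ 3 / 3 + 2 * y ^ 5 / 5 + 2 * y ^ 7 / 7 + 2 * y ^ 9 / 9 + 2 * y ^ 11 / 11 + 2 * y ^ 13 / 13 + 2 * y ^ 15 / 15 + 2 * y ^ 17 / 17"
    unfolding sum_lessThan_9 by simp
  ultimately have "2 * y ^ 1 / 1 + 2 * y ^ 3 / 3 + 2 * y ^ 5 / 5 + 2 * y ^ 7 / 7 + 2 * y ^ 9 / 9 + 2 * y ^ 11 / 11 + 2 * y ^ 13 / 13 + 2 * y ^ 15 / 15 + 2 * y ^ 17 / 17 \<le> ln (1 / 2 + sqrt 5 / 2)" "ln (1 / 2 + sqrt 5 / 2) \<le> 2 * y ^ 1 / 1 + 2 * y ^ 3 / 3 + 2 * y ^ 5 / 5 + 2 * y ^ 7 / 7 + 2 * y ^ 9 / 9 + 2 * y ^ 11 / 11 + 2 * y ^ 13 / 13 + 2 * y ^ 15 / 15 + 2 * y ^ 17 / 17 + 2 / 10 ^ 11"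
    using d by simp_all
  then show "0.4812118250 < ln (1 / 2 + sqrt 5 / 2)" "ln (1 / 2 + sqrt 5 / 2) < 0.4812118251"
    unfolding p1 p3 p5 p7 p9 p11 p13 p15 p17 using s by (simp_all add: add_divide_distrib diff_divide_distrib)
qed

lemma ln_silver_bounds:
  "0.8813735870 < ln (1 + sqrt 2)" "ln (1 + sqrt 2) < 0.8813735871"
proof -
  define s :: real where "s = sqrt 2"
  define y where "y = (1 + sqrt 2 - 1) / (1 + sqrt 2 + 1)"
  have ss: "s * s = 2" by (simp add: s_def)
  have s: "1.414213562373095048801688 < s" "s < 1.414213562373095048801689" unfolding s_def
    by (rule real_less_rsqrt real_less_lsqrt; simp add: power2_eq_square)+
  have y: "y = s - 1" unfolding y_def s_def[symmetric] using ss s by (simp add: field_simps)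
  have z: "y\<^sup>2 = 3 - 2 * s" unfolding y power2_eq_square using ss by (simp add: algebra_simps)
  have step: "y ^ (m + 2) = (3 * a - 4 * b) + (3 * b - 2 * a) * s" if "y ^ m = a + b * s" for m a b
  proof -
    have "y ^ (m + 2) = y ^ m * y\<^sup>2" by (rule power_add)
    also have "\<dots> = 3 * a - 2 * b * (s * s) + (3 * b - 2 * a) * s"
      unfolding that z by (simp add: algebra_simps)
    finally show ?thesis unfolding ss by simp
  qed
  have p1: "y ^ 1 = (-1) + 1 * s" using y by simp
  have p3: "y ^ 3 = (-7) + (5) * s" using step[OF p1] by (simp add: power3_eq_cube)
  have p5: "y ^ 5 = (-41) + (29) * s" using step[OF p3] by simp
  have p7: "y ^ 7 = (-239) + (169) * s" using step[OF p5] by simp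
  have p9: "y ^ 9 = (-1393) + (985) * s" using step[OF p7] by simp
  have p11: "y ^ 11 = (-8119) + (5741) * s" using step[OF p9] by simp
  have p13: "y ^ 13 = (-47321) + (33461) * s" using step[OF p11] by simp
  have p15: "y ^ 15 = (-275807) + (195025) * s" using step[OF p13] by simp
  have p17: "y ^ 17 = (-1607521) + (1136689) * s" using step[OF p15] by simp
  have p19: "y ^ 19 = (-9369319) + (6625109) * s" using step[OF p17] by simp
  have p21: "y ^ 21 = (-54608393) + (38613965) * s" using step[OF p19] by simp
  have p23: "y ^ 23 = (-318281039) + (225058681) * s" using step[OF p21] by simp
  have p25: "y ^ 25 = (-1855077841) + (1311738121) * s" using step[OF p23] by simp
  have p27: "y ^ 27 = (-10812186007) + (7645370045) * s" using step[OF p25] by simp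
  have d: "y ^ 27 / (1 - y\<^sup>2) / 27 < 1 / 10 ^ 11"
    unfolding p27 z using s by (simp add: divide_less_eq)
  have "ln (1 + sqrt 2) \<in> {(\<Sum>j<13. 2 * y ^ (2 * j + 1) / of_nat (2 * j + 1))..(\<Sum>j<13. 2 * y ^ (2 * j + 1) / of_nat (2 * j + 1))
      + 2 * (y ^ (2 * 13 + 1) / (1 - y\<^sup>2) / of_nat (2 * 13 + 1))}"
    unfolding y_def by (rule ln_approx_bounds) (use s in \<open>simp add: s_def\<close>)
  moreover have "(\<Sum>j<13. 2 * y ^ (2 * j + 1) / of_nat (2 * j + 1)) = 2 * y ^ 1 / 1 + 2 * y ^ 3 / 3 + 2 * y ^ 5 / 5 + 2 * y ^ 7 / 7 + 2 * y ^ 9 / 9 + 2 * y ^ 11 / 11 + 2 * y ^ 13 / 13 + 2 * y ^ 15 / 15 + 2 * y ^ 17 / 17 + 2 * y ^ 19 / 19 + 2 * y ^ 21 / 21 + 2 * y ^ 23 / 23 + 2 * y ^ 25 / 25"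
    unfolding sum_lessThan_13 by simp
  ultimately have "2 * y ^ 1 / 1 + 2 * y ^ 3 / 3 + 2 * y ^ 5 / 5 + 2 * y ^ 7 / 7 + 2 * y ^ 9 / 9 + 2 * y ^ 11 / 11 + 2 * y ^ 13 / 13 + 2 * y ^ 15 / 15 + 2 * y ^ 17 / 17 + 2 * y ^ 19 / 19 + 2 * y ^ 21 / 21 + 2 * y ^ 23 / 23 + 2 * y ^ 25 / 25 \<le> ln (1 + sqrt 2)" "ln (1 + sqrt 2) \<le> 2 * y ^ 1 / 1 + 2 * y ^ 3 / 3 + 2 * y ^ 5 / 5 + 2 * y ^ 7 / 7 + 2 * y ^ 9 / 9 + 2 * y ^ 11 / 11 + 2 * y ^ 13 / 13 + 2 * y ^ 15 / 15 + 2 * y ^ 17 / 17 + 2 * y ^ 19 / 19 + 2 * y ^ 21 / 21 + 2 * y ^ 23 / 23 + 2 * y ^ 25 / 25 + 2 / 10 ^ 11"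
    using d by simp_all
  then show "0.8813735870 < ln (1 + sqrt 2)" "ln (1 + sqrt 2) < 0.8813735871"
    unfolding p1 p3 p5 p7 p9 p11 p13 p15 p17 p19 p21 p23 p25 using s by (simp_all add: add_divide_distrib diff_divide_distrib)
qed

section \<open>The extremal problem\<close>

definition tau :: real where "tau = (sqrt 5 - 1) / 2"

lemma tau_sq: "tau * tau = 1 - tau"
  unfolding tau_def by (simp add: field_simps)

lemma tau_bounds: "0.6 < tau" "tau < 0.62"
proof -
  have "2.2 < sqrt 5" by (rule real_less_rsqrt) (simp add: power2_eq_square)
  moreover have "sqrt 5 < 2.24" by (rule real_less_lsqrt) (simp_all add: power2_eq_square)
  ultimately show "0.6 < tau" "tau < 0.62" unfolding tau_def by simp_all
qed

lemma ln_golden: "ln (1 / 2 + sqrt 5 / 2) = - ln tau"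
proof -
  have "1 / 2 + sqrt 5 / 2 = inverse tau"
    by (rule inverse_unique[symmetric]) (simp add: tau_def field_simps)
  then show ?thesis using tau_bounds by (simp add: ln_inverse)
qed

text \<open>
  \<open>kap\<close> is the optimal ratio of entropy and drift, \<open>lam\<close> the multiplier of the constraint
  \<open>c w * c z = 1\<close>, and \<open>lagr\<close> the contribution of one factor to the Lagrange function, normalised
  to vanish at the optimum.
\<close>

definition kap :: real where "kap = - ln tau * (3 + tau) / 2"

lemma kap_eq: "kap = (5 + sqrt 5) / 4 * ln (1 / 2 + sqrt 5 / 2)"
  unfolding ln_golden by (simp add: kap_def tau_def field_simps)

definition lam :: real where "lam = - ln tau * (1 + tau) / (14 + 8 * tau)"

lemma lam_pos: "0 < lam"
  unfolding lam_def using tau_bounds by (intro divide_pos_pos mult_pos_pos) (simp_all add: ln_less_zero)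

definition lagr :: "real \<Rightarrow> real" where
  "lagr w = ln (2 + w) - w * ln w / (2 + w) - kap * ((2 + 2 * w) / (2 + w))
     + lam * (ln w + ln (2 + w) - ln (2 - w\<^sup>2))"

text \<open>Clearing (2 + w)^2 from the derivative of \<open>lagr\<close> leaves one logarithm and
  rational terms whose monotone derivatives can be read off.\<close>

definition lagr_num :: "real \<Rightarrow> real" where
  "lagr_num w = - 2 * ln w - 2 * kap + lam * (4 / w + (12 * w + 16) / (2 - w\<^sup>2) - 2)"

lemma lagr_deriv:
  assumes "0 < w" "w < 1"
  shows "(lagr has_real_derivative lagr_num w / (2 + w)\<^sup>2) (at w)"
proof -
  have q: "0 < 2 - w\<^sup>2" using assms by (simp add: power_less_one_iff less_trans[of _ 1])
  have 1: "1 / (2 + w) - ((1 * ln w + w * (1 / w)) * (2 + w) - w * ln w * 1) / (2 + w)\<^sup>2 = - 2 * ln w / (2 + w)\<^sup>2"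
  proof -
    have "1 / (2 + w) = (2 + w) / (2 + w)\<^sup>2" using assms by (simp add: power2_eq_square)
    then show ?thesis using assms by (simp add: diff_divide_distrib[symmetric] algebra_simps)
  qed
  have 2: "(2 * (2 + w) - (2 + 2 * w) * 1) / (2 + w)\<^sup>2 = 2 / (2 + w)\<^sup>2"
    using assms by (simp add: field_simps)
  \<comment> \<open>After multiplication by (2 + w)^2 the left side is decomposed into partial
    fractions over w and 2 - w^2.\<close>
  have 3: "1 / w + 1 / (2 + w) + 2 * w / (2 - w\<^sup>2) = (4 / w + (12 * w + 16) / (2 - w\<^sup>2) - 2) / (2 + w)\<^sup>2"
  proof -
    have "(1 / w + 1 / (2 + w) + 2 * w / q) = (4 / w + (12 * w + 16) / q - 2) / (2 + w)\<^sup>2"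
      if "q = 2 - w * w" "q > 0" for q
    proof -
      have "(1 / w + 1 / (2 + w) + 2 * w / q) * (2 + w)\<^sup>2 * (w * q) = (4 / w + (12 * w + 16) / q - 2) * (w * q)"
      proof -
        have "(1 / w + 1 / (2 + w) + 2 * w / q) * (2 + w)\<^sup>2 * (w * q)
          = (2 + w)\<^sup>2 * q + (2 + w) * w * q + 2 * w * w * (2 + w)\<^sup>2"
        proof -
          have "(1 / w + 1 / u + 2 * w / q) * u\<^sup>2 * (w * q) = u\<^sup>2 * q + u * w * q + 2 * w * w * u\<^sup>2"
            if "u > 0" for u
            using assms \<open>q > 0\<close> that by (simp add: field_simps power2_eq_square)
          then show ?thesis using assms by simp
        qed
        also have "\<dots> = 4 * q + (12 * w + 16) * w - 2 * w * q"
          unfolding that(1) by (simp add: algebra_simps power2_eq_square)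
        also have "\<dots> = (4 / w + (12 * w + 16) / q - 2) * (w * q)"
          using assms that(2) by (simp add: field_simps)
        finally show ?thesis .
      qed
      then have "(1 / w + 1 / (2 + w) + 2 * w / q) * (2 + w)\<^sup>2 = 4 / w + (12 * w + 16) / q - 2"
        using assms that(2) by simp
      then show ?thesis using assms by (simp add: eq_divide_eq)
    qed
    then show ?thesis using q by (simp add: power2_eq_square)
  qed
  have "(lagr has_real_derivative
      1 / (2 + w) - ((1 * ln w + w * (1 / w)) * (2 + w) - w * ln w * 1) / (2 + w)\<^sup>2
      - kap * ((2 * (2 + w) - (2 + 2 * w) * 1) / (2 + w)\<^sup>2)
      + lam * (1 / w + 1 / (2 + w) + 2 * w / (2 - w\<^sup>2))) (at w)"
    unfolding lagr_def using assms q
    by (auto intro!: derivative_eq_intros simp: power2_eq_square; simp add: algebra_simps)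
  moreover have "1 / (2 + w) - ((1 * ln w + w * (1 / w)) * (2 + w) - w * ln w * 1) / (2 + w)\<^sup>2
      - kap * ((2 * (2 + w) - (2 + 2 * w) * 1) / (2 + w)\<^sup>2)
      + lam * (1 / w + 1 / (2 + w) + 2 * w / (2 - w\<^sup>2)) = lagr_num w / (2 + w)\<^sup>2"
    unfolding 1 2 3 lagr_num_def by (simp only: add_divide_distrib[symmetric] diff_divide_distrib[symmetric]
        times_divide_eq_right mult.commute[of kap 2])
  ultimately show ?thesis by simp
qed

text \<open>The derivative is a sum of increasing functions; the terms stemming from the constraint
  keep this property because \<open>lam\<close> is positive.\<close>

lemma lagr_num_convex: "convex_on {0<..1} lagr_num"
proof (rule convex_on_realI)
  fix w :: real assume "w \<in> {0<..1}"
  then have w: "0 < w" "w \<le> 1" by auto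
  then have q: "w * w < 2" using mult_le_one[of w w] by linarith
  show "(lagr_num has_real_derivative
      - 2 / w + lam * (- 4 / (w * w) + (24 + 32 * w + 12 * (w * w)) / (2 - w * w)\<^sup>2)) (at w)"
    unfolding lagr_num_def using w q
    by (auto intro!: derivative_eq_intros simp: power2_eq_square algebra_simps)
next
  fix x y :: real assume "x \<in> {0<..1}" "y \<in> {0<..1}" and xy: "x \<le> y"
  then have p: "0 < x" "y \<le> 1" "0 < y" by auto
  have s: "x * x \<le> y * y" using p xy by (intro mult_mono) auto
  have q: "y * y < 2" using mult_le_one[of y y] p by linarith
  have "(24 + 32 * x + 12 * (x * x)) / (2 - x * x)\<^sup>2 \<le> (24 + 32 * y + 12 * (y * y)) / (2 - y * y)\<^sup>2"
    using p s xy q by (intro frac_le add_mono mult_left_mono power_mono) auto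
  moreover have "4 / (y * y) \<le> 4 / (x * x)" using p s by (intro divide_left_mono) auto
  moreover have "2 / y \<le> 2 / x" using p xy by (intro divide_left_mono) auto
  ultimately show "- 2 / x + lam * (- 4 / (x * x) + (24 + 32 * x + 12 * (x * x)) / (2 - x * x)\<^sup>2)
      \<le> - 2 / y + lam * (- 4 / (y * y) + (24 + 32 * y + 12 * (y * y)) / (2 - y * y)\<^sup>2)"
    using lam_pos by (intro add_mono mult_left_mono) auto
qed (simp add: is_interval_connected is_interval_oc)

text \<open>This equation is the source of \<open>lam\<close>: at \<open>tau\<close> the bracket
  multiplied by it equals 14 + 8 * tau, the denominator in its definition.\<close>

lemma lagr_num_tau: "lagr_num tau = 0"
proof -
  have "2 - tau\<^sup>2 = 1 + tau" using tau_sq by (simp add: power2_eq_square)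
  moreover have "1 + tau = inverse tau"
    by (rule inverse_unique[symmetric]) (use tau_sq in \<open>simp add: algebra_simps\<close>)
  ultimately have q: "2 - tau\<^sup>2 = inverse tau" by simp
  have i: "1 / tau = 1 + tau" using tau_sq tau_bounds by (simp add: field_simps)
  have "4 / tau + (12 * tau + 16) / (2 - tau\<^sup>2) - 2 = 4 * (1 / tau) + 12 * (tau * tau) + 16 * tau - 2"
    unfolding q by (simp add: field_simps)
  also have "\<dots> = 14 + 8 * tau" unfolding i tau_sq by simp
  finally have K: "lam * (4 / tau + (12 * tau + 16) / (2 - tau\<^sup>2) - 2) = - ln tau * (1 + tau)"
    unfolding lam_def using tau_bounds by simp
  show ?thesis unfolding lagr_num_def K kap_def by (simp add: field_simps)
qed

text \<open>The bracket equals 30 at w = 1. Divided by - ln tau, the claim is a polynomial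
  inequality in \<open>tau\<close> whose two sides differ by the constant 20 once tau * tau is
  replaced by 1 - tau.\<close>

lemma lagr_num_1: "lagr_num 1 \<le> 0"
proof -
  have "30 * (1 + tau) \<le> (3 + tau) * (14 + 8 * tau)"
    using tau_sq by (simp add: algebra_simps)
  then have "30 * (1 + tau) / (14 + 8 * tau) \<le> 3 + tau"
    using tau_bounds by (simp add: divide_le_eq)
  then have "- ln tau * (30 * (1 + tau) / (14 + 8 * tau)) \<le> - ln tau * (3 + tau)"
    using tau_bounds by (intro mult_left_mono) (simp_all add: ln_le_zero_iff)
  moreover have "lagr_num 1 = - 2 * kap + 30 * lam" by (simp add: lagr_num_def)
  moreover have "30 * lam = - ln tau * (30 * (1 + tau) / (14 + 8 * tau))" unfolding lam_def by simp
  ultimately show ?thesis unfolding kap_def by simp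
qed

text \<open>This equation is the source of \<open>kap\<close>. Every logarithm becomes a multiple of
  ln tau, because 1 + tau and 2 - tau^2 equal 1 / tau, and 2 + tau equals 1 / tau^2.\<close>

lemma lagr_tau: "lagr tau = 0"
proof -
  have q: "2 - tau\<^sup>2 = 1 + tau" using tau_sq by (simp add: power2_eq_square)
  have i: "1 + tau = inverse tau"
    by (rule inverse_unique[symmetric]) (use tau_sq in \<open>simp add: algebra_simps\<close>)
  have j: "2 + tau = inverse tau * inverse tau"
    unfolding i[symmetric] using tau_sq by (simp add: algebra_simps)
  have l2: "ln (2 + tau) = - 2 * ln tau" unfolding j using tau_bounds by (simp add: ln_mult ln_inverse)
  have lq: "ln (2 - tau\<^sup>2) = - ln tau" unfolding q i using tau_bounds by (simp add: ln_inverse)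
  have d: "1 / (2 + tau) = tau * tau" unfolding j using tau_bounds by (simp add: field_simps)
  have "tau * (tau * tau) = tau - tau * tau"
    by (subst tau_sq) (simp add: right_diff_distrib)
  then have cub: "tau * (tau * tau) = 2 * tau - 1" unfolding tau_sq by simp
  have "tau * ln tau / (2 + tau) = ln tau * (tau * (1 / (2 + tau)))" by simp
  also have "tau * (1 / (2 + tau)) = 2 * tau - 1"
    unfolding d by (rule cub)
  finally have t1: "tau * ln tau / (2 + tau) = ln tau * (2 * tau - 1)" .
  have "(2 + 2 * tau) / (2 + tau) = 2 * ((1 + tau) * (1 / (2 + tau)))" by simp
  also have "\<dots> = 2 * tau" unfolding d i using tau_bounds by simp
  finally have t2: "(2 + 2 * tau) / (2 + tau) = 2 * tau" .
  have t3: "(3 + tau) * tau = 1 + 2 * tau" using tau_sq by (simp add: algebra_simps)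
  have "kap * (2 * tau) = - ln tau * ((3 + tau) * tau)" unfolding kap_def by simp
  then have t4: "kap * (2 * tau) = - ln tau * (1 + 2 * tau)" unfolding t3 .
  show ?thesis unfolding lagr_def t1 t2 t4 l2 lq by (simp add: algebra_simps)
qed

text \<open>A convex function that vanishes at \<open>tau\<close> and is nonpositive at 1 is
  nonnegative to the left of \<open>tau\<close> and nonpositive between \<open>tau\<close> and 1. So
  \<open>lagr\<close> rises up to \<open>tau\<close> and falls afterwards. In both cases u is the
  coefficient of 1 in a convex combination: \<open>tau\<close> lies between x and 1, or x between
  \<open>tau\<close> and 1.\<close>

lemma lagr_nonpos:
  assumes "0 < w" "w < 1"
  shows "lagr w \<le> 0"
proof (cases "w \<le> tau")
  case True
  have "lagr w \<le> lagr tau"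
  proof (rule DERIV_nonneg_imp_nondecreasing[OF True])
    fix x assume x: "w \<le> x" "x \<le> tau"
    then have x1: "0 < x" "x < 1" using assms tau_bounds by auto
    define u where "u = (tau - x) / (1 - x)"
    have u: "0 \<le> u" "u < 1" "tau = (1 - u) * x + u * 1"
      using x x1 tau_bounds by (auto simp: u_def divide_simps) (simp add: algebra_simps)
    have "lagr_num ((1 - u) *\<^sub>R x + u *\<^sub>R 1) \<le> (1 - u) * lagr_num x + u * lagr_num 1"
      using x1 u by (intro convex_onD[OF lagr_num_convex]) auto
    then have "0 \<le> (1 - u) * lagr_num x + u * lagr_num 1"
      using u(3) lagr_num_tau by simp
    then have "0 \<le> (1 - u) * lagr_num x" using u lagr_num_1 mult_nonneg_nonpos[of u "lagr_num 1"] by linarith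
    then have "0 \<le> lagr_num x" using u by (simp add: zero_le_mult_iff)
    then show "\<exists>y. DERIV lagr x :> y \<and> y \<ge> 0" using lagr_deriv[OF x1] by (metis divide_nonneg_nonneg zero_le_power2)
  qed
  then show ?thesis by (simp add: lagr_tau)
next
  case False
  have "lagr w \<le> lagr tau"
  proof (rule DERIV_nonpos_imp_nonincreasing[of tau w])
    show "tau \<le> w" using False by simp
    fix x assume x: "tau \<le> x" "x \<le> w"
    then have x1: "0 < x" "x < 1" using assms tau_bounds by auto
    define u where "u = (x - tau) / (1 - tau)"
    have u: "0 \<le> u" "u \<le> 1" "x = (1 - u) * tau + u * 1"
      using x x1 tau_bounds by (auto simp: u_def divide_simps) (simp add: algebra_simps)
    have "lagr_num ((1 - u) *\<^sub>R tau + u *\<^sub>R 1) \<le> (1 - u) * lagr_num tau + u * lagr_num 1"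
      using tau_bounds u by (intro convex_onD[OF lagr_num_convex]) auto
    then have "lagr_num x \<le> u * lagr_num 1"
      using u(3) lagr_num_tau by simp
    then have "lagr_num x \<le> 0" using u lagr_num_1 mult_nonneg_nonpos[of u "lagr_num 1"] by linarith
    then show "\<exists>y. DERIV lagr x :> y \<and> y \<le> 0" using lagr_deriv[OF x1] by (metis divide_nonpos_nonneg zero_le_power2)
  qed
  then show ?thesis by (simp add: lagr_tau)
qed

lemma numeric_bounds:
  "0.987686 \<le> kap / ln (1 + sqrt 2)" "kap / ln (1 + sqrt 2) < 0.987687"
proof -
  have s: "2.2360679774 < sqrt 5" "sqrt 5 < 2.2360679775"
    by (rule real_less_rsqrt real_less_lsqrt; simp add: power2_eq_square)+
  have l: "(5 + 2.2360679774) / 4 * 0.4812118250 \<le> kap"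
    unfolding kap_eq using s ln_golden_bounds by (intro mult_mono) auto
  have u: "kap \<le> (5 + 2.2360679775) / 4 * 0.4812118251"
    unfolding kap_eq using s ln_golden_bounds by (intro mult_mono) auto
  show "0.987686 \<le> kap / ln (1 + sqrt 2)"
    using l ln_silver_bounds by (simp add: le_divide_eq)
  show "kap / ln (1 + sqrt 2) < 0.987687"
    using u ln_silver_bounds by (simp add: divide_less_eq)
qed

section \<open>Hitting probabilities and correctors\<close>

text \<open>
  \<open>P f\<close> is the probability that a step uses the factor \<open>f\<close>. Excursions into the other factor turn
  the walk on a coset of the factor \<open>f\<close> into a simple random walk on the 4-cycle that survives each
  step with probability \<open>w f\<close>; \<open>\<alpha> f\<close> and \<open>\<alpha> f * w f\<close> are its probabilities of hitting a neighbour
  and the antipode.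
\<close>

locale cone_params =
  fixes P w \<alpha> :: "bool \<Rightarrow> real"
  assumes P_pos: "0 < P f"
    and P_sum: "P f + P (\<not> f) = 1"
    and w_pos: "0 < w f" and w_less: "w f < 1"
    and \<alpha>_eq: "\<alpha> f * (2 - w f * w f) = w f"
    and w_eq: "w f * (1 - P (\<not> f) * \<alpha> (\<not> f)) = P f"
begin

section \<open>Algebraic relations between the parameters\<close>

lemma denom_pos: "1 < 2 - w f * w f"
  using mult_strict_mono[of "w f" 1 "w f" 1] w_pos[of f] w_less[of f] by simp

lemma \<alpha>_def: "\<alpha> f = w f / (2 - w f * w f)"
  using \<alpha>_eq[of f] denom_pos[of f] by (simp add: eq_divide_eq)

lemma \<alpha>_pos: "0 < \<alpha> f"
  unfolding \<alpha>_def using w_pos[of f] denom_pos[of f] by simp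

lemma \<alpha>_less: "\<alpha> f < 1"
  unfolding \<alpha>_def using w_less[of f] denom_pos[of f] by (simp add: divide_less_eq)

text \<open>The total weight of the three letters of a factor: \<alpha> for each of the two
  generators and \<alpha> * w for the involution.\<close>

definition c where "c f = \<alpha> f * (2 + w f)"

lemma c_eq: "c f * (2 - w f * w f) = w f * (2 + w f)"
proof -
  have "c f * (2 - w f * w f) = \<alpha> f * (2 - w f * w f) * (2 + w f)" by (simp only: c_def mult_ac)
  then show ?thesis unfolding \<alpha>_eq .
qed

lemma c_eq_mult: "w f * w g * ((2 + w f) * (2 + w g)) = c f * c g * ((2 - w f * w f) * (2 - w g * w g))"
proof -
  have "c f * c g * ((2 - w f * w f) * (2 - w g * w g)) = c f * (2 - w f * w f) * (c g * (2 - w g * w g))"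
    by (simp only: mult_ac)
  then show ?thesis unfolding c_eq by (simp only: mult_ac)
qed

lemma c_pos: "0 < c f"
  unfolding c_def using \<alpha>_pos[of f] w_pos[of f] by simp

text \<open>Cramer's rule for the two equations \<open>w_eq\<close>, which are linear in P when w
  and \<alpha> are held fixed.\<close>

lemma P_det: "P f * (1 - w f * w (\<not> f) * \<alpha> f * \<alpha> (\<not> f)) = w f * (1 - w (\<not> f) * \<alpha> (\<not> f))"
proof -
  have "P f = w f * (1 - (w (\<not> f) * (1 - P f * \<alpha> f)) * \<alpha> (\<not> f))"
    using w_eq[of f] w_eq[of "\<not> f"] by simp
  then show ?thesis by (simp add: algebra_simps)
qed

lemma one_minus_\<alpha>: "(1 - \<alpha> f) * (2 - w f * w f) = (1 - w f) * (2 + w f)"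
  using \<alpha>_eq[of f] by (simp add: algebra_simps)

lemma one_minus_w_\<alpha>: "(1 - w f * \<alpha> f) * (2 - w f * w f) = 2 * (1 - w f * w f)"
proof -
  have "(1 - w f * \<alpha> f) * (2 - w f * w f) = 2 - w f * w f - w f * (\<alpha> f * (2 - w f * w f))"
    by (simp add: algebra_simps)
  then show ?thesis unfolding \<alpha>_eq by (simp add: algebra_simps)
qed

text \<open>Adding \<open>P_det\<close> for both factors eliminates P. The resulting identity
  contains the factor 1 - w for each of the two parameters, belonging to the degenerate solution w =
  1; since w < 1 it can be cancelled.\<close>

lemma c_mult: "c f * c (\<not> f) = 1"
proof -
  let ?A = "w f" and ?B = "w (\<not> f)" and ?a = "\<alpha> f" and ?b = "\<alpha> (\<not> f)"
  have "P f * (1 - ?A * ?B * ?a * ?b) + P (\<not> f) * (1 - ?A * ?B * ?a * ?b) = ?A * (1 - ?B * ?b) + ?B * (1 - ?A * ?a)"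
    using P_det[of f] P_det[of "\<not> f"] by (simp add: mult_ac)
  then have "1 - ?A * ?B * ?a * ?b = ?A * (1 - ?B * ?b) + ?B * (1 - ?A * ?a)"
    unfolding distrib_right[symmetric] P_sum by simp
  then have 1: "(1 - ?A) * (1 - ?B) = ?A * ?B * ((1 - ?a) * (1 - ?b))"
    by (simp add: algebra_simps)
  have "(1 - ?A) * (1 - ?B) * ((2 - ?A * ?A) * (2 - ?B * ?B))
      = ?A * ?B * (((1 - ?a) * (2 - ?A * ?A)) * ((1 - ?b) * (2 - ?B * ?B)))"
    unfolding 1 by (simp add: mult_ac)
  also have "\<dots> = ((1 - ?A) * (1 - ?B)) * (?A * ?B * ((2 + ?A) * (2 + ?B)))"
    unfolding one_minus_\<alpha> by (simp only: mult_ac)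
  finally have "(2 - ?A * ?A) * (2 - ?B * ?B) = ?A * ?B * ((2 + ?A) * (2 + ?B))"
    using w_less[of f] w_less[of "\<not> f"] by simp
  also have "\<dots> = c f * c (\<not> f) * ((2 - ?A * ?A) * (2 - ?B * ?B))"
    by (rule c_eq_mult)
  finally show ?thesis using denom_pos[of f] denom_pos[of "\<not> f"] by simp
qed

lemma w_relation: "(w f + w (\<not> f)) * (w f + w (\<not> f) + w f * w (\<not> f)) = 2"
proof -
  let ?A = "w f" and ?B = "w (\<not> f)"
  have "?A * ?B * ((2 + ?A) * (2 + ?B)) = c f * c (\<not> f) * ((2 - ?A * ?A) * (2 - ?B * ?B))"
    by (rule c_eq_mult)
  then show ?thesis unfolding c_mult by (simp add: algebra_simps)
qed

text \<open>An escape probability: from a stack with a letter of f on top, the next step opens a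
  syllable of the other factor, and that syllable is never removed.\<close>

definition C where "C f = P (\<not> f) * (1 - \<alpha> (\<not> f))"

lemma C_pos: "0 < C f"
  unfolding C_def using P_pos[of "\<not> f"] \<alpha>_less[of "\<not> f"] by simp

text \<open>This makes the prefactor of \<open>speed\<close> symmetric in the two factors and the
  corrector equations consistent. Multiplied by the determinant D of \<open>P_det\<close> and by the
  denominators q and r of the two \<alpha>, both sides become polynomials in the values of w, and
  \<open>w_relation\<close> equates them.\<close>

lemma C_eq: "C f = c (\<not> f) * C (\<not> f)"
proof -
  let ?A = "w f" and ?B = "w (\<not> f)" and ?a = "\<alpha> f" and ?b = "\<alpha> (\<not> f)"
  define D where "D = 1 - ?A * ?B * ?a * ?b"
  define q r where "q = 2 - ?A * ?A" and "r = 2 - ?B * ?B"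
  have qr: "q > 0" "r > 0" using denom_pos[of f] denom_pos[of "\<not> f"] by (simp_all add: q_def r_def)
  have Aa: "?A * ?a < 1" "?B * ?b < 1"
    using mult_strict_mono[of ?A 1 ?a 1] mult_strict_mono[of ?B 1 ?b 1]
      w_less[of f] w_less[of "\<not> f"] \<alpha>_less[of f] \<alpha>_less[of "\<not> f"] \<alpha>_pos[of f] \<alpha>_pos[of "\<not> f"] by simp_all
  have "0 < ?A * ?a" "0 < ?B * ?b" using \<alpha>_pos w_pos by simp_all
  then have "(?A * ?a) * (?B * ?b) < 1" using Aa mult_strict_mono[of "?A * ?a" 1 "?B * ?b" 1] by simp
  then have D: "D > 0" unfolding D_def by (simp add: mult_ac)
  have PD: "P f * D = ?A * (1 - ?B * ?b)" "P (\<not> f) * D = ?B * (1 - ?A * ?a)"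
    using P_det[of f] P_det[of "\<not> f"] by (simp_all add: D_def mult_ac)
  have a: "(1 - ?a) * q = (1 - ?A) * (2 + ?A)" "(1 - ?b) * r = (1 - ?B) * (2 + ?B)"
    using one_minus_\<alpha>[of f] one_minus_\<alpha>[of "\<not> f"] by (simp_all add: q_def r_def)
  have A: "(1 - ?A * ?a) * q = 2 * (1 - ?A * ?A)" "(1 - ?B * ?b) * r = 2 * (1 - ?B * ?B)"
    unfolding q_def r_def by (rule one_minus_w_\<alpha>)+
  have b: "?b * r = ?B" using \<alpha>_eq[of "\<not> f"] by (simp add: r_def)
  have rel: "?A * (1 + ?B) * (2 + ?A) = (1 + ?A) * r"
    using w_relation[of f] by (simp add: r_def algebra_simps)
  have "C f * (D * q * r * r) = (P (\<not> f) * D) * ((1 - ?b) * r) * q * r"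
    by (simp add: C_def mult_ac)
  also have "\<dots> = ?B * ((1 - ?A * ?a) * q) * ((1 - ?B) * (2 + ?B)) * r"
    unfolding PD a by (simp only: mult_ac)
  also have "\<dots> = ?B * 2 * (1 - ?A) * (1 - ?B) * (2 + ?B) * ((1 + ?A) * r)"
    unfolding A by (simp add: algebra_simps)
  also have "\<dots> = ?B * 2 * (1 - ?A) * (1 - ?B) * (2 + ?B) * (?A * (1 + ?B) * (2 + ?A))"
    unfolding rel ..
  also have "\<dots> = (?B * (2 + ?B)) * ?A * (2 * (1 - ?B * ?B)) * ((1 - ?A) * (2 + ?A))"
    by (simp add: algebra_simps)
  also have "\<dots> = (?b * r * (2 + ?B)) * (?A * ((1 - ?B * ?b) * r)) * ((1 - ?a) * q)"
    unfolding A a b by (simp only: mult_ac)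
  also have "\<dots> = (?b * r * (2 + ?B)) * ((?A * (1 - ?B * ?b)) * r) * ((1 - ?a) * q)"
    by (simp only: mult_ac)
  also have "\<dots> = c (\<not> f) * C (\<not> f) * (D * q * r * r)"
    unfolding PD(1)[symmetric] by (simp add: C_def c_def mult_ac)
  finally show ?thesis using D qr by simp
qed

section \<open>Asymptotic speed of additive functionals and its corrector\<close>

definition avg where "avg f \<omega>\<^sub>1 \<omega>\<^sub>2 = (2 * \<omega>\<^sub>1 + w f * \<omega>\<^sub>2) / (2 + w f)"

text \<open>Here \<open>\<omega>\<^sub>1\<close> is the weight of a generator and
  \<open>\<omega>\<^sub>2\<close> that of the involution. \<open>avg\<close> is the mean weight of a
  letter drawn in proportion to its hitting probability, and the prefactor is the asymptotic number
  of syllables of each factor per step: \<open>speed\<close> reduces to it for weight 1 on one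
  factor and 0 on the other.\<close>

definition speed where
  "speed \<omega>\<^sub>1 \<omega>\<^sub>2 = C True / (1 + c False) * (avg True (\<omega>\<^sub>1 True) (\<omega>\<^sub>2 True) + avg False (\<omega>\<^sub>1 False) (\<omega>\<^sub>2 False))"

text \<open>The Poisson equation for the killed walk on the 4-cycle with value 0 at the base point,
  \<open>R\<^sub>1\<close> at its neighbours and \<open>R\<^sub>2\<close> at the antipode, and
  sources a and b. The third equation computes what this factor contributes to the equations of the
  other one.\<close>

lemma poisson_solution:
  fixes a b :: real and f :: bool
  defines "R\<^sub>1 \<equiv> w f / P f * (2 * a + w f * b) / (2 - w f * w f)"
  defines "R\<^sub>2 \<equiv> w f * R\<^sub>1 + w f / P f * b"
  shows "P f / 2 * R\<^sub>2 - P f / w f * R\<^sub>1 + a = 0" "P f * R\<^sub>1 - P f / w f * R\<^sub>2 + b = 0"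
    "P f * R\<^sub>1 = c f * avg f a b"
proof -
  have p: "P f \<noteq> 0" "w f \<noteq> 0" "2 + w f \<noteq> 0" using P_pos[of f] w_pos[of f] by simp_all
  have q: "2 - w f * w f \<noteq> 0" using denom_pos[of f] by simp
  have 1: "P f * R\<^sub>1 * (2 - w f * w f) = w f * (2 * a + w f * b)"
    unfolding R\<^sub>1_def using p q by simp
  have 2: "P f / w f * R\<^sub>2 = P f * R\<^sub>1 + b" "P f / 2 * R\<^sub>2 = w f * (P f * R\<^sub>1 + b) / 2"
    unfolding R\<^sub>2_def using p by (simp_all add: field_simps)
  show "P f * R\<^sub>1 - P f / w f * R\<^sub>2 + b = 0" using 2 by simp
  have "w f * (P f / 2 * R\<^sub>2 - P f / w f * R\<^sub>1 + a) = w f * (w f * (P f * R\<^sub>1 + b) / 2) - P f * R\<^sub>1 + w f * a"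
    unfolding 2(2) using p by (simp add: algebra_simps)
  also have "\<dots> = 0" using 1 by (simp add: field_simps)
  finally show "P f / 2 * R\<^sub>2 - P f / w f * R\<^sub>1 + a = 0" using p by simp
  have "P f * R\<^sub>1 = w f * (2 * a + w f * b) / (2 - w f * w f)" using 1 q by (simp add: eq_divide_eq)
  also have "\<dots> = c f * avg f a b" unfolding c_def \<alpha>_def avg_def using p by simp
  finally show "P f * R\<^sub>1 = c f * avg f a b" .
qed

text \<open>The equations say that weight plus corrector gains \<open>speed\<close> in one step when
  a generator, respectively the involution, is on top. In the unknowns \<open>r\<^sub>1\<close> +
  \<open>\<omega>\<^sub>1\<close> and \<open>r\<^sub>2\<close> + \<open>\<omega>\<^sub>2\<close>
  each factor becomes a Poisson problem, coupled to the other only through a constant source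
  J.\<close>

lemma ex_corrector:
  fixes \<omega>\<^sub>1 \<omega>\<^sub>2 :: "bool \<Rightarrow> real"
  obtains r\<^sub>1 r\<^sub>2 :: "bool \<Rightarrow> real" where
    "\<And>f. P f / 2 * (\<omega>\<^sub>2 f - 2 * \<omega>\<^sub>1 f + r\<^sub>2 f) + P (\<not> f) * (\<omega>\<^sub>1 (\<not> f) + r\<^sub>1 (\<not> f) + \<alpha> (\<not> f) * r\<^sub>1 f) - r\<^sub>1 f
      = speed \<omega>\<^sub>1 \<omega>\<^sub>2"
    "\<And>f. P f * (\<omega>\<^sub>1 f - \<omega>\<^sub>2 f + r\<^sub>1 f) + P (\<not> f) * (\<omega>\<^sub>1 (\<not> f) + r\<^sub>1 (\<not> f) + \<alpha> (\<not> f) * r\<^sub>2 f) - r\<^sub>2 f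
      = speed \<omega>\<^sub>1 \<omega>\<^sub>2"
proof -
  define \<gamma> where "\<gamma> = speed \<omega>\<^sub>1 \<omega>\<^sub>2"
  define E where "E f = avg f (\<omega>\<^sub>1 f) (\<omega>\<^sub>2 f)" for f
  \<comment> \<open>The corrector is only determined up to adding a multiple of \<open>1 - hit\<close>; it is normalised by
    \<open>J True = 0\<close>, which decouples the equations of the left factor.\<close>
  define J where "J f = (if f then 0 else C False * E True - \<gamma>)" for f
  define a b where "a f = C f * \<omega>\<^sub>1 f + J f" and "b f = C f * \<omega>\<^sub>2 f + J f" for f
  define R\<^sub>1 where "R\<^sub>1 f = w f / P f * (2 * a f + w f * b f) / (2 - w f * w f)" for f
  define R\<^sub>2 where "R\<^sub>2 f = w f * R\<^sub>1 f + w f / P f * b f" for f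
  note R = poisson_solution[of f "a f" "b f" for f, folded R\<^sub>1_def, folded R\<^sub>2_def]
  have avg_ab: "avg f (a f) (b f) = C f * E f + J f" for f
    unfolding avg_def a_def b_def E_def using w_pos[of f] by (simp add: field_simps)
  have \<gamma>: "\<gamma> * (1 + c False) = C True * (E True + E False)"
    using c_pos[of False] by (simp add: \<gamma>_def speed_def E_def)
  have RT: "P True * R\<^sub>1 True = C False * E True"
    using C_eq[of False] by (simp add: R(3) avg_ab J_def)
  \<comment> \<open>With J fixed, one equation remains: J True = 0 must agree with its expression
    through the right factor. This consistency condition determines the value of
    \<open>speed\<close>.\<close>
  have "P False * R\<^sub>1 False = c False * (C False * (E True + E False)) - c False * \<gamma>"
    by (simp add: R(3) avg_ab J_def algebra_simps)
  also have "c False * (C False * (E True + E False)) = C True * (E True + E False)"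
    using C_eq[of True] by simp
  finally have RF: "P False * R\<^sub>1 False = \<gamma>" using \<gamma> by (simp add: algebra_simps)
  have J: "P (\<not> f) * R\<^sub>1 (\<not> f) - \<gamma> = J f" for f
    using RT RF by (cases f) (simp_all add: J_def)
  have Pw: "P f / w f = 1 - P (\<not> f) * \<alpha> (\<not> f)" for f
    using w_eq[of f] w_pos[of f] by (simp add: divide_eq_eq mult.commute)
  show thesis
  proof
    fix f
    have "P f / 2 * (\<omega>\<^sub>2 f - 2 * \<omega>\<^sub>1 f + (R\<^sub>2 f - \<omega>\<^sub>2 f)) + P (\<not> f) * (\<omega>\<^sub>1 (\<not> f) + (R\<^sub>1 (\<not> f) - \<omega>\<^sub>1 (\<not> f)) + \<alpha> (\<not> f) * (R\<^sub>1 f - \<omega>\<^sub>1 f)) - (R\<^sub>1 f - \<omega>\<^sub>1 f) - \<gamma>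
      = P f / 2 * R\<^sub>2 f - (1 - P (\<not> f) * \<alpha> (\<not> f)) * R\<^sub>1 f + (1 - P (\<not> f) * \<alpha> (\<not> f) - P f) * \<omega>\<^sub>1 f + (P (\<not> f) * R\<^sub>1 (\<not> f) - \<gamma>)"
      by (simp add: algebra_simps)
    also have "1 - P (\<not> f) * \<alpha> (\<not> f) - P f = C f" using P_sum[of f] by (simp add: C_def algebra_simps)
    also have "P f / 2 * R\<^sub>2 f - (1 - P (\<not> f) * \<alpha> (\<not> f)) * R\<^sub>1 f + C f * \<omega>\<^sub>1 f + (P (\<not> f) * R\<^sub>1 (\<not> f) - \<gamma>) = 0"
      unfolding J Pw[symmetric] using R(1)[of f] by (simp add: a_def)
    finally show "P f / 2 * (\<omega>\<^sub>2 f - 2 * \<omega>\<^sub>1 f + (R\<^sub>2 f - \<omega>\<^sub>2 f)) + P (\<not> f) * (\<omega>\<^sub>1 (\<not> f) + (R\<^sub>1 (\<not> f) - \<omega>\<^sub>1 (\<not> f)) + \<alpha> (\<not> f) * (R\<^sub>1 f - \<omega>\<^sub>1 f)) - (R\<^sub>1 f - \<omega>\<^sub>1 f)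
      = speed \<omega>\<^sub>1 \<omega>\<^sub>2" by (simp add: \<gamma>_def)
    have "P f * (\<omega>\<^sub>1 f - \<omega>\<^sub>2 f + (R\<^sub>1 f - \<omega>\<^sub>1 f)) + P (\<not> f) * (\<omega>\<^sub>1 (\<not> f) + (R\<^sub>1 (\<not> f) - \<omega>\<^sub>1 (\<not> f)) + \<alpha> (\<not> f) * (R\<^sub>2 f - \<omega>\<^sub>2 f)) - (R\<^sub>2 f - \<omega>\<^sub>2 f) - \<gamma>
      = P f * R\<^sub>1 f - (1 - P (\<not> f) * \<alpha> (\<not> f)) * R\<^sub>2 f + (1 - P (\<not> f) * \<alpha> (\<not> f) - P f) * \<omega>\<^sub>2 f + (P (\<not> f) * R\<^sub>1 (\<not> f) - \<gamma>)"
      by (simp add: algebra_simps)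
    also have "1 - P (\<not> f) * \<alpha> (\<not> f) - P f = C f" using P_sum[of f] by (simp add: C_def algebra_simps)
    also have "P f * R\<^sub>1 f - (1 - P (\<not> f) * \<alpha> (\<not> f)) * R\<^sub>2 f + C f * \<omega>\<^sub>2 f + (P (\<not> f) * R\<^sub>1 (\<not> f) - \<gamma>) = 0"
      unfolding J Pw[symmetric] using R(2)[of f] by (simp add: b_def)
    finally show "P f * (\<omega>\<^sub>1 f - \<omega>\<^sub>2 f + (R\<^sub>1 f - \<omega>\<^sub>1 f)) + P (\<not> f) * (\<omega>\<^sub>1 (\<not> f) + (R\<^sub>1 (\<not> f) - \<omega>\<^sub>1 (\<not> f)) + \<alpha> (\<not> f) * (R\<^sub>2 f - \<omega>\<^sub>2 f)) - (R\<^sub>2 f - \<omega>\<^sub>2 f)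
      = speed \<omega>\<^sub>1 \<omega>\<^sub>2" by (simp add: \<gamma>_def)
  qed
qed

section \<open>Comparison of the two rates\<close>

definition drift_rate where "drift_rate = speed (\<lambda>_. 1) (\<lambda>_. 2)"
definition entropy_rate where "entropy_rate = speed (\<lambda>f. - ln (\<alpha> f)) (\<lambda>f. - ln (\<alpha> f * w f))"

lemma speed_scale_pos: "0 < C True / (1 + c False)"
  using C_pos[of True] c_pos[of False] by simp

lemma drift_rate_pos: "0 < drift_rate"
proof -
  have "0 < avg f 1 2" for f unfolding avg_def using w_pos[of f] by simp
  then show ?thesis unfolding drift_rate_def speed_def using speed_scale_pos
    by (intro mult_pos_pos add_pos_pos)
qed

text \<open>The logarithm of c is split off because it cancels between the factors by
  \<open>c_mult\<close>; the rest depends on w alone.\<close>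

lemma avg_entropy: "avg f (- ln (\<alpha> f)) (- ln (\<alpha> f * w f)) = kap * avg f 1 2 + lagr (w f) - (1 + lam) * ln (c f)"
proof -
  have w: "w f > 0" "2 + w f > 0" "2 - w f * w f > 0" using w_pos[of f] denom_pos[of f] by simp_all
  have la: "ln (\<alpha> f) = ln (w f) - ln (2 - w f * w f)" unfolding \<alpha>_def using w by (simp add: ln_div)
  have lc: "ln (c f) = ln (\<alpha> f) + ln (2 + w f)" unfolding c_def using w \<alpha>_pos[of f] by (simp add: ln_mult)
  have "avg f (- ln (\<alpha> f)) (- ln (\<alpha> f * w f)) = - ln (\<alpha> f) - w f * ln (w f) / (2 + w f)"
    unfolding avg_def using w \<alpha>_pos[of f] by (simp add: ln_mult field_simps)
  moreover have "avg f 1 2 = (2 + 2 * w f) / (2 + w f)" unfolding avg_def by (simp add: mult.commute)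
  ultimately show ?thesis
    unfolding lagr_def lc la power2_eq_square by (simp add: algebra_simps)
qed

lemma sum_avg_entropy:
  "avg True (- ln (\<alpha> True)) (- ln (\<alpha> True * w True)) + avg False (- ln (\<alpha> False)) (- ln (\<alpha> False * w False))
   = kap * (avg True 1 2 + avg False 1 2) + (lagr (w True) + lagr (w False))"
proof -
  have "ln (c True) + ln (c False) = ln (c True * c False)"
    using c_pos[of True] c_pos[of False] by (simp add: ln_mult)
  then have "ln (c True) + ln (c False) = 0" using c_mult[of True] by simp
  then have "(1 + lam) * ln (c True) + (1 + lam) * ln (c False) = 0" by (simp add: distrib_left[symmetric])
  then show ?thesis unfolding avg_entropy by (simp add: algebra_simps)
qed

lemma entropy_rate_le: "entropy_rate \<le> kap * drift_rate"
proof -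
  have "lagr (w True) + lagr (w False) \<le> 0"
    using lagr_nonpos[OF w_pos w_less, of True] lagr_nonpos[OF w_pos w_less, of False] by simp
  then have "C True / (1 + c False) * (kap * (avg True 1 2 + avg False 1 2) + (lagr (w True) + lagr (w False)))
      \<le> C True / (1 + c False) * (kap * (avg True 1 2 + avg False 1 2))"
    using speed_scale_pos by (intro mult_left_mono) auto
  then show ?thesis unfolding entropy_rate_def drift_rate_def speed_def sum_avg_entropy by (simp add: mult_ac)
qed

lemma entropy_rate_golden:
  assumes "\<And>f. w f = tau"
  shows "entropy_rate = kap * drift_rate"
proof -
  have "lagr (w True) + lagr (w False) = 0" by (simp add: assms lagr_tau)
  then show ?thesis
    unfolding entropy_rate_def drift_rate_def speed_def sum_avg_entropy by (simp add: mult_ac)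
qed

end

section \<open>Existence of the parameters for given step probabilities\<close>

lemma cone_params_golden: "cone_params (\<lambda>_. 1 / 2) (\<lambda>_. tau) (\<lambda>_. tau * tau)"
proof
  have "tau * tau * (2 - tau * tau) = (1 - tau) * (1 + tau)" unfolding tau_sq by simp
  also have "\<dots> = 1 - tau * tau" by (simp add: algebra_simps)
  also have "\<dots> = tau" unfolding tau_sq by simp
  finally show "tau * tau * (2 - tau * tau) = tau" .
  have "tau * (1 - 1 / 2 * (1 - tau)) = (tau + tau * tau) / 2" by (simp add: field_simps)
  also have "tau + tau * tau = 1" unfolding tau_sq by simp
  finally show "tau * (1 - 1 / 2 * (tau * tau)) = 1 / 2" unfolding tau_sq .
qed (use tau_bounds in auto)

text \<open>Elimination leaves one equation \<phi> x = 0 for x = w True. It always has the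
  degenerate root x = 1, where the derivative is negative; so \<phi> is positive just to the left of
  1, while \<phi> 0 is negative, and the intermediate value theorem yields a root strictly between 0
  and 1.\<close>

lemma ex_cone_params:
  assumes pos: "\<And>f. 0 < P f" and sum: "P True + P False = 1"
  obtains w \<alpha> where "cone_params P w \<alpha>"
proof -
  define h where "h x = x / (2 - x * x)" for x :: real
  let ?p = "P True" and ?q = "P False"
  define z where "z x = ?q / (1 - ?p * h x)" for x
  define \<phi> where "\<phi> x = x * (1 - ?q * h (z x)) - ?p" for x
  have pq: "0 < ?p" "0 < ?q" "?p = 1 - ?q" using pos[of True] pos[of False] sum by auto
  have sq: "x * x \<le> 1" if "0 \<le> x" "x \<le> 1" for x :: real using that by (simp add: mult_le_one)
  have h1: "h 1 = 1" by (simp add: h_def)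
  have h01: "0 \<le> h x \<and> h x \<le> 1" if "0 \<le> x" "x \<le> 1" for x
    using that sq[OF that] by (auto simp: h_def divide_le_eq)
  have h_less: "h x < 1" if "0 \<le> x" "x < 1" for x
    using that sq[of x] by (auto simp: h_def divide_less_eq)
  have den: "?q \<le> 1 - ?p * h x" if "0 \<le> x" "x \<le> 1" for x
  proof -
    have "?p * h x \<le> ?p * 1" using h01[OF that] pq(1) by (intro mult_left_mono) simp_all
    then show ?thesis using pq(3) by linarith
  qed
  have z01: "0 < z x \<and> z x \<le> 1" if "0 \<le> x" "x \<le> 1" for x
    using den[OF that] pq unfolding z_def by (auto simp: divide_le_eq)
  have z_less: "z x < 1" if "0 \<le> x" "x < 1" for x
  proof -
    have "?p * h x < ?p * 1" using h_less[OF that] pq(1) by (rule mult_strict_left_mono)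
    then have "?q < 1 - ?p * h x" using pq(3) by linarith
    then show ?thesis using pq(2) unfolding z_def by (simp add: divide_less_eq)
  qed
  have dh: "(h has_real_derivative 3) (at 1)"
    unfolding h_def by (auto intro!: derivative_eq_intros)
  have "((\<lambda>x. ?q / (1 - ?p * h x)) has_real_derivative 3 * ?p / ?q) (at 1)"
    using pq by (auto intro!: derivative_eq_intros dh simp: h1 minus_divide_left)
  then have dz: "(z has_real_derivative 3 * ?p / ?q) (at 1)" unfolding z_def .
  have z1: "z 1 = 1" unfolding z_def h1 using pq by simp
  have "((\<lambda>x. h (z x)) has_real_derivative 3 * (3 * ?p / ?q)) (at 1)"
    using DERIV_chain2[of h 3 z 1, OF _ dz] dh z1 by simp
  \<comment> \<open>The contribution - 9 * P True contains the slope 3 of h at 1 twice, once for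
    each factor; the leading x contributes 1 - P False = P True.\<close>
  then have "(\<phi> has_real_derivative - 8 * ?p) (at 1)"
    unfolding \<phi>_def using pq by (auto intro!: derivative_eq_intros simp: z1 h1)
  moreover have "- 8 * ?p < 0" using pq by simp
  ultimately obtain d where d: "d > 0" "\<And>e. 0 < e \<Longrightarrow> e < d \<Longrightarrow> \<phi> 1 < \<phi> (1 - e)"
    using DERIV_neg_dec_left by blast
  define y where "y = 1 - min (d / 2) (1 / 2)"
  have y: "0 < y" "y < 1" using d(1) by (auto simp: y_def)
  have "\<phi> 1 < \<phi> y" unfolding y_def using d by (intro d(2)) auto
  moreover have "\<phi> 1 = 0" using pq by (simp add: \<phi>_def z1 h1)
  ultimately have py: "0 < \<phi> y" by simp
  have p0: "\<phi> 0 < 0" using pq by (simp add: \<phi>_def)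
  have ch: "continuous_on {0..1} h"
    unfolding h_def using sq by (intro continuous_intros) (auto simp: not_le[symmetric], force)
  have cz: "continuous_on {0..y} z"
    unfolding z_def using den y pq by (intro continuous_intros continuous_on_subset[OF ch]) force+
  have "continuous_on {0..y} (\<lambda>x. h (z x))"
    using z01 y by (intro continuous_on_compose2[OF ch cz]) (auto simp: less_imp_le)
  then have "continuous_on {0..y} \<phi>"
    unfolding \<phi>_def by (intro continuous_intros)
  then obtain x where x: "0 \<le> x" "x \<le> y" "\<phi> x = 0"
    using IVT'[of \<phi> 0 0 y] p0 py y by auto
  have x0: "0 < x" using x p0 by (cases "x = 0") auto
  have x1: "x < 1" using x y by simp
  have zx: "0 < z x" "z x < 1" using z01[of x] z_less[of x] x0 x1 by auto
  have zeq: "z x * (1 - ?p * h x) = ?q" using den[of x] x0 x1 pq by (simp add: z_def)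
  have heq: "h u * (2 - u * u) = u" if "0 < u" "u < 1" for u
    using that sq[of u] by (simp add: h_def)
  show thesis
  proof
    show "cone_params P (\<lambda>f. if f then x else z x) (\<lambda>f. if f then h x else h (z x))"
    proof
      fix f
      show "P f + P (\<not> f) = 1" using sum by (cases f) auto
    qed (use pos x0 x1 zx zeq x(3) heq in \<open>auto simp: \<phi>_def\<close>)
  qed
qed

lemma exp_le_quadratic:
  fixes x :: real
  assumes "\<bar>x\<bar> \<le> 1"
  shows "exp x \<le> 1 + x + x\<^sup>2"
proof (cases "0 \<le> x")
  case True
  then show ?thesis using assms exp_bound[of x] by simp
next
  case False
  define y where "y = - x"
  have y: "0 \<le> y" "x = - y" using False by (simp_all add: y_def)
  have "1 + y + y\<^sup>2 / 2 \<le> exp y" using y exp_lower_Taylor_quadratic[of y] by simp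
  moreover have q: "0 < 1 + y + y\<^sup>2 / 2" using y by (simp add: add_pos_nonneg)
  ultimately have "inverse (exp y) \<le> inverse (1 + y + y\<^sup>2 / 2)" by (intro le_imp_inverse_le)
  also have "\<dots> \<le> 1 - y + y\<^sup>2"
  proof -
    have "(1 - y + y\<^sup>2) * (1 + y + y\<^sup>2 / 2) = 1 + (y\<^sup>2 + y ^ 3 + y ^ 4) / 2"
      by (simp add: field_simps power2_eq_square power3_eq_cube power4_eq_xxxx)
    also have "\<dots> \<ge> 1" using y by simp
    finally show ?thesis using q by (simp add: inverse_eq_divide divide_le_eq)
  qed
  finally show ?thesis using y by (simp add: exp_minus)
qed

section \<open>The averaging operator and its harmonic function\<close>

context cone_params
begin

definition step :: "(stack \<Rightarrow> real) \<Rightarrow> stack \<Rightarrow> real" where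
  "step \<phi> st = (\<Sum>f\<in>UNIV. P f / 2 * (\<phi> (push (f, 1) st) + \<phi> (push (f, 3) st)))"

lemma step_split:
  "step \<phi> st = P f / 2 * (\<phi> (push (f, 1) st) + \<phi> (push (f, 3) st))
     + P (\<not> f) / 2 * (\<phi> (push (\<not> f, 1) st) + \<phi> (push (\<not> f, 3) st))"
  unfolding step_def UNIV_bool by (cases f) simp_all

lemma step_mono:
  assumes "\<And>l. l \<in> gens \<Longrightarrow> \<phi> (push l st) \<le> \<psi> (push l st)"
  shows "step \<phi> st \<le> step \<psi> st"
  unfolding step_def
  by (intro sum_mono mult_left_mono add_mono assms) (simp_all add: gens_iff P_pos less_imp_le)

lemma step_const: "step (\<lambda>_. k) st = k"
  using P_sum[of True] unfolding step_split[of _ _ True]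
  by (simp add: distrib_right[symmetric] add_divide_distrib[symmetric])

lemma step_add: "step (\<lambda>s. \<phi> s + \<psi> s) st = step \<phi> st + step \<psi> st"
  unfolding step_def by (simp add: algebra_simps sum.distrib)

lemma step_cmult: "step (\<lambda>s. k * \<phi> s) st = k * step \<phi> st"
  unfolding step_def sum_distrib_left by (intro sum.cong) (simp_all add: algebra_simps)

definition hit1 :: "bool \<times> int \<Rightarrow> real" where
  "hit1 l = (if snd l = 2 then \<alpha> (fst l) * w (fst l) else \<alpha> (fst l))"

definition hit :: "stack \<Rightarrow> real" where
  "hit st = prod_list (map hit1 st)"

lemma hit_simps [simp]: "hit [] = 1" "hit (l # st) = hit1 l * hit st"
  by (simp_all add: hit_def)

lemma hit1_pos: "0 < hit1 l"
  unfolding hit1_def using \<alpha>_pos w_pos by simp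

lemma hit1_le: "hit1 l \<le> max (\<alpha> True) (\<alpha> False)"
proof -
  have "hit1 l \<le> \<alpha> (fst l)"
    unfolding hit1_def using mult_left_mono[of "w (fst l)" 1 "\<alpha> (fst l)"] \<alpha>_pos[of "fst l"] w_less[of "fst l"] by simp
  also have "\<dots> \<le> max (\<alpha> True) (\<alpha> False)" by (cases "fst l") simp_all
  finally show ?thesis .
qed

lemma hit_pos: "0 < hit st"
  by (induction st) (simp_all add: hit1_pos)

lemma reduced_Cons_cases:
  assumes "reduced (l # st)"
  obtains (one) f x where "l = (f, x)" "x = 1 \<or> x = 3" "avoids f st" "reduced st"
  | (two) f where "l = (f, 2)" "avoids f st" "reduced st"
  using assms by (cases l) auto

lemma push_gen_one:
  assumes "x = 1 \<or> x = 3" "avoids f st"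
  shows "\<phi> (push (f, 1) ((f, x) # st)) + \<phi> (push (f, 3) ((f, x) # st)) = \<phi> st + (\<phi> ((f, 2) # st) :: real)"
  using assms by auto

lemma push_other: "push (\<not> f, 1) ((f, x) # st) = (\<not> f, 1) # (f, x) # st"
  "push (\<not> f, 3) ((f, x) # st) = (\<not> f, 3) # (f, x) # st"
  by auto

lemma push_gen_two:
  "push (f, 1) ((f, 2) # st) = (f, 3) # st" "push (f, 3) ((f, 2) # st) = (f, 1) # st"
  by auto

lemma hit1_values: "hit1 (f, 1) = \<alpha> f" "hit1 (f, 3) = \<alpha> f" "hit1 (f, 2) = \<alpha> f * w f"
  by (simp_all add: hit1_def)

text \<open>The first-step equation on the killed 4-cycle: from a neighbour, the base point and the
  antipode are equally likely.\<close>

lemma two_\<alpha>: "2 * \<alpha> f = w f + \<alpha> f * w f * w f"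
  using \<alpha>_eq[of f] by (simp add: algebra_simps)

text \<open>The next step within the coset is made at once, or after an excursion into the other
  factor that returns with probability \<alpha> of that factor.\<close>

lemma P_w: "P f + w f * (P (\<not> f) * \<alpha> (\<not> f)) = w f"
  using w_eq[of f] by (simp add: algebra_simps)

lemma harmonic_one: "P f / 2 * (1 + \<alpha> f * w f) + P (\<not> f) * \<alpha> (\<not> f) * \<alpha> f = \<alpha> f"
proof -
  have "w f * (P f / 2 * (1 + \<alpha> f * w f)) = P f * (w f + \<alpha> f * w f * w f) / 2"
    by (simp add: field_simps)
  also have "\<dots> = P f * (2 * \<alpha> f) / 2" by (simp only: two_\<alpha>)
  finally have 1: "w f * (P f / 2 * (1 + \<alpha> f * w f)) = P f * \<alpha> f" by simp
  have "w f * (P f / 2 * (1 + \<alpha> f * w f) + P (\<not> f) * \<alpha> (\<not> f) * \<alpha> f)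
      = P f * \<alpha> f + w f * (P (\<not> f) * \<alpha> (\<not> f)) * \<alpha> f"
    by (subst distrib_left) (simp only: 1 mult_ac)
  also have "\<dots> = w f * \<alpha> f" unfolding distrib_right[symmetric] P_w ..
  finally show ?thesis using w_pos[of f] by simp
qed

lemma harmonic_two: "P f * \<alpha> f + P (\<not> f) * \<alpha> (\<not> f) * (\<alpha> f * w f) = \<alpha> f * w f"
proof -
  have "P f * \<alpha> f + P (\<not> f) * \<alpha> (\<not> f) * (\<alpha> f * w f) = \<alpha> f * (P f + w f * (P (\<not> f) * \<alpha> (\<not> f)))"
    by (simp add: algebra_simps)
  then show ?thesis unfolding P_w .
qed

text \<open>First-step analysis at the top letter; what lies below enters only as a common factor.
  Harmonicity fails at the empty stack, where \<open>hit\<close> takes its strict maximum 1.\<close>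

lemma step_hit:
  assumes "reduced st" "st \<noteq> []"
  shows "step hit st = hit st"
proof -
  obtain l st' where st: "st = l # st'" using assms(2) by (cases st) auto
  show ?thesis
    using assms(1) unfolding st
  proof (cases rule: reduced_Cons_cases)
    case (one f x)
    have "hit1 (f, x) = \<alpha> f" using one(2) by (auto simp: hit1_values)
    then have "step hit (l # st') = (P f / 2 * (1 + \<alpha> f * w f) + P (\<not> f) * \<alpha> (\<not> f) * \<alpha> f) * hit st'"
      unfolding one(1) step_split[of _ _ f] push_gen_one[OF one(2,3)] push_other
      by (simp add: hit1_values algebra_simps)
    then show "step hit (l # st') = hit (l # st')" unfolding harmonic_one using \<open>hit1 (f, x) = \<alpha> f\<close> one(1) by simp
  next
    case (two f)
    have "step hit (l # st') = (P f * \<alpha> f + P (\<not> f) * \<alpha> (\<not> f) * (\<alpha> f * w f)) * hit st'"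
      unfolding two(1) step_split[of _ _ f] push_gen_two push_other
      by (simp add: hit1_values algebra_simps)
    then show "step hit (l # st') = hit (l # st')" unfolding harmonic_two two(1) by (simp add: hit1_values)
  qed
qed

section \<open>Additive functionals as martingales with constant drift\<close>

fun weight :: "(bool \<Rightarrow> real) \<Rightarrow> (bool \<Rightarrow> real) \<Rightarrow> stack \<Rightarrow> real" where
  "weight a b [] = 0"
| "weight a b (l # st) = (if snd l = 2 then b (fst l) else a (fst l)) + weight a b st"

text \<open>The discount serves two ends: being harmonic, it keeps the contributions from below the
  top unchanged in mean; decaying geometrically with the number of letters, it keeps the sum
  bounded.\<close>

fun corr :: "(bool \<Rightarrow> real) \<Rightarrow> (bool \<Rightarrow> real) \<Rightarrow> real \<Rightarrow> stack \<Rightarrow> real" where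
  "corr a b k [] = k"
| "corr a b k (l # st) = (if snd l = 2 then b (fst l) else a (fst l)) + hit1 l * corr a b k st"

lemma corr_bounded:
  "\<exists>B. \<forall>st. \<bar>corr a b k st\<bar> \<le> B"
proof -
  define \<theta> where "\<theta> = max (\<alpha> True) (\<alpha> False)"
  define m where "m = \<bar>a True\<bar> + \<bar>a False\<bar> + \<bar>b True\<bar> + \<bar>b False\<bar>"
  define B where "B = max \<bar>k\<bar> (m / (1 - \<theta>))"
  have \<theta>: "0 < \<theta>" "\<theta> < 1" unfolding \<theta>_def using \<alpha>_pos \<alpha>_less by (auto simp: less_max_iff_disj)
  have "m / (1 - \<theta>) \<le> B" by (simp add: B_def)
  then have mB: "m + \<theta> * B \<le> B" using \<theta> by (simp add: divide_le_eq algebra_simps)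
  have B0: "0 \<le> B" unfolding B_def by simp
  have "\<bar>corr a b k st\<bar> \<le> B" for st
  proof (induction st)
    case Nil
    then show ?case by (simp add: B_def)
  next
    case (Cons l st)
    have "\<bar>if snd l = 2 then b (fst l) else a (fst l)\<bar> \<le> m"
      unfolding m_def by (cases "fst l") simp_all
    moreover have "\<bar>hit1 l * corr a b k st\<bar> \<le> \<theta> * B"
      unfolding abs_mult using hit1_pos[of l] hit1_le[of l] Cons B0 \<theta>
      by (intro mult_mono) (simp_all add: \<theta>_def)
    ultimately have "\<bar>corr a b k (l # st)\<bar> \<le> m + \<theta> * B"
      unfolding corr.simps by linarith
    then show ?case using mB by linarith
  qed
  then show ?thesis by blast
qed

lemma weight_push_bounded:
  assumes "reduced st" "l \<in> gens"
  shows "\<bar>weight a b (push l st) - weight a b st\<bar> \<le> \<bar>a True\<bar> + \<bar>a False\<bar> + \<bar>b True\<bar> + \<bar>b False\<bar>"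
proof -
  obtain f x where l: "l = (f, x)" by (cases l)
  have x: "x = 1 \<or> x = 3" using assms(2) by (simp add: l gens_iff)
  have "\<bar>weight a b (push (f, x) st) - weight a b st\<bar> \<le> \<bar>a f\<bar> + \<bar>b f\<bar>"
  proof (cases "avoids f st")
    case True
    then show ?thesis using x by (auto simp: push_avoids)
  next
    case False
    then obtain y st' where st: "st = (f, y) # st'" by (cases st) auto
    have "y = 1 \<or> y = 2 \<or> y = 3" using assms(1) by (auto simp: st)
    then show ?thesis using x unfolding st by (elim disjE) simp_all
  qed
  also have "\<dots> \<le> \<bar>a True\<bar> + \<bar>a False\<bar> + \<bar>b True\<bar> + \<bar>b False\<bar>" by (cases f) simp_all
  finally show ?thesis unfolding l .
qed

lemma ex_martingale:
  fixes a b :: "bool \<Rightarrow> real"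
  obtains \<Psi> K D where
    "\<And>st. \<bar>\<Psi> st - weight a b st\<bar> \<le> K"
    "\<And>st. reduced st \<Longrightarrow> step \<Psi> st = \<Psi> st + speed a b"
    "\<And>st l. reduced st \<Longrightarrow> l \<in> gens \<Longrightarrow> \<bar>\<Psi> (push l st) - \<Psi> st\<bar> \<le> D"
proof -
  define \<gamma> where "\<gamma> = speed a b"
  obtain r s where r:
    "\<And>f. P f / 2 * (b f - 2 * a f + s f) + P (\<not> f) * (a (\<not> f) + r (\<not> f) + \<alpha> (\<not> f) * r f) - r f = \<gamma>"
    "\<And>f. P f * (a f - b f + r f) + P (\<not> f) * (a (\<not> f) + r (\<not> f) + \<alpha> (\<not> f) * s f) - s f = \<gamma>"
    unfolding \<gamma>_def by (rule ex_corrector[where \<omega>\<^sub>1 = a and \<omega>\<^sub>2 = b]) blast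
  \<comment> \<open>The probability of never returning to the empty stack. Its positivity makes the
    equation at the empty stack solvable for the value k there.\<close>
  define e where "e = 1 - P True * \<alpha> True - P False * \<alpha> False"
  have "P f * \<alpha> f < P f * 1" for f
    using \<alpha>_less P_pos by (intro mult_strict_left_mono)
  from this[of True] this[of False] have e: "e > 0" using P_sum[of True] by (simp add: e_def)
  define k where "k = (P True * (a True + r True) + P False * (a False + r False) - \<gamma>) / e"
  have k: "P True * (a True + r True + \<alpha> True * k) + P False * (a False + r False + \<alpha> False * k) = k + \<gamma>"
  proof -
    have "k * e = P True * (a True + r True) + P False * (a False + r False) - \<gamma>" using e by (simp add: k_def)
    then show ?thesis by (simp add: e_def algebra_simps)
  qed
  define \<Psi> where "\<Psi> st = weight a b st + corr r s k st" for st
  obtain B where B: "\<And>st. \<bar>corr r s k st\<bar> \<le> B" using corr_bounded by blast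
  show thesis
  proof
    show "\<bar>\<Psi> st - weight a b st\<bar> \<le> B" for st using B[of st] by (simp add: \<Psi>_def)
    show "\<bar>\<Psi> (push l st) - \<Psi> st\<bar> \<le> \<bar>a True\<bar> + \<bar>a False\<bar> + \<bar>b True\<bar> + \<bar>b False\<bar> + (B + B)"
      if "reduced st" "l \<in> gens" for st l
      using weight_push_bounded[OF that, of a b] B[of st] B[of "push l st"] unfolding \<Psi>_def by linarith
    show "step \<Psi> st = \<Psi> st + speed a b" if red: "reduced st" for st
    proof (cases st)
      case Nil
      have "step \<Psi> [] = P True * (a True + r True + \<alpha> True * k) + P False * (a False + r False + \<alpha> False * k)"
        unfolding step_split[of _ _ True] \<Psi>_def by (simp add: hit1_values field_simps)
      then show ?thesis unfolding k Nil by (simp add: \<Psi>_def \<gamma>_def)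
    next
      case (Cons l st')
      have "reduced (l # st')" using red Cons by simp
      then have "step \<Psi> (l # st') = \<Psi> (l # st') + \<gamma>"
      proof (cases rule: reduced_Cons_cases)
        case (one f x)
        have h: "hit1 (f, x) = \<alpha> f" "x \<noteq> 2" using one(2) by (auto simp: hit1_values)
        define W V where "W = weight a b st'" and "V = corr r s k st'"
        have "step \<Psi> (l # st') = P f / 2 * (\<Psi> st' + \<Psi> ((f, 2) # st'))
            + P (\<not> f) / 2 * (\<Psi> ((\<not> f, 1) # (f, x) # st') + \<Psi> ((\<not> f, 3) # (f, x) # st'))"
          unfolding one(1) step_split[of _ _ f] push_gen_one[OF one(2,3)] push_other ..
        also have "\<dots> = P f / 2 * ((W + V) + (W + b f + s f + \<alpha> f * w f * V))
            + P (\<not> f) * (W + a f + a (\<not> f) + r (\<not> f) + \<alpha> (\<not> f) * (r f + \<alpha> f * V))"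
          unfolding \<Psi>_def using h by (simp add: hit1_values W_def V_def algebra_simps)
        \<comment> \<open>Three groups: total probability handles the weights, the corrector
          equation handles r and s, and harmonicity handles the correction V from below.\<close>
        also have "\<dots> = (P f + P (\<not> f)) * (W + a f)
            + (P f / 2 * (b f - 2 * a f + s f) + P (\<not> f) * (a (\<not> f) + r (\<not> f) + \<alpha> (\<not> f) * r f))
            + (P f / 2 * (1 + \<alpha> f * w f) + P (\<not> f) * \<alpha> (\<not> f) * \<alpha> f) * V"
          by (simp add: field_simps)
        also have "\<dots> = W + a f + (r f + \<gamma>) + \<alpha> f * V"
          unfolding harmonic_one P_sum using r(1)[of f] by simp
        also have "\<dots> = \<Psi> (l # st') + \<gamma>"
          unfolding one(1) \<Psi>_def using h by (simp add: W_def V_def)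
        finally show ?thesis .
      next
        case (two f)
        define W V where "W = weight a b st'" and "V = corr r s k st'"
        have "step \<Psi> (l # st') = P f * (W + a f + r f + \<alpha> f * V)
            + P (\<not> f) * (W + b f + a (\<not> f) + r (\<not> f) + \<alpha> (\<not> f) * (s f + \<alpha> f * w f * V))"
          unfolding two(1) step_split[of _ _ f] push_gen_two push_other \<Psi>_def
          by (simp add: hit1_values W_def V_def algebra_simps)
        also have "\<dots> = (P f + P (\<not> f)) * (W + b f)
            + (P f * (a f - b f + r f) + P (\<not> f) * (a (\<not> f) + r (\<not> f) + \<alpha> (\<not> f) * s f))
            + (P f * \<alpha> f + P (\<not> f) * \<alpha> (\<not> f) * (\<alpha> f * w f)) * V"
          by (simp add: algebra_simps)
        also have "\<dots> = W + b f + (s f + \<gamma>) + \<alpha> f * w f * V"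
          unfolding harmonic_two P_sum using r(2)[of f] by simp
        also have "\<dots> = \<Psi> (l # st') + \<gamma>"
          unfolding two(1) \<Psi>_def by (simp add: W_def V_def hit1_values)
        finally show ?thesis .
      qed
      then show ?thesis by (simp add: Cons \<gamma>_def)
    qed
  qed
qed

lemma neg_ln_hit: "- ln (hit st) = weight (\<lambda>f. - ln (\<alpha> f)) (\<lambda>f. - ln (\<alpha> f * w f)) st"
proof (induction st)
  case (Cons l st)
  have "ln (hit (l # st)) = ln (hit1 l) + ln (hit st)"
    using hit1_pos[of l] hit_pos[of st] by (simp add: ln_mult)
  then show ?case using Cons by (simp add: hit1_def)
qed simp

lemma len_weight: "real (len st) = weight (\<lambda>_. 1) (\<lambda>_. 2) st"
  by (induction st) simp_all

end

section \<open>Entropy\<close>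

fun law :: "(bool \<times> int) pmf \<Rightarrow> nat \<Rightarrow> stack pmf" where
  "law \<nu> 0 = return_pmf []"
| "law \<nu> (Suc n) = bind_pmf (law \<nu> n) (\<lambda>st. map_pmf (\<lambda>l. push l st) \<nu>)"

lemma finite_gens: "finite gens"
  by (simp add: gens_def)

lemma law_reduced:
  assumes "set_pmf \<nu> \<subseteq> gens" "st \<in> set_pmf (law \<nu> n)"
  shows "reduced st"
  using assms(2)
proof (induction n arbitrary: st)
  case (Suc n)
  then obtain s l where "s \<in> set_pmf (law \<nu> n)" "l \<in> set_pmf \<nu>" "st = push l s" by auto
  then show ?case using Suc.IH reduced_push_gen assms(1) by blast
qed simp

lemma length_push_le: "length (push l st) \<le> Suc (length st)"
  by (cases l; cases st) auto

lemma law_length: "st \<in> set_pmf (law \<nu> n) \<Longrightarrow> length st \<le> n"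
proof (induction n arbitrary: st)
  case (Suc n)
  then obtain s l where s: "s \<in> set_pmf (law \<nu> n)" and st: "st = push l s" by auto
  show ?case using Suc.IH[OF s] length_push_le[of l s] unfolding st by simp
qed simp

lemma finite_law:
  assumes "set_pmf \<nu> \<subseteq> gens"
  shows "finite (set_pmf (law \<nu> n))"
  using finite_subset[OF assms finite_gens] by (induction n) auto

lemma conv_power_law:
  assumes "set_pmf \<nu> \<subseteq> gens"
  shows "conv_power G4 (map_pmf (\<lambda>l. cls [l]) \<nu>) n = map_pmf cls (law \<nu> n)"
proof (induction n)
  case 0
  show ?case by (simp add: one_G4)
next
  case (Suc n)
  have "conv_power G4 (map_pmf (\<lambda>l. cls [l]) \<nu>) (Suc n)
    = bind_pmf (law \<nu> n) (\<lambda>st. map_pmf (\<lambda>l. cls st \<otimes>\<^bsub>G4\<^esub> cls [l]) \<nu>)"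
    unfolding conv_power.simps Suc
    by (simp add: pair_pmf_def map_pmf_def bind_assoc_pmf bind_return_pmf)
  also have "\<dots> = bind_pmf (law \<nu> n) (\<lambda>st. map_pmf (\<lambda>l. cls (push l st)) \<nu>)"
  proof (intro bind_pmf_cong map_pmf_cong HOL.refl)
    fix st l assume "st \<in> set_pmf (law \<nu> n)" "l \<in> set_pmf \<nu>"
    then have "reduced st" "l \<in> gens" using law_reduced[OF assms] assms by auto
    then show "cls st \<otimes>\<^bsub>G4\<^esub> cls [l] = cls (push l st)" by (rule cls_mult_gen)
  qed
  also have "\<dots> = map_pmf cls (law \<nu> (Suc n))"
    by (simp add: map_bind_pmf map_pmf_comp)
  finally show ?case .
qed

lemma shannon_entropy_finite:
  assumes "finite (set_pmf p)"
  shows "shannon_entropy p = - (\<Sum>x\<in>set_pmf p. pmf p x * ln (pmf p x))"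
proof -
  have "(\<Sum>\<^sub>\<infinity>x. pmf p x * ln (pmf p x)) = (\<Sum>\<^sub>\<infinity>x\<in>set_pmf p. pmf p x * ln (pmf p x))"
    by (rule infsum_cong_neutral) (auto simp: set_pmf_iff)
  then show ?thesis unfolding shannon_entropy_def using assms by simp
qed

lemma shannon_entropy_map:
  assumes "finite (set_pmf p)" "inj_on f (set_pmf p)"
  shows "shannon_entropy (map_pmf f p) = shannon_entropy p"
proof -
  have "(\<Sum>x\<in>f ` set_pmf p. pmf (map_pmf f p) x * ln (pmf (map_pmf f p) x))
      = (\<Sum>x\<in>set_pmf p. pmf p x * ln (pmf p x))"
    using assms(2) by (simp add: sum.reindex pmf_map_inj)
  then show ?thesis using assms(1) by (simp add: shannon_entropy_finite)
qed

section \<open>Expectations along the walk on stacks\<close>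

locale cone_walk = cone_params +
  fixes \<nu> :: "(bool \<times> int) pmf"
  assumes \<nu>_gens: "set_pmf \<nu> \<subseteq> gens"
    and \<nu>_eq: "(f, x) \<in> gens \<Longrightarrow> pmf \<nu> (f, x) = P f / 2"
begin

definition mean :: "nat \<Rightarrow> (stack \<Rightarrow> real) \<Rightarrow> real" where
  "mean n \<phi> = (\<Sum>st\<in>set_pmf (law \<nu> n). pmf (law \<nu> n) st * \<phi> st)"

lemma finite_supp: "finite (set_pmf (law \<nu> n))"
  by (rule finite_law[OF \<nu>_gens])

lemma supp_reduced: "st \<in> set_pmf (law \<nu> n) \<Longrightarrow> reduced st"
  by (rule law_reduced[OF \<nu>_gens])

lemma mean_expectation: "mean n \<phi> = measure_pmf.expectation (law \<nu> n) \<phi>"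
  unfolding mean_def by (subst integral_measure_pmf[OF finite_supp]) auto

lemma sum_gens: "(\<Sum>l\<in>gens. pmf \<nu> l * \<phi> l) = (\<Sum>f\<in>UNIV. P f / 2 * (\<phi> (f, 1) + \<phi> (f, 3)))"
proof -
  have e: "pmf \<nu> (f, 1) = P f / 2" "pmf \<nu> (f, 3) = P f / 2" for f
    using \<nu>_eq[of f] by (simp_all add: gens_iff)
  have "(\<Sum>l\<in>gens. pmf \<nu> l * \<phi> l) = pmf \<nu> (True, 1) * \<phi> (True, 1) + pmf \<nu> (True, 3) * \<phi> (True, 3)
      + pmf \<nu> (False, 1) * \<phi> (False, 1) + pmf \<nu> (False, 3) * \<phi> (False, 3)"
    unfolding gens_def by simp
  then show ?thesis unfolding e UNIV_bool by (simp add: algebra_simps)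
qed

lemma expectation_gens: "measure_pmf.expectation \<nu> \<phi> = (\<Sum>l\<in>gens. pmf \<nu> l * \<phi> l)"
  for \<phi> :: "bool \<times> int \<Rightarrow> real"
  using \<nu>_gens by (subst integral_measure_pmf[OF finite_gens]) auto

lemma mean_0: "mean 0 \<phi> = \<phi> []"
  by (simp add: mean_def)

lemma mean_Suc: "mean (Suc n) \<phi> = mean n (step \<phi>)"
proof -
  have "mean (Suc n) \<phi> = (\<Sum>st\<in>set_pmf (law \<nu> n). pmf (law \<nu> n) st *\<^sub>R
      measure_pmf.expectation (map_pmf (\<lambda>l. push l st) \<nu>) \<phi>)"
    unfolding mean_expectation law.simps
    by (rule pmf_expectation_bind[OF finite_supp]) (auto intro: finite_subset[OF \<nu>_gens finite_gens])
  also have "\<dots> = mean n (step \<phi>)"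
    unfolding mean_def step_def by (simp add: expectation_gens sum_gens)
  finally show ?thesis .
qed

lemma mean_cong: "(\<And>st. reduced st \<Longrightarrow> \<phi> st = \<psi> st) \<Longrightarrow> mean n \<phi> = mean n \<psi>"
  unfolding mean_def using supp_reduced by (intro sum.cong) auto

lemma mean_mono: "(\<And>st. reduced st \<Longrightarrow> \<phi> st \<le> \<psi> st) \<Longrightarrow> mean n \<phi> \<le> mean n \<psi>"
  unfolding mean_def using supp_reduced by (intro sum_mono mult_left_mono) auto

lemma mean_const: "mean n (\<lambda>_. k) = k"
  unfolding mean_def sum_distrib_right[symmetric] using finite_supp by (simp add: sum_pmf_eq_1)

lemma mean_add: "mean n (\<lambda>st. \<phi> st + \<psi> st) = mean n \<phi> + mean n \<psi>"
  unfolding mean_def by (simp add: distrib_left sum.distrib)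

lemma mean_cmult: "mean n (\<lambda>st. k * \<phi> st) = k * mean n \<phi>"
  unfolding mean_def sum_distrib_left by (intro sum.cong) auto

text \<open>The corrected functional gains exactly \<open>speed\<close> per step in mean, and the
  corrector costs only a constant.\<close>

lemma mean_weight_bound: "\<exists>K. \<forall>n. \<bar>mean n (weight a b) - real n * speed a b\<bar> \<le> K"
proof -
  obtain \<Psi> K D where \<Psi>: "\<And>st. \<bar>\<Psi> st - weight a b st\<bar> \<le> K"
    "\<And>st. reduced st \<Longrightarrow> step \<Psi> st = \<Psi> st + speed a b"
    using ex_martingale[of a b] by metis
  have 1: "mean n \<Psi> = \<Psi> [] + real n * speed a b" for n
  proof (induction n)
    case (Suc n)
    have "mean (Suc n) \<Psi> = mean n (\<lambda>st. \<Psi> st + speed a b)"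
      unfolding mean_Suc using \<Psi>(2) by (rule mean_cong)
    then show ?case unfolding mean_add mean_const Suc by (simp add: algebra_simps)
  qed (simp add: mean_0)
  have "mean n (weight a b) \<le> mean n (\<lambda>st. \<Psi> st + K)" "mean n \<Psi> \<le> mean n (\<lambda>st. weight a b st + K)" for n
    using \<Psi>(1) by (intro mean_mono; smt (verit))+
  then have "\<bar>mean n (weight a b) - real n * speed a b\<bar> \<le> K + \<bar>\<Psi> []\<bar>" for n
    unfolding mean_add mean_const 1 by (smt (verit))
  then show ?thesis by blast
qed

section \<open>Pointwise bound for the law\<close>

lemma pmf_push_le:
  assumes "reduced st" "(f, x) \<in> gens"
  shows "pmf (map_pmf (push (f, x)) (law \<nu> n)) st \<le> pmf (law \<nu> n) (push (f, 4 - x) st)"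
proof -
  have x: "x = 1 \<or> x = 3" using assms(2) by (simp add: gens_iff)
  have inv: "push (f, 4 - x) (push (f, x) s) = s" if "reduced s" for s
    using push_push[OF that, of x "4 - x" f] x by auto
  \<comment> \<open>The inverse generator undoes the push on reduced stacks only; other stacks may
    lie in the preimage but carry no mass.\<close>
  have "measure (law \<nu> n) (push (f, x) -` {st}) \<le> measure (law \<nu> n) {push (f, 4 - x) st}"
    using inv supp_reduced by (intro measure_pmf.finite_measure_mono_AE) (auto simp: AE_measure_pmf_iff)
  then show ?thesis by (simp add: pmf_map measure_pmf_single)
qed

text \<open>Splitting off the last step expresses the mass at \<open>st\<close> through the masses
  at the stacks reached by inverse generators. By symmetry of the measure this average is
  \<open>step\<close>, which preserves \<open>hit\<close> off the empty stack; at the empty stack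
  the bound 1 is trivial.\<close>

lemma pmf_law_le_hit: "reduced st \<Longrightarrow> pmf (law \<nu> n) st \<le> hit st"
proof (induction n arbitrary: st)
  case 0
  then show ?case using hit_pos[of st] by (cases "st = []") (auto simp: less_imp_le)
next
  case (Suc n)
  show ?case
  proof (cases "st = []")
    case True
    then show ?thesis by (simp only: hit_simps pmf_le_1)
  next
    case False
    have le: "pmf (map_pmf (push (f, x)) (law \<nu> n)) st \<le> hit (push (f, 4 - x) st)"
      if "(f, x) \<in> gens" for f x
    proof -
      have "(f, 4 - x) \<in> gens" using that by (auto simp: gens_iff)
      then show ?thesis
        using pmf_push_le[OF Suc.prems that] Suc.IH[OF reduced_push_gen[OF Suc.prems]] by (meson order_trans)
    qed
    have "law \<nu> (Suc n) = bind_pmf \<nu> (\<lambda>l. map_pmf (push l) (law \<nu> n))"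
      unfolding law.simps map_pmf_def by (rule bind_commute_pmf)
    then have "pmf (law \<nu> (Suc n)) st = (\<Sum>l\<in>gens. pmf \<nu> l * pmf (map_pmf (push l) (law \<nu> n)) st)"
      by (simp only: pmf_bind expectation_gens)
    also have "\<dots> = (\<Sum>f\<in>UNIV. P f / 2 * (pmf (map_pmf (push (f, 1)) (law \<nu> n)) st + pmf (map_pmf (push (f, 3)) (law \<nu> n)) st))"
      by (rule sum_gens)
    also have "\<dots> \<le> (\<Sum>f\<in>UNIV. P f / 2 * (hit (push (f, 3) st) + hit (push (f, 1) st)))"
      using le[of _ 1] le[of _ 3] P_pos
      by (intro sum_mono mult_left_mono add_mono) (simp_all add: gens_iff less_imp_le)
    also have "\<dots> = step hit st" unfolding step_def by (simp add: add.commute)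
    finally show ?thesis unfolding step_hit[OF Suc.prems False] .
  qed
qed

section \<open>Total hitting mass by number of syllables\<close>

definition blocks :: "bool \<Rightarrow> nat \<Rightarrow> stack set" where
  "blocks f k = {st. reduced st \<and> length st = k \<and> avoids f st}"

lemma blocks_0: "blocks f 0 = {[]}"
  by (auto simp: blocks_def)

lemma blocks_Suc: "blocks f (Suc k) = (\<lambda>(x, st). (\<not> f, x) # st) ` ({1, 2, 3} \<times> blocks (\<not> f) k)"
proof (intro subset_antisym subsetI)
  fix st assume st: "st \<in> blocks f (Suc k)"
  then obtain g x s where e: "st = (g, x) # s" by (cases st) (auto simp: blocks_def)
  have "g = (\<not> f)" "x \<in> {1, 2, 3}" "s \<in> blocks (\<not> f) k"
    using st unfolding blocks_def e by auto
  then show "st \<in> (\<lambda>(x, st). (\<not> f, x) # st) ` ({1, 2, 3} \<times> blocks (\<not> f) k)" unfolding e by force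
qed (auto simp: blocks_def)

lemma finite_blocks: "finite (blocks f k)"
  by (induction k arbitrary: f) (simp_all add: blocks_0 blocks_Suc)

lemma sum_hit_blocks_Suc: "(\<Sum>st\<in>blocks f (Suc k). hit st) = c (\<not> f) * (\<Sum>st\<in>blocks (\<not> f) k. hit st)"
proof -
  have "(\<Sum>st\<in>blocks f (Suc k). hit st) = (\<Sum>(x, st)\<in>{1, 2, 3} \<times> blocks (\<not> f) k. hit1 (\<not> f, x) * hit st)"
    unfolding blocks_Suc by (subst sum.reindex) (auto simp: inj_on_def case_prod_unfold)
  also have "\<dots> = (\<Sum>x\<in>{1, 2, 3}. hit1 (\<not> f, x)) * (\<Sum>st\<in>blocks (\<not> f) k. hit st)"
    unfolding sum_product sum.cartesian_product ..
  also have "(\<Sum>x\<in>{1, 2, 3}. hit1 (\<not> f, x)) = c (\<not> f)"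
    unfolding c_def by (simp add: hit1_values algebra_simps)
  finally show ?thesis .
qed

text \<open>Two further syllables multiply the sum by c True * c False = 1, so only its values at k
  = 0 and k = 1 matter.\<close>

lemma sum_hit_blocks_le: "(\<Sum>st\<in>blocks f k. hit st) \<le> 1 + c True + c False"
proof (induction k arbitrary: f rule: induct_nat_012)
  case 0
  show ?case using c_pos[of True] c_pos[of False] by (simp add: blocks_0)
next
  case 1
  show ?case using c_pos[of True] c_pos[of False] by (cases f) (simp_all add: sum_hit_blocks_Suc blocks_0)
next
  case (ge2 k)
  have "(\<Sum>st\<in>blocks f (Suc (Suc k)). hit st) = c f * c (\<not> f) * (\<Sum>st\<in>blocks f k. hit st)"
    by (simp add: sum_hit_blocks_Suc)
  then show ?case using ge2 by (simp add: c_mult)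
qed

lemma sum_hit_supp_le:
  "(\<Sum>st\<in>set_pmf (law \<nu> n). hit st) \<le> 2 * (1 + c True + c False) * real (Suc n)"
proof -
  let ?B = "\<lambda>k. blocks True k \<union> blocks False k"
  have "st \<in> (\<Union>k\<in>{..n}. ?B k)" if st: "st \<in> set_pmf (law \<nu> n)" for st
  proof -
    have "avoids True st \<or> avoids False st" unfolding avoids_def by auto
    then have "st \<in> ?B (length st)" using supp_reduced[OF st] by (auto simp: blocks_def)
    then show ?thesis using law_length[OF st] by blast
  qed
  then have "(\<Sum>st\<in>set_pmf (law \<nu> n). hit st) \<le> (\<Sum>st\<in>(\<Union>k\<in>{..n}. ?B k). hit st)"
    using hit_pos by (intro sum_mono2) (auto simp: finite_blocks less_imp_le)
  also have "\<dots> = (\<Sum>k\<le>n. \<Sum>st\<in>?B k. hit st)"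
  proof (intro sum.UNION_disjoint ballI impI)
    show "?B i \<inter> ?B j = {}" if "i \<noteq> j" for i j using that unfolding blocks_def by blast
  qed (simp_all add: finite_blocks)
  also have "\<dots> \<le> (\<Sum>k\<le>n. 2 * (1 + c True + c False))"
  proof (intro sum_mono)
    fix k
    have "(\<Sum>st\<in>?B k. hit st) \<le> (\<Sum>st\<in>blocks True k. hit st) + (\<Sum>st\<in>blocks False k. hit st)"
      using hit_pos sum_nonneg[of "blocks True k \<inter> blocks False k" hit]
      by (subst sum_Un) (simp_all add: finite_blocks less_imp_le)
    then show "(\<Sum>st\<in>?B k. hit st) \<le> 2 * (1 + c True + c False)"
      using sum_hit_blocks_le[of True k] sum_hit_blocks_le[of False k] by simp
  qed
  also have "\<dots> = 2 * (1 + c True + c False) * real (Suc n)" by simp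
  finally show ?thesis .
qed

section \<open>Entropy between two bounds\<close>

lemma entropy_lower: "mean n (\<lambda>st. - ln (hit st)) \<le> shannon_entropy (law \<nu> n)"
proof -
  have "pmf (law \<nu> n) st * - ln (hit st) \<le> - (pmf (law \<nu> n) st * ln (pmf (law \<nu> n) st))"
    if st: "st \<in> set_pmf (law \<nu> n)" for st
  proof -
    have p: "0 < pmf (law \<nu> n) st" using st by (simp add: pmf_positive)
    then have "ln (pmf (law \<nu> n) st) \<le> ln (hit st)"
      using pmf_law_le_hit[OF supp_reduced[OF st]] by (intro ln_mono)
    then show ?thesis using p by simp
  qed
  then show ?thesis
    unfolding mean_def shannon_entropy_finite[OF finite_supp] sum_negf[symmetric] by (rule sum_mono)
qed

text \<open>Gibbs' inequality against \<open>hit\<close> / M, whose total mass on the support of the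
  law is at most 1.\<close>

lemma entropy_upper:
  "shannon_entropy (law \<nu> n) \<le> mean n (\<lambda>st. - ln (hit st)) + ln (2 * (1 + c True + c False) * real (Suc n))"
proof -
  define M where "M = 2 * (1 + c True + c False) * real (Suc n)"
  have M: "M > 0" unfolding M_def using c_pos[of True] c_pos[of False] by simp
  have "- (pmf (law \<nu> n) st * ln (pmf (law \<nu> n) st)) \<le>
      pmf (law \<nu> n) st * (- ln (hit st) + (ln M - 1)) + hit st / M"
    if st: "st \<in> set_pmf (law \<nu> n)" for st
  proof -
    define p where "p = pmf (law \<nu> n) st"
    have p: "0 < p" using st by (simp add: pmf_positive p_def)
    have "ln (hit st / (M * p)) \<le> hit st / (M * p) - 1"
      using hit_pos[of st] M p by (intro ln_le_minus_one) simp
    moreover have "ln (hit st / (M * p)) = ln (hit st) - ln M - ln p"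
      using hit_pos[of st] M p by (simp add: ln_div ln_mult)
    ultimately have "p * (ln (hit st) - ln M - ln p) \<le> p * (hit st / (M * p) - 1)"
      using p by (intro mult_left_mono) auto
    also have "\<dots> = hit st / M - p" using p M by (simp add: field_simps)
    finally show ?thesis unfolding p_def[symmetric] by (simp add: algebra_simps)
  qed
  then have "shannon_entropy (law \<nu> n) \<le> (\<Sum>st\<in>set_pmf (law \<nu> n).
      pmf (law \<nu> n) st * (- ln (hit st) + (ln M - 1)) + hit st / M)"
    unfolding shannon_entropy_finite[OF finite_supp] sum_negf[symmetric] by (rule sum_mono)
  also have "\<dots> = mean n (\<lambda>st. - ln (hit st)) + (ln M - 1) + (\<Sum>st\<in>set_pmf (law \<nu> n). hit st) / M"
    unfolding sum.distrib mean_def[symmetric] mean_add mean_const sum_divide_distrib ..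
  also have "(\<Sum>st\<in>set_pmf (law \<nu> n). hit st) / M \<le> 1"
    using sum_hit_supp_le[of n, folded M_def] M by (simp add: divide_le_eq)
  finally show ?thesis by (simp add: M_def)
qed

lemma entropy_limit: "(\<lambda>n. shannon_entropy (law \<nu> n) / real n) \<longlonglongrightarrow> entropy_rate"
proof -
  obtain K where K: "\<And>n. \<bar>mean n (\<lambda>st. - ln (hit st)) - real n * entropy_rate\<bar> \<le> K"
    using mean_weight_bound[of "\<lambda>f. - ln (\<alpha> f)" "\<lambda>f. - ln (\<alpha> f * w f)"]
    unfolding neg_ln_hit[abs_def] entropy_rate_def by blast
  define M where "M = 2 * (1 + c True + c False)"
  have M: "M > 0" unfolding M_def using c_pos[of True] c_pos[of False] by simp
  have b: "- K \<le> shannon_entropy (law \<nu> n) - real n * entropy_rate"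
    "shannon_entropy (law \<nu> n) - real n * entropy_rate \<le> K + ln (M * real (Suc n))" for n
    using K[of n] entropy_lower[of n] entropy_upper[of n] unfolding M_def by linarith+
  have s: "(\<lambda>n. (shannon_entropy (law \<nu> n) - real n * entropy_rate) / real n) \<longlonglongrightarrow> 0"
  proof (rule tendsto_sandwich)
    show "(\<lambda>n. - K / real n) \<longlonglongrightarrow> 0" by (rule lim_const_over_n)
    show "(\<lambda>n. (K + ln (M * real (Suc n))) / real n) \<longlonglongrightarrow> 0"
      using M by real_asymp
    show "\<forall>\<^sub>F n in sequentially. - K / real n \<le> (shannon_entropy (law \<nu> n) - real n * entropy_rate) / real n"
      using b(1) by (intro always_eventually allI divide_right_mono) auto
    show "\<forall>\<^sub>F n in sequentially. (shannon_entropy (law \<nu> n) - real n * entropy_rate) / real n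
        \<le> (K + ln (M * real (Suc n))) / real n"
      using b(2) by (intro always_eventually allI divide_right_mono) auto
  qed
  have "(\<lambda>n. (shannon_entropy (law \<nu> n) - real n * entropy_rate) / real n + entropy_rate) \<longlonglongrightarrow> 0 + entropy_rate"
    by (rule tendsto_add[OF s tendsto_const])
  then have "(\<lambda>n. (shannon_entropy (law \<nu> n) - real n * entropy_rate) / real n + entropy_rate) \<longlonglongrightarrow> entropy_rate"
    by simp
  then show ?thesis
    by (rule Lim_transform_eventually) (auto intro!: eventually_sequentiallyI[of 1] simp: field_simps)
qed

lemma walk_entropy_eq: "walk_entropy G4 (map_pmf (\<lambda>l. cls [l]) \<nu>) = entropy_rate"
proof -
  have "inj_on cls (set_pmf (law \<nu> n))" for n
    using supp_reduced cls_inject by (intro inj_onI) blast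
  then have "shannon_entropy (conv_power G4 (map_pmf (\<lambda>l. cls [l]) \<nu>) n) = shannon_entropy (law \<nu> n)" for n
    unfolding conv_power_law[OF \<nu>_gens] by (intro shannon_entropy_map finite_supp)
  then show ?thesis unfolding walk_entropy_def using entropy_limit by (simp add: limI)
qed

end

section \<open>Drift\<close>

lemma reduced_gen: "l \<in> gens \<Longrightarrow> reduced [l]"
  by (cases l) (auto simp: gens_iff)

lemma inj_on_cls_gens: "inj_on (\<lambda>l. cls [l]) gens"
proof (rule inj_onI)
  fix l m assume "l \<in> gens" "m \<in> gens" and eq: "cls [l] = cls [m]"
  then show "l = m" using cls_inject[OF reduced_gen reduced_gen] by blast
qed

text \<open>
  The type of group elements is uncountable, so \<^const>\<open>walk\<close> need not be measurable for the product
  \<open>\<sigma>\<close>-algebra; the increments are therefore decoded into the countable type of letters.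
\<close>

fun stack_walk :: "('g \<Rightarrow> bool \<times> int) \<Rightarrow> (nat \<Rightarrow> 'g) \<Rightarrow> nat \<Rightarrow> stack" where
  "stack_walk d x 0 = []"
| "stack_walk d x (Suc n) = push (d (x n)) (stack_walk d x n)"

lemma measurable_stack_walk:
  "(\<lambda>x. stack_walk d x n) \<in> measurable (\<Pi>\<^sub>M i\<in>(UNIV :: nat set). measure_pmf \<mu>) (count_space UNIV)"
proof (induction n)
  case (Suc n)
  have "(\<lambda>x. d (x n)) \<in> measurable (\<Pi>\<^sub>M i\<in>(UNIV :: nat set). measure_pmf \<mu>) (count_space UNIV)"
    by (rule measurable_compose[OF measurable_component_singleton]) simp_all
  then have "(\<lambda>x. push l (stack_walk d x n)) \<in> measurable (\<Pi>\<^sub>M i\<in>(UNIV :: nat set). measure_pmf \<mu>) (count_space UNIV)" for l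
    using Suc by (intro measurable_compose[OF Suc]) simp
  then show ?case
    unfolding stack_walk.simps
    by (rule measurable_compose_countable) fact
qed simp

lemma stack_walk_cong: "(\<And>i. i < n \<Longrightarrow> x i = y i) \<Longrightarrow> stack_walk d x n = stack_walk d y n"
  by (induction n) simp_all

text \<open>Gluing the first n entries of one sequence to an independent second sequence preserves
  the product measure, so entry n becomes independent of the first n steps. The induction runs over
  all \<phi> because its hypothesis is applied to the average of \<phi> over one step.\<close>

lemma nn_integral_stack_walk:
  fixes \<phi> :: "stack \<Rightarrow> ennreal"
  shows "(\<integral>\<^sup>+x. \<phi> (stack_walk d x n) \<partial>increments \<mu>) = (\<integral>\<^sup>+st. \<phi> st \<partial>law (map_pmf d \<mu>) n)"
proof -
  interpret product_prob_space "\<lambda>_. measure_pmf \<mu>" "UNIV :: nat set"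
    by (intro product_prob_spaceI prob_space_measure_pmf)
  interpret sequence_space "measure_pmf \<mu>" ..
  let ?S = "\<Pi>\<^sub>M i\<in>(UNIV :: nat set). measure_pmf \<mu>"
  have S: "prob_space ?S" by (rule prob_space_PiM) (rule prob_space_measure_pmf)
  have m: "(\<lambda>x. \<phi> (stack_walk d x n)) \<in> borel_measurable ?S" for \<phi> :: "stack \<Rightarrow> ennreal" and n
    by (rule measurable_compose[OF measurable_stack_walk]) simp
  show ?thesis unfolding increments_def
  proof (induction n arbitrary: \<phi>)
    case 0
    show ?case by (simp add: prob_space.emeasure_space_1[OF S])
  next
    case (Suc n)
    have "(\<integral>\<^sup>+x. \<phi> (stack_walk d x (Suc n)) \<partial>?S)
        = (\<integral>\<^sup>+x. \<phi> (stack_walk d x (Suc n)) \<partial>distr (?S \<Otimes>\<^sub>M ?S) ?S (\<lambda>(\<omega>, \<omega>'). comb_seq n \<omega> \<omega>'))"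
      unfolding PiM_comb_seq ..
    also have "\<dots> = (\<integral>\<^sup>+z. \<phi> (stack_walk d (case z of (\<omega>, \<omega>') \<Rightarrow> comb_seq n \<omega> \<omega>') (Suc n)) \<partial>(?S \<Otimes>\<^sub>M ?S))"
      by (rule nn_integral_distr[OF measurable_comb_seq]) (simp only: measurable_distr_eq1 m)
    also have "\<dots> = (\<integral>\<^sup>+\<omega>. \<integral>\<^sup>+\<omega>'. \<phi> (stack_walk d (comb_seq n \<omega> \<omega>') (Suc n)) \<partial>?S \<partial>?S)"
      by (subst sigma_finite_measure.nn_integral_fst[OF prob_space_imp_sigma_finite[OF S], symmetric])
        (simp_all only: measurable_compose[OF measurable_comb_seq m] split_conv)
    also have "\<dots> = (\<integral>\<^sup>+\<omega>. \<integral>\<^sup>+\<omega>'. \<phi> (push (d (\<omega>' 0)) (stack_walk d \<omega> n)) \<partial>?S \<partial>?S)"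
    proof -
      have "stack_walk d (comb_seq n \<omega> \<omega>') (Suc n) = push (d (\<omega>' 0)) (stack_walk d \<omega> n)" for \<omega> \<omega>' :: "nat \<Rightarrow> 'a"
      proof -
        have "stack_walk d (comb_seq n \<omega> \<omega>') n = stack_walk d \<omega> n"
          by (rule stack_walk_cong) (rule comb_seq_less)
        moreover have "comb_seq n \<omega> \<omega>' n = \<omega>' 0" using comb_seq_add[of n \<omega> \<omega>' 0] by simp
        ultimately show ?thesis by simp
      qed
      then show ?thesis by simp
    qed
    also have "\<dots> = (\<integral>\<^sup>+\<omega>. \<integral>\<^sup>+g. \<phi> (push (d g) (stack_walk d \<omega> n)) \<partial>\<mu> \<partial>?S)"
    proof -
      have comp: "(\<integral>\<^sup>+\<omega>'. \<psi> (\<omega>' 0) \<partial>?S) = (\<integral>\<^sup>+g. \<psi> g \<partial>\<mu>)" for \<psi> :: "'a \<Rightarrow> ennreal"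
      proof -
        have "(\<integral>\<^sup>+g. \<psi> g \<partial>\<mu>) = (\<integral>\<^sup>+g. \<psi> g \<partial>distr ?S \<mu> (\<lambda>\<omega>. \<omega> 0))"
          by (subst PiM_component) simp_all
        also have "\<dots> = (\<integral>\<^sup>+\<omega>'. \<psi> (\<omega>' 0) \<partial>?S)" by (rule nn_integral_distr) simp_all
        finally show ?thesis ..
      qed
      show ?thesis
      proof (rule nn_integral_cong)
        fix \<omega>
        show "(\<integral>\<^sup>+\<omega>'. \<phi> (push (d (\<omega>' 0)) (stack_walk d \<omega> n)) \<partial>?S) = (\<integral>\<^sup>+g. \<phi> (push (d g) (stack_walk d \<omega> n)) \<partial>\<mu>)"
          by (rule comp[of "\<lambda>g. \<phi> (push (d g) (stack_walk d \<omega> n))"])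
      qed
    qed
    also have "\<dots> = (\<integral>\<^sup>+st. \<integral>\<^sup>+g. \<phi> (push (d g) st) \<partial>\<mu> \<partial>law (map_pmf d \<mu>) n)"
      by (rule Suc.IH)
    also have "\<dots> = (\<integral>\<^sup>+st. \<phi> st \<partial>law (map_pmf d \<mu>) (Suc n))" by simp
    finally show ?case .
  qed
qed

lemma emeasure_stack_walk:
  "emeasure (increments \<mu>) {x \<in> space (increments \<mu>). stack_walk d x n \<in> A} = emeasure (law (map_pmf d \<mu>) n) A"
proof -
  have s: "{x \<in> space (increments \<mu>). stack_walk d x n \<in> A} \<in> sets (increments \<mu>)"
    using measurable_sets[OF measurable_stack_walk[of d n \<mu>], of A]
    by (simp add: vimage_def Int_def conj_commute increments_def)
  have "emeasure (increments \<mu>) {x \<in> space (increments \<mu>). stack_walk d x n \<in> A}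
      = (\<integral>\<^sup>+x. indicator {x \<in> space (increments \<mu>). stack_walk d x n \<in> A} x \<partial>increments \<mu>)"
    using s by (rule nn_integral_indicator[symmetric])
  also have "\<dots> = (\<integral>\<^sup>+x. indicator A (stack_walk d x n) \<partial>increments \<mu>)"
    by (intro nn_integral_cong) (simp split: split_indicator)
  also have "\<dots> = emeasure (law (map_pmf d \<mu>) n) A"
    unfolding nn_integral_stack_walk by simp
  finally show ?thesis .
qed

section \<open>Exponential moments and almost sure limits\<close>

context cone_walk
begin

text \<open>An estimate of Azuma type: in the quadratic bound for the exponential the linear term
  has mean zero by the martingale property, so each step costs at most the factor 1 + (\<theta> *
  D)^2.\<close>

lemma exponential_moment:
  assumes \<Psi>: "\<And>st. reduced st \<Longrightarrow> step \<Psi> st = \<Psi> st + \<gamma>"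
    and D: "\<And>st l. reduced st \<Longrightarrow> l \<in> gens \<Longrightarrow> \<bar>\<Psi> (push l st) - \<Psi> st - \<gamma>\<bar> \<le> D"
    and \<theta>: "\<bar>\<theta>\<bar> * D \<le> 1"
  shows "mean n (\<lambda>st. exp (\<theta> * (\<Psi> st - \<Psi> [] - real n * \<gamma>))) \<le> (1 + (\<theta> * D)\<^sup>2) ^ n"
proof (induction n)
  case 0
  show ?case by (simp add: mean_0)
next
  case (Suc n)
  define g where "g st = exp (\<theta> * (\<Psi> st - \<Psi> [] - real n * \<gamma>))" for st
  have "step (\<lambda>st. exp (\<theta> * (\<Psi> st - \<Psi> [] - real (Suc n) * \<gamma>))) st \<le> (1 + (\<theta> * D)\<^sup>2) * g st"
    if st: "reduced st" for st
  proof -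
    have "step (\<lambda>s. exp (\<theta> * (\<Psi> s - \<Psi> [] - real (Suc n) * \<gamma>))) st
        \<le> step (\<lambda>s. g st * (1 - \<theta> * (\<Psi> st + \<gamma>) + (\<theta> * D)\<^sup>2) + g st * \<theta> * \<Psi> s) st"
    proof (rule step_mono)
      fix l assume l: "l \<in> gens"
      define u where "u = \<Psi> (push l st) - \<Psi> st - \<gamma>"
      have u: "\<bar>u\<bar> \<le> D" unfolding u_def using D[OF st l] .
      have a: "\<bar>\<theta> * u\<bar> \<le> \<bar>\<theta>\<bar> * D" unfolding abs_mult using u by (intro mult_left_mono) auto
      have "exp (\<theta> * (\<Psi> (push l st) - \<Psi> [] - real (Suc n) * \<gamma>)) = g st * exp (\<theta> * u)"
        unfolding g_def u_def exp_add[symmetric] by (simp add: algebra_simps)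
      also have "exp (\<theta> * u) \<le> 1 + \<theta> * u + (\<theta> * u)\<^sup>2"
        using a \<theta> by (intro exp_le_quadratic) linarith
      also have "(\<theta> * u)\<^sup>2 \<le> (\<theta> * D)\<^sup>2"
        using u by (simp add: power_mult_distrib mult_left_mono abs_le_square_iff[symmetric])
      finally have "exp (\<theta> * (\<Psi> (push l st) - \<Psi> [] - real (Suc n) * \<gamma>)) \<le> g st * (1 + \<theta> * u + (\<theta> * D)\<^sup>2)"
        by (simp add: g_def)
      also have "\<dots> = g st * (1 - \<theta> * (\<Psi> st + \<gamma>) + (\<theta> * D)\<^sup>2) + g st * \<theta> * \<Psi> (push l st)"
        unfolding u_def by (simp add: algebra_simps)
      finally show "exp (\<theta> * (\<Psi> (push l st) - \<Psi> [] - real (Suc n) * \<gamma>))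
          \<le> g st * (1 - \<theta> * (\<Psi> st + \<gamma>) + (\<theta> * D)\<^sup>2) + g st * \<theta> * \<Psi> (push l st)" .
    qed
    also have "\<dots> = (1 + (\<theta> * D)\<^sup>2) * g st"
      unfolding step_add step_const step_cmult \<Psi>[OF st] by (simp add: algebra_simps)
    finally show ?thesis .
  qed
  then have "mean (Suc n) (\<lambda>st. exp (\<theta> * (\<Psi> st - \<Psi> [] - real (Suc n) * \<gamma>)))
      \<le> mean n (\<lambda>st. (1 + (\<theta> * D)\<^sup>2) * g st)"
    unfolding mean_Suc by (rule mean_mono)
  also have "\<dots> \<le> (1 + (\<theta> * D)\<^sup>2) * (1 + (\<theta> * D)\<^sup>2) ^ n"
    unfolding mean_cmult using Suc by (intro mult_left_mono) (simp_all add: g_def)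
  finally show ?case by simp
qed

lemma deviation_bound:
  assumes \<Psi>: "\<And>st. reduced st \<Longrightarrow> step \<Psi> st = \<Psi> st + \<gamma>"
    and D: "\<And>st l. reduced st \<Longrightarrow> l \<in> gens \<Longrightarrow> \<bar>\<Psi> (push l st) - \<Psi> st - \<gamma>\<bar> \<le> D"
    and \<theta>: "0 \<le> \<theta>" "\<theta> * D \<le> 1"
  shows "measure (law \<nu> n) {st. real n * e \<le> \<bar>\<Psi> st - \<Psi> [] - real n * \<gamma>\<bar>}
    \<le> 2 * (exp (- \<theta> * e) * (1 + (\<theta> * D)\<^sup>2)) ^ n"
proof -
  define A where "A = {st. real n * e \<le> \<bar>\<Psi> st - \<Psi> [] - real n * \<gamma>\<bar>}"
  define g where "g \<sigma> st = exp (\<sigma> * (\<Psi> st - \<Psi> [] - real n * \<gamma>))" for \<sigma> st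
  have "measure (law \<nu> n) A = measure (law \<nu> n) (A \<inter> set_pmf (law \<nu> n))"
    by (rule measure_Int_set_pmf[symmetric])
  also have "\<dots> = (\<Sum>st\<in>A \<inter> set_pmf (law \<nu> n). pmf (law \<nu> n) st)"
    using finite_supp by (intro measure_measure_pmf_finite) auto
  also have "\<dots> = mean n (indicator A)"
    unfolding mean_def using finite_supp by (intro sum.mono_neutral_cong_left) (auto split: split_indicator)
  also have "\<dots> \<le> mean n (\<lambda>st. exp (- \<theta> * e) ^ n * (g \<theta> st + g (- \<theta>) st))"
  proof (rule mean_mono)
    fix st
    define y where "y = \<Psi> st - \<Psi> [] - real n * \<gamma>"
    show "indicator A st \<le> exp (- \<theta> * e) ^ n * (g \<theta> st + g (- \<theta>) st)"
    proof (cases "st \<in> A")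
      case True
      then have "\<theta> * (real n * e) \<le> \<theta> * \<bar>y\<bar>" using \<theta>(1) unfolding A_def y_def by (intro mult_left_mono) auto
      then have "1 \<le> exp (- \<theta> * e * real n + \<theta> * \<bar>y\<bar>)" by (simp add: mult_ac)
      also have "\<dots> = exp (- \<theta> * e) ^ n * exp (\<theta> * \<bar>y\<bar>)"
        unfolding exp_add by (simp add: exp_of_nat_mult[symmetric] mult_ac)
      also have "exp (\<theta> * \<bar>y\<bar>) \<le> exp (\<theta> * y) + exp (- \<theta> * y)"
        by (cases "0 \<le> y") (simp_all add: less_imp_le)
      finally have "1 \<le> exp (- \<theta> * e) ^ n * (exp (\<theta> * y) + exp (- \<theta> * y))"
        by (simp add: mult_left_mono)
      then show ?thesis using True unfolding g_def y_def by simp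
    next
      case False
      then show ?thesis by (simp add: g_def add_nonneg_nonneg)
    qed
  qed
  also have "\<dots> = exp (- \<theta> * e) ^ n * (mean n (g \<theta>) + mean n (g (- \<theta>)))"
    unfolding mean_cmult mean_add by simp
  also have "\<dots> \<le> exp (- \<theta> * e) ^ n * ((1 + (\<theta> * D)\<^sup>2) ^ n + (1 + (- \<theta> * D)\<^sup>2) ^ n)"
    unfolding g_def[abs_def] using \<theta>
    by (intro mult_left_mono add_mono exponential_moment[OF \<Psi> D]) simp_all
  also have "\<dots> = 2 * (exp (- \<theta> * e) * (1 + (\<theta> * D)\<^sup>2)) ^ n"
    by (simp add: power_mult_distrib)
  finally show ?thesis unfolding A_def .
qed

lemma summable_deviation:
  assumes \<Psi>: "\<And>st. reduced st \<Longrightarrow> step \<Psi> st = \<Psi> st + \<gamma>"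
    and D: "\<And>st l. reduced st \<Longrightarrow> l \<in> gens \<Longrightarrow> \<bar>\<Psi> (push l st) - \<Psi> st - \<gamma>\<bar> \<le> D"
    and e: "0 < e"
  shows "summable (\<lambda>n. measure (law \<nu> n) {st. real n * e \<le> \<bar>\<Psi> st - \<Psi> [] - real n * \<gamma>\<bar>})"
proof -
  define E where "E = 1 + \<bar>D\<bar>"
  have E: "E \<ge> 1" "D \<le> E" by (simp_all add: E_def)
  have D': "\<bar>\<Psi> (push l st) - \<Psi> st - \<gamma>\<bar> \<le> E" if "reduced st" "l \<in> gens" for st l
    using D[OF that] E by simp
  \<comment> \<open>The first entry meets the requirement of the moment bound; the second makes
    (\<theta> * E)^2 at most half of \<theta> * e, so the deviation probabilities decay
    geometrically.\<close>
  define \<theta> where "\<theta> = min (1 / E) (e / (2 * E\<^sup>2))"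
  have \<theta>: "0 < \<theta>" "\<theta> \<le> 1 / E" "\<theta> \<le> e / (2 * E\<^sup>2)"
    using E e by (auto simp: \<theta>_def)
  have \<theta>E: "\<theta> * E \<le> 1" using \<theta>(2) E by (simp add: le_divide_eq)
  have "\<theta> * (2 * E\<^sup>2) \<le> e" using \<theta>(3) E by (simp add: le_divide_eq)
  then have "\<theta> * (\<theta> * (2 * E\<^sup>2)) \<le> \<theta> * e" using \<theta>(1) by (intro mult_left_mono) auto
  moreover have "0 < \<theta> * e" using \<theta> e by simp
  ultimately have "(\<theta> * E)\<^sup>2 < \<theta> * e" by (simp add: power2_eq_square mult_ac)
  then have "1 + (\<theta> * E)\<^sup>2 < exp (\<theta> * e)" using exp_ge_add_one_self[of "\<theta> * e"] by linarith
  then have "exp (- \<theta> * e) * (1 + (\<theta> * E)\<^sup>2) < exp (- \<theta> * e) * exp (\<theta> * e)"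
    by (intro mult_strict_left_mono) auto
  then have q: "exp (- \<theta> * e) * (1 + (\<theta> * E)\<^sup>2) < 1" by (simp add: exp_minus)
  show ?thesis
  proof (rule summable_comparison_test')
    show "summable (\<lambda>n. 2 * (exp (- \<theta> * e) * (1 + (\<theta> * E)\<^sup>2)) ^ n)"
      using q by (intro summable_mult summable_geometric) (simp add: add_nonneg_nonneg)
    show "norm (measure (law \<nu> n) {st. real n * e \<le> \<bar>\<Psi> st - \<Psi> [] - real n * \<gamma>\<bar>})
        \<le> 2 * (exp (- \<theta> * e) * (1 + (\<theta> * E)\<^sup>2)) ^ n" for n
      using deviation_bound[OF \<Psi> D', of \<theta> n e] \<theta>(1) \<theta>E by simp
  qed
qed

lemma AE_weight_limit:
  assumes \<mu>: "map_pmf d \<mu> = \<nu>"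
  shows "AE x in increments \<mu>. (\<lambda>n. weight a b (stack_walk d x n) / real n) \<longlonglongrightarrow> speed a b"
proof -
  define \<gamma> where "\<gamma> = speed a b"
  obtain \<Psi> K D where \<Psi>: "\<And>st. \<bar>\<Psi> st - weight a b st\<bar> \<le> K"
    "\<And>st. reduced st \<Longrightarrow> step \<Psi> st = \<Psi> st + \<gamma>"
    "\<And>st l. reduced st \<Longrightarrow> l \<in> gens \<Longrightarrow> \<bar>\<Psi> (push l st) - \<Psi> st\<bar> \<le> D"
    unfolding \<gamma>_def using ex_martingale[of a b] by metis
  have D: "\<bar>\<Psi> (push l st) - \<Psi> st - \<gamma>\<bar> \<le> D + \<bar>\<gamma>\<bar>" if "reduced st" "l \<in> gens" for st l
    using \<Psi>(3)[OF that] by linarith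
  interpret M: prob_space "increments \<mu>"
    unfolding increments_def by (rule prob_space_PiM) (rule prob_space_measure_pmf)
  have "AE x in increments \<mu>. \<forall>\<^sub>F n in sequentially.
      \<bar>\<Psi> (stack_walk d x n) - \<Psi> [] - real n * \<gamma>\<bar> < real n * e" if e: "0 < e" for e
  proof -
    define A where "A n = {st. real n * e \<le> \<bar>\<Psi> st - \<Psi> [] - real n * \<gamma>\<bar>}" for n
    define B where "B n = {x \<in> space (increments \<mu>). stack_walk d x n \<in> A n}" for n
    have "B n \<in> sets (increments \<mu>)" for n
      using measurable_sets[OF measurable_stack_walk[of d n \<mu>], of "A n"] unfolding B_def
      by (simp add: vimage_def Int_def conj_commute increments_def)
    moreover have "measure (increments \<mu>) (B n) = measure (law \<nu> n) (A n)" for n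
      unfolding B_def measure_def emeasure_stack_walk \<mu> ..
    moreover have "summable (\<lambda>n. measure (law \<nu> n) (A n))"
      unfolding A_def by (rule summable_deviation[OF \<Psi>(2) D e])
    ultimately have "AE x in increments \<mu>. \<forall>\<^sub>F n in sequentially. x \<in> space (increments \<mu>) - B n"
      by (intro borel_cantelli_AE1) (simp_all add: M.emeasure_eq_measure)
    then show ?thesis
      by eventually_elim (auto elim!: eventually_mono simp: B_def A_def not_le)
  qed
  \<comment> \<open>The thresholds are restricted to 1 / (m + 1), since only countably many almost
    sure events can be intersected.\<close>
  then have "AE x in increments \<mu>. \<forall>m. \<forall>\<^sub>F n in sequentially.
      \<bar>\<Psi> (stack_walk d x n) - \<Psi> [] - real n * \<gamma>\<bar> < real n * inverse (real (Suc m))"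
    unfolding AE_all_countable by simp
  then show ?thesis
  proof eventually_elim
    fix x assume x: "\<forall>m. \<forall>\<^sub>F n in sequentially.
      \<bar>\<Psi> (stack_walk d x n) - \<Psi> [] - real n * \<gamma>\<bar> < real n * inverse (real (Suc m))"
    define y where "y n = \<Psi> (stack_walk d x n)" for n
    have 1: "(\<lambda>n. (y n - \<Psi> [] - real n * \<gamma>) / real n) \<longlonglongrightarrow> 0"
    proof (rule LIMSEQ_I)
      fix r :: real assume "0 < r"
      then obtain m where m: "inverse (real (Suc m)) < r" using reals_Archimedean by blast
      obtain N where N: "\<And>n. n \<ge> N \<Longrightarrow> \<bar>y n - \<Psi> [] - real n * \<gamma>\<bar> < real n * inverse (real (Suc m))"
        using x unfolding y_def eventually_sequentially by blast
      have "norm ((y n - \<Psi> [] - real n * \<gamma>) / real n - 0) < r" if "n \<ge> max N 1" for n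
      proof -
        have n: "n > 0" "n \<ge> N" using that by auto
        have "\<bar>y n - \<Psi> [] - real n * \<gamma>\<bar> < real n * inverse (real (Suc m))" using N n by blast
        also have "\<dots> \<le> real n * r" using m by (intro mult_left_mono) auto
        finally show ?thesis using n by (simp add: divide_less_eq mult.commute)
      qed
      then show "\<exists>no. \<forall>n\<ge>no. norm ((y n - \<Psi> [] - real n * \<gamma>) / real n - 0) < r" by blast
    qed
    have 2: "(\<lambda>n. (weight a b (stack_walk d x n) - y n) / real n) \<longlonglongrightarrow> 0"
    proof (rule Lim_null_comparison)
      show "(\<lambda>n. K / real n) \<longlonglongrightarrow> 0" by (rule lim_const_over_n)
      have "\<bar>weight a b (stack_walk d x n) - y n\<bar> \<le> K" for n
        unfolding y_def using \<Psi>(1)[of "stack_walk d x n"] by linarith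
      then show "\<forall>\<^sub>F n in sequentially. norm ((weight a b (stack_walk d x n) - y n) / real n) \<le> K / real n"
        by (intro always_eventually allI) (simp add: divide_right_mono)
    qed
    have "(\<lambda>n. (y n - \<Psi> [] - real n * \<gamma>) / real n + (weight a b (stack_walk d x n) - y n) / real n
        + \<Psi> [] / real n + \<gamma>) \<longlonglongrightarrow> 0 + 0 + 0 + \<gamma>"
      by (intro tendsto_add 1 2 lim_const_over_n tendsto_const)
    then have "(\<lambda>n. (y n - \<Psi> [] - real n * \<gamma>) / real n + (weight a b (stack_walk d x n) - y n) / real n
        + \<Psi> [] / real n + \<gamma>) \<longlonglongrightarrow> \<gamma>" by simp
    moreover have "\<forall>\<^sub>F n in sequentially. (y n - \<Psi> [] - real n * \<gamma>) / real n
        + (weight a b (stack_walk d x n) - y n) / real n + \<Psi> [] / real n + \<gamma>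
        = weight a b (stack_walk d x n) / real n"
      by (intro eventually_sequentiallyI[of 1]) (simp add: add_divide_distrib diff_divide_distrib)
    ultimately show "(\<lambda>n. weight a b (stack_walk d x n) / real n) \<longlonglongrightarrow> speed a b"
      unfolding \<gamma>_def[symmetric] by (rule Lim_transform_eventually)
  qed
qed

text \<open>Almost every path uses only increments from the support, and along such a path decoding
  turns the walk in the group into the walk on stacks, where the limit is known.\<close>

lemma drift_eq: "drift G4 S4 (map_pmf (\<lambda>l. cls [l]) \<nu>) = drift_rate"
proof -
  define \<mu> where "\<mu> = map_pmf (\<lambda>l. cls [l]) \<nu>"
  define d where "d = inv_into gens (\<lambda>l. cls [l])"
  have inj: "inj_on (\<lambda>l. cls [l]) gens" by (rule inj_on_cls_gens)
  have d: "d (cls [l]) = l" if "l \<in> gens" for l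
    unfolding d_def by (rule inv_into_f_f[OF inj that])
  have \<nu>: "map_pmf d \<mu> = \<nu>"
    unfolding \<mu>_def map_pmf_comp using d \<nu>_gens by (intro map_pmf_idI) auto
  interpret M: prob_space "increments \<mu>"
    unfolding increments_def by (rule prob_space_PiM) (rule prob_space_measure_pmf)
  have "AE x in increments \<mu>. x i \<in> set_pmf \<mu>" for i
    unfolding increments_def by (rule AE_PiM_component) (auto simp: AE_measure_pmf prob_space_measure_pmf)
  then have supp: "AE x in increments \<mu>. \<forall>i. x i \<in> set_pmf \<mu>"
    by (simp add: AE_all_countable)
  have walk: "reduced (stack_walk d x n) \<and> walk G4 x n = cls (stack_walk d x n)"
    if x: "\<forall>i. x i \<in> set_pmf \<mu>" for x n
  proof (induction n)
    case 0
    show ?case by (simp add: one_G4)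
  next
    case (Suc n)
    have "x n \<in> set_pmf \<mu>" using x by blast
    then obtain l where l: "l \<in> set_pmf \<nu>" "x n = cls [l]" unfolding \<mu>_def by auto
    then have "l \<in> gens" using \<nu>_gens by blast
    then show ?case using Suc l d cls_mult_gen reduced_push_gen by simp
  qed
  have lim: "AE x in increments \<mu>. (\<lambda>n. real (word_length G4 S4 (walk G4 x n)) / real n) \<longlonglongrightarrow> drift_rate"
    using supp AE_weight_limit[OF \<nu>, of "\<lambda>_. 1" "\<lambda>_. 2"]
  proof eventually_elim
    case (elim x)
    have "real (word_length G4 S4 (walk G4 x n)) = weight (\<lambda>_. 1) (\<lambda>_. 2) (stack_walk d x n)" for n
      using walk[OF elim(1), of n] word_length_cls len_weight by metis
    then show ?case using elim(2) unfolding drift_rate_def by simp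
  qed
  show ?thesis unfolding drift_def \<mu>_def[symmetric]
  proof (rule the_equality)
    show "AE x in increments \<mu>. (\<lambda>n. real (word_length G4 S4 (walk G4 x n)) / real n) \<longlonglongrightarrow> drift_rate"
      by (rule lim)
    fix k assume "AE x in increments \<mu>. (\<lambda>n. real (word_length G4 S4 (walk G4 x n)) / real n) \<longlonglongrightarrow> k"
    \<comment> \<open>The two limits agree on almost every path. Their equality does not involve the
      path, and so it holds outright on a probability space.\<close>
    with lim have "AE x in increments \<mu>. k = drift_rate"
      by eventually_elim (rule LIMSEQ_unique)
    then show "k = drift_rate" by (simp add: M.AE_const)
  qed
qed

end

section \<open>The supremum\<close>

lemma cone_walk_bounds:
  assumes "cone_walk P w \<alpha> \<nu>"
  shows "walk_entropy G4 (map_pmf (\<lambda>l. cls [l]) \<nu>) /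
      (drift G4 S4 (map_pmf (\<lambda>l. cls [l]) \<nu>) * volume_growth G4 S4) \<le> kap / ln (1 + sqrt 2)"
    and "(\<And>f. w f = tau) \<Longrightarrow> walk_entropy G4 (map_pmf (\<lambda>l. cls [l]) \<nu>) /
      (drift G4 S4 (map_pmf (\<lambda>l. cls [l]) \<nu>) * volume_growth G4 S4) = kap / ln (1 + sqrt 2)"
proof -
  interpret cone_walk P w \<alpha> \<nu> by fact
  have v: "0 < ln (1 + sqrt 2)" by (rule ln_gt_zero) simp
  show "walk_entropy G4 (map_pmf (\<lambda>l. cls [l]) \<nu>) /
      (drift G4 S4 (map_pmf (\<lambda>l. cls [l]) \<nu>) * volume_growth G4 S4) \<le> kap / ln (1 + sqrt 2)"
    unfolding walk_entropy_eq drift_eq volume_growth_G4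
    using entropy_rate_le drift_rate_pos v by (simp add: divide_simps mult_ac)
  show "walk_entropy G4 (map_pmf (\<lambda>l. cls [l]) \<nu>) /
      (drift G4 S4 (map_pmf (\<lambda>l. cls [l]) \<nu>) * volume_growth G4 S4) = kap / ln (1 + sqrt 2)"
    if "\<And>f. w f = tau"
    unfolding walk_entropy_eq drift_eq volume_growth_G4 entropy_rate_golden[OF that]
    using drift_rate_pos by simp
qed

section \<open>Admissible measures as letter distributions\<close>

lemma pmf_map_cls:
  assumes "set_pmf \<nu> \<subseteq> gens" "l \<in> gens"
  shows "pmf (map_pmf (\<lambda>l. cls [l]) \<nu>) (cls [l]) = pmf \<nu> l"
proof -
  have "pmf (map_pmf (\<lambda>l. cls [l]) \<nu>) (cls [l]) = measure \<nu> ((\<lambda>l. cls [l]) -` {cls [l]})"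
    by (rule pmf_map)
  also have "\<dots> = measure \<nu> {l}"
  proof (rule measure_pmf.finite_measure_eq_AE)
    show "AE x in \<nu>. (x \<in> (\<lambda>l. cls [l]) -` {cls [l]}) = (x \<in> {l})"
      unfolding AE_measure_pmf_iff using assms inj_on_cls_gens unfolding inj_on_def by blast
  qed simp_all
  finally show ?thesis by (simp add: measure_pmf_single)
qed

lemma map_cls_inv_into:
  assumes "set_pmf \<mu> \<subseteq> S4"
  defines "\<nu> \<equiv> map_pmf (inv_into gens (\<lambda>l. cls [l])) \<mu>"
  shows "set_pmf \<nu> \<subseteq> gens" "map_pmf (\<lambda>l. cls [l]) \<nu> = \<mu>"
proof -
  have "inv_into gens (\<lambda>l. cls [l]) g \<in> gens" if "g \<in> set_pmf \<mu>" for g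
    using that assms(1) inv_into_into[of g "\<lambda>l. cls [l]" gens] by blast
  then show "set_pmf \<nu> \<subseteq> gens" unfolding \<nu>_def by auto
  have "cls [inv_into gens (\<lambda>l. cls [l]) g] = g" if "g \<in> set_pmf \<mu>" for g
    using that assms(1) f_inv_into_f[of g "\<lambda>l. cls [l]" gens] by blast
  then show "map_pmf (\<lambda>l. cls [l]) \<nu> = \<mu>"
    unfolding \<nu>_def map_pmf_comp by (rule map_pmf_idI)
qed

text \<open>A walk whose steps all lie in one factor stays there; admissibility therefore gives both
  factors positive step probability.\<close>

lemma law_avoids_factor:
  assumes "set_pmf \<nu> \<subseteq> {(\<not> f, 1), (\<not> f, 3)}" "st \<in> set_pmf (law \<nu> n)"
  shows "fst ` set st \<subseteq> {\<not> f}"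
  using assms(2)
proof (induction n arbitrary: st)
  case (Suc n)
  then obtain s l where s: "s \<in> set_pmf (law \<nu> n)" "l \<in> set_pmf \<nu>" "st = push l s" by auto
  have "fst ` set (push l s) \<subseteq> insert (fst l) (fst ` set s)"
    by (cases l; cases s) (auto split: if_splits)
  also have "\<dots> \<subseteq> {\<not> f}" using assms(1) s(2) Suc.IH[OF s(1)] by auto
  finally show ?case unfolding s(3) .
qed simp

lemma ex_cone_walk:
  assumes "\<mu> \<in> admissible G4 S4"
  obtains P w \<alpha> \<nu> where "cone_walk P w \<alpha> \<nu>" "\<mu> = map_pmf (\<lambda>l. cls [l]) \<nu>"
proof -
  have supp: "set_pmf \<mu> \<subseteq> S4"
    and sym: "\<And>s. s \<in> S4 \<Longrightarrow> pmf \<mu> s = pmf \<mu> (inv\<^bsub>G4\<^esub> s)"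
    and gen: "(\<Union>n\<in>{1..}. set_pmf (conv_power G4 \<mu> n)) = carrier G4"
    using assms unfolding admissible_def by blast+
  define \<nu> where "\<nu> = map_pmf (inv_into gens (\<lambda>l. cls [l])) \<mu>"
  have \<nu>: "set_pmf \<nu> \<subseteq> gens" "map_pmf (\<lambda>l. cls [l]) \<nu> = \<mu>"
    unfolding \<nu>_def by (rule map_cls_inv_into[OF supp])+
  have pmf_\<nu>: "pmf \<nu> l = pmf \<mu> (cls [l])" if "l \<in> gens" for l
    using pmf_map_cls[OF \<nu>(1) that] unfolding \<nu>(2) by simp
  have sym13: "pmf \<nu> (f, 3) = pmf \<nu> (f, 1)" for f
  proof -
    have g: "(f, 1) \<in> gens" "(f, 3) \<in> gens" by (simp_all add: gens_iff)
    have "inv\<^bsub>G4\<^esub> (cls [(f, 1)]) = cls [(f, 4 - 1)]" by (rule inv_cls_gen) simp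
    then have "pmf \<mu> (cls [(f, 1)]) = pmf \<mu> (cls [(f, 3)])"
      using sym[OF imageI[OF g(1)]] by simp
    then show ?thesis using g by (simp add: pmf_\<nu>)
  qed
  define P where "P f = 2 * pmf \<nu> (f, 1)" for f
  have "(\<Sum>l\<in>gens. pmf \<nu> l) = 1" by (rule sum_pmf_eq_1[OF finite_gens \<nu>(1)])
  then have sum: "P True + P False = 1"
    unfolding gens_def P_def by (simp add: sym13)
  have pos: "0 < P f" for f
  proof (rule ccontr)
    assume "\<not> 0 < P f"
    then have z: "pmf \<nu> (f, 1) = 0" using pmf_nonneg[of \<nu> "(f, 1)"] by (simp add: P_def)
    have "set_pmf \<nu> \<subseteq> {(\<not> f, 1), (\<not> f, 3)}"
    proof
      fix l assume l: "l \<in> set_pmf \<nu>"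
      obtain g x where e: "l = (g, x)" by (cases l)
      have "x = 1 \<or> x = 3" using l \<nu>(1) by (auto simp: e gens_iff)
      moreover have "g \<noteq> f"
      proof
        assume "g = f"
        then have "pmf \<nu> (g, x) = 0" using calculation z sym13[of f] by auto
        then show False using l unfolding e by (simp add: set_pmf_iff)
      qed
      ultimately show "l \<in> {(\<not> f, 1), (\<not> f, 3)}" unfolding e by auto
    qed
    note av = law_avoids_factor[OF this]
    have r: "reduced [(f, 1)]" by simp
    have "cls [(f, 1)] \<in> (\<Union>n\<in>{1..}. set_pmf (conv_power G4 \<mu> n))"
      unfolding gen by (rule cls_in_carrier[OF r])
    then obtain n where "cls [(f, 1)] \<in> set_pmf (map_pmf cls (law \<nu> n))"
      using conv_power_law[OF \<nu>(1)] unfolding \<nu>(2) by auto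
    then obtain st where st: "st \<in> set_pmf (law \<nu> n)" "cls [(f, 1)] = cls st" by auto
    then have "[(f, 1)] = st" using cls_inject[OF r law_reduced[OF \<nu>(1) st(1)]] by blast
    then show False using av[OF st(1)] by auto
  qed
  obtain w \<alpha> where cp: "cone_params P w \<alpha>" using ex_cone_params[OF pos sum] .
  have "cone_walk P w \<alpha> \<nu>"
  proof (intro cone_walk.intro cp cone_walk_axioms.intro \<nu>(1))
    fix f x assume "(f, x) \<in> gens"
    then have "x = 1 \<or> x = 3" by (simp add: gens_iff)
    then show "pmf \<nu> (f, x) = P f / 2" using sym13[of f] by (auto simp: P_def)
  qed
  then show thesis using \<nu>(2)[symmetric] by (rule that)
qed

lemma law_reaches:
  assumes "gens \<subseteq> set_pmf \<nu>" "reduced st"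
  shows "\<exists>n. st \<in> set_pmf (law \<nu> n)"
proof -
  obtain ls where ls: "set ls \<subseteq> gens" "fold push ls [] = st" using ex_gens_word[OF assms(2)] by blast
  have "fold push ls [] \<in> set_pmf (law \<nu> (length ls))"
    using ls(1)
  proof (induction ls rule: rev_induct)
    case (snoc l ls)
    then have "fold push ls [] \<in> set_pmf (law \<nu> (length ls))" "l \<in> set_pmf \<nu>" using assms(1) by auto
    then show ?case by auto
  qed simp
  then show ?thesis using ls(2) by blast
qed

lemma uniform_walk:
  obtains \<nu> where "cone_walk (\<lambda>_. 1 / 2) (\<lambda>_. tau) (\<lambda>_. tau * tau) \<nu>"
    "map_pmf (\<lambda>l. cls [l]) \<nu> \<in> admissible G4 S4"
proof
  define \<nu> where "\<nu> = pmf_of_set gens"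
  define \<mu> where "\<mu> = map_pmf (\<lambda>l. cls [l]) \<nu>"
  have ne: "gens \<noteq> {}" by (simp add: gens_def)
  have card: "card gens = 4" by (simp add: gens_def)
  have supp: "set_pmf \<nu> = gens" unfolding \<nu>_def by (rule set_pmf_of_set[OF ne finite_gens])
  have val: "pmf \<nu> l = 1 / 4" if "l \<in> gens" for l
    using that ne finite_gens card unfolding \<nu>_def by (simp add: pmf_of_set)
  show "cone_walk (\<lambda>_. 1 / 2) (\<lambda>_. tau) (\<lambda>_. tau * tau) \<nu>"
    by (intro cone_walk.intro cone_params_golden cone_walk_axioms.intro) (simp_all add: supp val)
  have "\<mu> \<in> admissible G4 S4"
    unfolding admissible_def
  proof (intro CollectI conjI ballI)
    show "set_pmf \<mu> \<subseteq> S4" unfolding \<mu>_def set_map_pmf supp ..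
    have mu: "pmf \<mu> (cls [l]) = 1 / 4" if "l \<in> gens" for l
      unfolding \<mu>_def using pmf_map_cls[OF _ that, of \<nu>] supp val[OF that] by simp
    fix s assume "s \<in> S4"
    then obtain f x where s: "s = cls [(f, x)]" "(f, x) \<in> gens" by auto
    then have x: "x \<in> {1, 3}" by (simp add: gens_iff)
    then have s': "(f, 4 - x) \<in> gens" by (auto simp: gens_iff)
    show "pmf \<mu> s = pmf \<mu> (inv\<^bsub>G4\<^esub> s)"
      unfolding s(1) inv_cls_gen[OF x] mu[OF s(2)] mu[OF s'] ..
  next
    have law_in: "cls st \<in> carrier G4" if "st \<in> set_pmf (law \<nu> n)" for st n
      using law_reduced[of \<nu> st n] that supp by (intro cls_in_carrier) simp
    have cp: "set_pmf (conv_power G4 \<mu> n) = cls ` set_pmf (law \<nu> n)" for n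
      unfolding \<mu>_def using conv_power_law[of \<nu> n] supp by simp
    show "(\<Union>n\<in>{1..}. set_pmf (conv_power G4 \<mu> n)) = carrier G4"
    proof (intro subset_antisym subsetI)
      fix g assume "g \<in> (\<Union>n\<in>{1..}. set_pmf (conv_power G4 \<mu> n))"
      then show "g \<in> carrier G4" unfolding cp using law_in by blast
    next
      fix g assume "g \<in> carrier G4"
      then obtain st where st: "g = cls st" "reduced st" unfolding carrier_G4 by blast
      have "\<exists>n\<ge>1. st \<in> set_pmf (law \<nu> n)"
      proof (cases "st = []")
        \<comment> \<open>The union over the steps starts at n = 1, so the neutral element has to be
          reached by a genuine return, here in two steps.\<close>
        case True
        have g: "(True, 1) \<in> gens" "(True, 3) \<in> gens" by (simp_all add: gens_iff)
        have "push (True, 1) [] \<in> set_pmf (law \<nu> (Suc 0))"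
          using g(1) unfolding law.simps supp set_bind_pmf set_map_pmf set_return_pmf by blast
        then have "push (True, 3) (push (True, 1) []) \<in> set_pmf (law \<nu> (Suc (Suc 0)))"
          using g(2) unfolding law.simps(2)[of \<nu> "Suc 0"] supp set_bind_pmf set_map_pmf by blast
        moreover have "push (True, 3) (push (True, 1) []) = []" by simp
        ultimately show ?thesis using True by (intro exI[of _ "Suc (Suc 0)"]) simp
      next
        case False
        obtain n where n: "st \<in> set_pmf (law \<nu> n)" using law_reaches[OF _ st(2), of \<nu>] supp by blast
        then have "n \<noteq> 0" using False by (intro notI) simp
        then show ?thesis using n by (intro exI[of _ n]) simp
      qed
      then show "g \<in> (\<Union>n\<in>{1..}. set_pmf (conv_power G4 \<mu> n))" unfolding cp st(1) by auto
    qed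
  qed
  then show "map_pmf (\<lambda>l. cls [l]) \<nu> \<in> admissible G4 S4" unfolding \<mu>_def .
qed

lemma sup_ratio_G4: "sup_ratio G4 S4 = ereal (kap / ln (1 + sqrt 2))"
  unfolding sup_ratio_def
proof (rule antisym)
  show "(SUP \<mu>\<in>admissible G4 S4. ereal (walk_entropy G4 \<mu> / (drift G4 S4 \<mu> * volume_growth G4 S4)))
      \<le> ereal (kap / ln (1 + sqrt 2))"
  proof (rule SUP_least)
    fix \<mu> assume "\<mu> \<in> admissible G4 S4"
    then obtain P w \<alpha> \<nu> where c: "cone_walk P w \<alpha> \<nu>" and m: "\<mu> = map_pmf (\<lambda>l. cls [l]) \<nu>"
      by (rule ex_cone_walk)
    show "ereal (walk_entropy G4 \<mu> / (drift G4 S4 \<mu> * volume_growth G4 S4)) \<le> ereal (kap / ln (1 + sqrt 2))"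
      unfolding m using cone_walk_bounds(1)[OF c] by (simp only: ereal_less_eq)
  qed
  obtain \<nu> where c: "cone_walk (\<lambda>_. 1 / 2) (\<lambda>_. tau) (\<lambda>_. tau * tau) \<nu>"
    and a: "map_pmf (\<lambda>l. cls [l]) \<nu> \<in> admissible G4 S4"
    by (rule uniform_walk)
  show "ereal (kap / ln (1 + sqrt 2))
      \<le> (SUP \<mu>\<in>admissible G4 S4. ereal (walk_entropy G4 \<mu> / (drift G4 S4 \<mu> * volume_growth G4 S4)))"
    unfolding cone_walk_bounds(2)[OF c HOL.refl, symmetric] by (rule SUP_upper[OF a])
qed

theorem mainTheorem14:
  fixes s t :: int
    and G :: "(int + int) list set monoid"
    and a b :: "(int + int) list set"
    and S :: "(int + int) list set set"
  assumes "G = free_product (integer_mod_group 4) (integer_mod_group 4)"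
    and "s \<in> carrier (integer_mod_group 4)"
    and "generate (integer_mod_group 4) {s} = carrier (integer_mod_group 4)"
    and "t \<in> carrier (integer_mod_group 4)"
    and "generate (integer_mod_group 4) {t} = carrier (integer_mod_group 4)"
    and "a = free_prod_inl (integer_mod_group 4) (integer_mod_group 4) s"
    and "b = free_prod_inr (integer_mod_group 4) (integer_mod_group 4) t"
    and "S = {a, inv\<^bsub>G\<^esub> a, b, inv\<^bsub>G\<^esub> b}"
  shows "\<not> extremal G S \<and>
    sup_ratio G S = ereal ((5 + sqrt 5) / 4 * (ln (1 / 2 + sqrt 5 / 2) / ln (1 + sqrt 2))) \<and>
    0.987686 \<le> (5 + sqrt 5) / 4 * (ln (1 / 2 + sqrt 5 / 2) / ln (1 + sqrt 2)) \<and>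
    (5 + sqrt 5) / 4 * (ln (1 / 2 + sqrt 5 / 2) / ln (1 + sqrt 2)) < 0.987687 \<and>
    sup_ratio G S < 1"
proof -
  have "S = S4"
    unfolding assms(8) assms(1)
    by (rule generating_set_eq[OF generator_Z4[OF assms(2,3)] generator_Z4[OF assms(4,5)] assms(6,7)])
  moreover have q: "(5 + sqrt 5) / 4 * (ln (1 / 2 + sqrt 5 / 2) / ln (1 + sqrt 2)) = kap / ln (1 + sqrt 2)"
    by (simp add: kap_eq)
  ultimately have sup: "sup_ratio G S = ereal (kap / ln (1 + sqrt 2))"
    using sup_ratio_G4 assms(1) by simp
  have "kap / ln (1 + sqrt 2) < 0.987687" by (rule numeric_bounds(2))
  also have "\<dots> < 1" by simp
  finally have "kap / ln (1 + sqrt 2) < 1" .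
  then have "ereal (kap / ln (1 + sqrt 2)) < 1" by (simp only: one_ereal_def less_ereal.simps)
  then show ?thesis
    unfolding extremal_def sup q using numeric_bounds by auto
qed

end
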